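(* Let $\ell \geq 1$ be an integer, let $G$ be a graph on $n$ vertices, and let $(L,H,R)$ be a good partition of $V(G)$. Then for every partition $(I,O)$ of $H \cup R$, there are at most $2^{|L|}\cdot e^{-\frac{|L|}{2^{10\ell}\cdot 100\ell^2}}$ minimal $(I,O)$-extensions. Furthermore, all minimal $(I,O)$-extensions can be listed in time $2^{|L|}\cdot e^{-\frac{|L|}{2^{10\ell}\cdot 100\ell^2}}\cdot n^{\mathcal{O}(1)}$.
   Context: All graphs are finite and simple. For a fixed integer $\ell \geq 1$, a partition $(L,H,R)$ of $V(G)$ into three sets is a good partition if $|L| \geq 10|H|$, $L$ is an independent set in $G$, and every vertex of $L$ has fewer than $\ell$ neighbors in $R$. A vertex set $X$ is a connected dominating set of $G$ if every vertex not in $X$ has a neighbor in $X$ and $G[X]$ is connected. For disjoint vertex sets $I$ and $O$, an $(I,O)$-extension is a vertex set $S$ disjoint from $I \cup O$ such that $I \cup S$ is a connected dominating set of $G$; it is minimal if no proper subset of it is also an $(I,O)$-extension. *)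

theory Defs
  imports Complex_Main "Graph_Theory.Graph_Theory"
begin

section \<open>Graphs, good partitions and extensions\<close>

text \<open>
  Finite simple graphs are the \<^locale>\<open>pair_graph\<close>s of the library: finite, loopless digraphs
  whose arc relation is symmetric. An edge \<open>uv\<close> is the pair of arcs \<open>(u, v)\<close> and \<open>(v, u)\<close>.
  The parts of a partition may be empty.
\<close>

definition good_partition ::
  "nat \<Rightarrow> 'a pair_pre_digraph \<Rightarrow> 'a set \<Rightarrow> 'a set \<Rightarrow> 'a set \<Rightarrow> bool" where
  "good_partition l G L H R \<longleftrightarrow>
     L \<union> H \<union> R = pverts G \<and> L \<inter> H = {} \<and> L \<inter> R = {} \<and> H \<inter> R = {} \<and>
     card L \<ge> 10 * card H \<and>
     (\<forall>u\<in>L. \<forall>v\<in>L. (u, v) \<notin> parcs G) \<and>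
     (\<forall>v\<in>L. card {u \<in> R. (v, u) \<in> parcs G} < l)"

text \<open>The constant \<open>connected\<close> of the library requires a nonempty vertex set.\<close>

definition connected_dominating_set :: "'a pair_pre_digraph \<Rightarrow> 'a set \<Rightarrow> bool" where
  "connected_dominating_set G X \<longleftrightarrow>
     X \<subseteq> pverts G \<and>
     (\<forall>v \<in> pverts G - X. \<exists>u\<in>X. (v, u) \<in> parcs G) \<and>
     Digraph_Component.connected (with_proj G \<restriction> X)"

definition extension ::
  "'a pair_pre_digraph \<Rightarrow> 'a set \<Rightarrow> 'a set \<Rightarrow> 'a set \<Rightarrow> bool" where
  "extension G I O' S \<longleftrightarrow>
     S \<subseteq> pverts G \<and> S \<inter> (I \<union> O') = {} \<and> connected_dominating_set G (I \<union> S)"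

definition minimal_extension ::
  "'a pair_pre_digraph \<Rightarrow> 'a set \<Rightarrow> 'a set \<Rightarrow> 'a set \<Rightarrow> bool" where
  "minimal_extension G I O' S \<longleftrightarrow>
     extension G I O' S \<and> (\<forall>T. T \<subset> S \<longrightarrow> \<not> extension G I O' T)"


section \<open>Machine model\<close>

text \<open>
  Running time is measured on a random access machine with structured control flow.
  It has registers and an unbounded memory with indirect addressing, all holding natural numbers,
  and a write-only output stream; every instruction and every test takes one time unit.
  The only arithmetic is successor and predecessor, so after \<open>t\<close> steps no number exceeds \<open>t\<close> plus
  the largest number in the input or the program. Hence the unit cost does not hide any
  computation on long numbers: for times of the form \<open>2\<^sup>O\<^sup>(\<^sup>n\<^sup>)\<close> the numbers have polynomially many
  bits, and the model agrees with the logarithmic-cost RAM up to a factor polynomial in \<open>n\<close>.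
\<close>

datatype com =
    Skip
  | Const nat nat      \<comment> \<open>\<open>r := k\<close>\<close>
  | Copy nat nat       \<comment> \<open>\<open>r := s\<close>\<close>
  | Inc nat            \<comment> \<open>\<open>r := r + 1\<close>\<close>
  | Dec nat            \<comment> \<open>\<open>r := r - 1\<close>, truncated at 0\<close>
  | Load nat nat       \<comment> \<open>\<open>r := mem[a]\<close>\<close>
  | Store nat nat      \<comment> \<open>\<open>mem[a] := r\<close>\<close>
  | Print nat
  | Seq com com
  | IfLess nat nat com com
  | WhileLess nat nat com

record state =
  reg :: "nat \<Rightarrow> nat"
  mem :: "nat \<Rightarrow> nat"
  out :: "nat list"

text \<open>\<open>exec c s t s'\<close>: started in \<open>s\<close>, the program \<open>c\<close> halts after exactly \<open>t\<close> steps in \<open>s'\<close>.\<close>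

inductive exec :: "com \<Rightarrow> state \<Rightarrow> nat \<Rightarrow> state \<Rightarrow> bool" where
  Skip: "exec Skip s 1 s"
| Const: "exec (Const r k) s 1 (s\<lparr>reg := (reg s)(r := k)\<rparr>)"
| Copy: "exec (Copy r r') s 1 (s\<lparr>reg := (reg s)(r := reg s r')\<rparr>)"
| Inc: "exec (Inc r) s 1 (s\<lparr>reg := (reg s)(r := reg s r + 1)\<rparr>)"
| Dec: "exec (Dec r) s 1 (s\<lparr>reg := (reg s)(r := reg s r - 1)\<rparr>)"
| Load: "exec (Load r a) s 1 (s\<lparr>reg := (reg s)(r := mem s (reg s a))\<rparr>)"
| Store: "exec (Store a r) s 1 (s\<lparr>mem := (mem s)(reg s a := reg s r)\<rparr>)"
| Print: "exec (Print r) s 1 (s\<lparr>out := out s @ [reg s r]\<rparr>)"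
| Seq: "exec c s t s' \<Longrightarrow> exec d s' t' s'' \<Longrightarrow> exec (Seq c d) s (t + t') s''"
| IfTrue: "reg s r < reg s r' \<Longrightarrow> exec c s t s' \<Longrightarrow> exec (IfLess r r' c d) s (1 + t) s'"
| IfFalse: "\<not> reg s r < reg s r' \<Longrightarrow> exec d s t s' \<Longrightarrow> exec (IfLess r r' c d) s (1 + t) s'"
| WhileTrue: "reg s r < reg s r' \<Longrightarrow> exec c s t s' \<Longrightarrow> exec (WhileLess r r' c) s' t' s'' \<Longrightarrow>
    exec (WhileLess r r' c) s (1 + t + t') s''"
| WhileFalse: "\<not> reg s r < reg s r' \<Longrightarrow> exec (WhileLess r r' c) s 1 s"

inductive_cases exec_basicE:
  "exec Skip s t s'" "exec (Const r k) s t s'" "exec (Copy r r') s t s'" "exec (Inc r) s t s'"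
  "exec (Dec r) s t s'" "exec (Load r a) s t s'" "exec (Store a r) s t s'" "exec (Print r) s t s'"

inductive_cases exec_SeqE: "exec (Seq c d) s t s'"
inductive_cases exec_IfLessE: "exec (IfLess r r' c d) s t s'"
inductive_cases exec_WhileLessE: "exec (WhileLess r r' c) s t s'"

lemma exec_deterministic:
  "exec c s t s' \<Longrightarrow> exec c s u s'' \<Longrightarrow> t = u \<and> s' = s''"
proof (induction arbitrary: u s'' rule: exec.induct)
  case (Seq c s t s' d t' s'')
  show ?case by (rule exec_SeqE[OF Seq.prems]) (use Seq.IH in \<open>metis plus_1_eq_Suc add_Suc One_nat_def add_0\<close>)
next
  case (IfTrue s r r' c t s' d)
  show ?case by (rule exec_IfLessE[OF IfTrue.prems]) (use IfTrue.IH IfTrue.hyps in \<open>metis plus_1_eq_Suc add_Suc One_nat_def add_0\<close>)+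
next
  case (IfFalse s r r' d t s' c)
  show ?case by (rule exec_IfLessE[OF IfFalse.prems]) (use IfFalse.IH IfFalse.hyps in \<open>metis plus_1_eq_Suc add_Suc One_nat_def add_0\<close>)+
next
  case (WhileTrue s r r' c t s' t' s'')
  show ?case by (rule exec_WhileLessE[OF WhileTrue.prems]) (use WhileTrue.IH WhileTrue.hyps in \<open>metis plus_1_eq_Suc add_Suc One_nat_def add_0\<close>)+
next
  case (WhileFalse s r r' c)
  show ?case by (rule exec_WhileLessE[OF WhileFalse.prems]) (use WhileFalse.hyps in \<open>metis plus_1_eq_Suc add_Suc One_nat_def add_0\<close>)+
qed (erule exec_basicE, simp)+

definition initial_state :: "nat list \<Rightarrow> state" where
  "initial_state xs =
     \<lparr>reg = (\<lambda>_. 0), mem = (\<lambda>i. if i < length xs then xs ! i else 0), out = []\<rparr>"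

definition computes_in_time :: "com \<Rightarrow> nat list \<Rightarrow> nat list \<Rightarrow> nat \<Rightarrow> bool" where
  "computes_in_time P xs ys t \<longleftrightarrow> (\<exists>s. exec P (initial_state xs) t s \<and> out s = ys)"


section \<open>Encoding of instances and of listings\<close>

text \<open>
  The list \<open>vs\<close> is an arbitrary numbering of the vertices. An instance consists of the number of
  vertices, \<open>\<ell>\<close>, the characteristic vectors of the five vertex sets, and the adjacency matrix.
\<close>

definition encode_instance ::
  "'a list \<Rightarrow> nat \<Rightarrow> 'a pair_pre_digraph \<Rightarrow>
     'a set \<Rightarrow> 'a set \<Rightarrow> 'a set \<Rightarrow> 'a set \<Rightarrow> 'a set \<Rightarrow> nat list" where
  "encode_instance vs l G L H R I O' =
     [length vs, l] @
     concat (map (\<lambda>X. map (\<lambda>v. of_bool (v \<in> X)) vs) [L, H, R, I, O']) @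
     concat (map (\<lambda>u. map (\<lambda>v. of_bool ((u, v) \<in> parcs G)) vs) vs)"

text \<open>
  A vertex set is printed as the increasing sequence of the numbers of its elements, where vertex
  \<open>vs ! i\<close> has number \<open>i + 1\<close>, terminated by 0.
\<close>

definition encode_set :: "'a list \<Rightarrow> 'a set \<Rightarrow> nat list" where
  "encode_set vs S = map Suc (filter (\<lambda>i. vs ! i \<in> S) [0..<length vs]) @ [0]"

definition is_listing :: "'a list \<Rightarrow> 'a set set \<Rightarrow> nat list \<Rightarrow> bool" where
  "is_listing vs F ys \<longleftrightarrow>
     (\<exists>Ss. distinct Ss \<and> set Ss = F \<and> ys = concat (map (encode_set vs) Ss))"

end

theory Submission
  imports Defs
begin

text \<open>
  Call the components of \<open>G[I]\<close> (if there are at least two) and the vertices of \<open>O\<close> without a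
  neighbour in \<open>I\<close> objects. Every extension meets the neighbourhood in \<open>L\<close> of every object, and a
  minimal extension has at most as many elements as there are objects. At most \<open>|L|/10\<close> objects
  meet \<open>H\<close>, and, counting edges between \<open>L\<close> and \<open>R\<close>, at most \<open>|L|/10\<close> of the others have more than
  \<open>10\<ell>\<close> neighbours in \<open>L\<close>. If there are at least \<open>|L|/10\<close> remaining objects, then at least
  \<open>|L|/(100\<ell>\<^sup>2)\<close> of them have disjoint neighbourhoods of size at most \<open>10\<ell>\<close>, and each of these rules
  out a fraction \<open>2\<^sup>-\<^sup>1\<^sup>0\<^sup>\<ell>\<close> of the subsets of \<open>L\<close>. Otherwise there are at most \<open>3|L|/10\<close> objects, and few
  subsets of \<open>L\<close> are that small.

  The algorithm decides the vertices of \<open>L\<close> one by one and abandons a branch as soon as the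
  vertices not yet discarded fail to form an extension or more vertices are chosen than there are
  objects. The two bounds above apply verbatim to the surviving branches of each level of the
  search tree, so the tree needs no knowledge of the disjoint family.
\<close>

section \<open>Connected dominating sets\<close>

text \<open>Two facts carry both halves. A superset of a connected dominating set is again one, so
  the set of all vertices not yet discarded fails the test only if no extension lies below, and
  minimality can be tested by single deletions. And \<open>L\<close> is independent: once
  \<open>I\<close> is nonempty and an extension exists, every vertex of \<open>L\<close> has a
  neighbour in \<open>I\<close>. Chosen vertices thus never need one another, and one vertex per
  merge of components plus one per undominated vertex is enough.

  On the constants: a neighbourhood of at most \<open>10 * l\<close> points, each lying in at most
  \<open>l\<close> neighbourhoods, meets at most \<open>10 * l * l\<close> of them; one more factor
  10 comes from the tenth of \<open>card L\<close>, which gives \<open>100 * l\<^sup>2\<close>. When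
  objects are few, a weighting argument gives a base of 2^(3/10) * 3/2 < 1.85, while the base of the
  claimed bound is at least 100/51 > 1.96.

  The obstacle for the running time is that all search nodes have to be paid for, not only the
  leaves. A surviving node is charged to the extension it represents or to its small set of choices;
  doing this level by level costs a factor \<open>n\<close>.\<close>

definition comp_rel :: "'a rel \<Rightarrow> 'a set \<Rightarrow> 'a rel" where
  "comp_rel E X = {(x, y). x \<in> X \<and> y \<in> X \<and> (x, y) \<in> (Restr E X)\<^sup>*}"

definition ncomp :: "'a rel \<Rightarrow> 'a set \<Rightarrow> nat" where
  "ncomp E X = card (X // comp_rel E X)"

definition undom :: "'a rel \<Rightarrow> 'a set \<Rightarrow> 'a set \<Rightarrow> 'a set" where
  "undom E V X = {v \<in> V - X. \<forall>u\<in>X. (v, u) \<notin> E}"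

definition cds :: "'a rel \<Rightarrow> 'a set \<Rightarrow> 'a set \<Rightarrow> bool" where
  "cds E V X \<longleftrightarrow> X \<subseteq> V \<and> undom E V X = {} \<and> X \<noteq> {} \<and> X \<times> X \<subseteq> comp_rel E X"

text \<open>The plain closure is reflexive at every point, \<open>rtrancl_on X\<close> only inside
  \<open>X\<close>; the membership conjuncts make up the difference.\<close>

lemma rtrancl_on_Restr:
  "(u, v) \<in> rtrancl_on X (Restr E X) \<longleftrightarrow> u \<in> X \<and> v \<in> X \<and> (u, v) \<in> (Restr E X)\<^sup>*"
proof
  assume "(u, v) \<in> rtrancl_on X (Restr E X)"
  then show "u \<in> X \<and> v \<in> X \<and> (u, v) \<in> (Restr E X)\<^sup>*"
  proof (induction rule: rtrancl_on_induct)
    case (step x y)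
    then show ?case using rtrancl_into_rtrancl[of u x "Restr E X" y] by blast
  qed simp
next
  assume a: "u \<in> X \<and> v \<in> X \<and> (u, v) \<in> (Restr E X)\<^sup>*"
  then have "(u, v) \<in> (Restr E X)\<^sup>*" "u \<in> X" by auto
  then show "(u, v) \<in> rtrancl_on X (Restr E X)"
  proof (induction rule: rtrancl_induct)
    case (step y z)
    then have "(y, z) \<in> Restr E X" "z \<in> X" by auto
    then show ?case using step.IH[OF step.prems] by (rule rtrancl_on_into_rtrancl_on[rotated])
  qed simp
qed

text \<open>Library connectedness is strong connectedness of the symmetric closure. The arcs here
  are symmetric already, so it amounts to reachability along \<open>Restr\<close>.\<close>

lemma connected_dominating_set_iff_cds:
  assumes "pair_graph G"
  shows "connected_dominating_set G X \<longleftrightarrow> cds (parcs G) (pverts G) X"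
proof -
  interpret pair_graph G by fact
  have sym: "(v, u) \<in> parcs G" if "(u, v) \<in> parcs G" for u v
    using that sym_arcs by (auto simp: symmetric_def dest: symD)
  have arcs: "parcs (mk_symmetric (with_proj G \<restriction> X)) = Restr (parcs G) X"
    using sym by (auto simp: parcs_mk_symmetric)
  have "Digraph_Component.connected (with_proj G \<restriction> X) \<longleftrightarrow>
      X \<noteq> {} \<and> X \<times> X \<subseteq> comp_rel (parcs G) X"
    unfolding Digraph_Component.connected_def strongly_connected_def reachable_def
    by (auto simp: arcs rtrancl_on_Restr comp_rel_def)
  then show ?thesis
    by (auto simp: connected_dominating_set_def cds_def undom_def)
qed

lemma equiv_comp_rel:
  assumes "sym E"
  shows "equiv X (comp_rel E X)"
proof (intro equivI refl_onI symI transI)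
  have "sym ((Restr E X)\<^sup>*)"
    using assms by (intro sym_rtrancl sym_Int) (auto simp: sym_def)
  then show "(y, x) \<in> comp_rel E X" if "(x, y) \<in> comp_rel E X" for x y
    using that symD[of "(Restr E X)\<^sup>*" x y] by (simp add: comp_rel_def)
  show "(x, z) \<in> comp_rel E X" if "(x, y) \<in> comp_rel E X" "(y, z) \<in> comp_rel E X" for x y z
    using that rtrancl_trans[of x y "Restr E X" z] by (simp add: comp_rel_def)
qed (auto simp: comp_rel_def)

lemma comp_rel_mono: "X \<subseteq> Y \<Longrightarrow> comp_rel E X \<subseteq> comp_rel E Y"
  unfolding comp_rel_def using rtrancl_mono[of "Restr E X" "Restr E Y"] by blast

lemma comp_rel_edge: "(x, y) \<in> E \<Longrightarrow> x \<in> X \<Longrightarrow> y \<in> X \<Longrightarrow> (x, y) \<in> comp_rel E X"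
  by (auto simp: comp_rel_def)

lemma comp_rel_trans: "(x, y) \<in> comp_rel E X \<Longrightarrow> (y, z) \<in> comp_rel E X \<Longrightarrow> (x, z) \<in> comp_rel E X"
  using rtrancl_trans[of x y "Restr E X" z] by (simp add: comp_rel_def)

lemma comp_rel_sym: "sym E \<Longrightarrow> (x, y) \<in> comp_rel E X \<Longrightarrow> (y, x) \<in> comp_rel E X"
  using equiv_comp_rel[of E X] by (meson equivE symD)

lemma card_quotient_eq_1_iff:
  assumes "equiv X r" "finite X"
  shows "card (X // r) = 1 \<longleftrightarrow> X \<noteq> {} \<and> X \<times> X \<subseteq> r"
proof
  assume "card (X // r) = 1"
  then obtain C where C: "X // r = {C}" by (rule card_1_singletonE)
  have "(x, y) \<in> r" if "x \<in> X" "y \<in> X" for x y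
  proof -
    have "r `` {x} \<in> {C}" "r `` {y} \<in> {C}" using quotientI that C by metis+
    then have "r `` {x} = r `` {y}" by simp
    then show ?thesis using assms(1) that by (simp add: eq_equiv_class)
  qed
  with C show "X \<noteq> {} \<and> X \<times> X \<subseteq> r" by auto
next
  assume a: "X \<noteq> {} \<and> X \<times> X \<subseteq> r"
  then have "r `` {x} = X" if "x \<in> X" for x
    using assms(1) that by (auto simp: equiv_def refl_on_def)
  then have "X // r = {X}" using a by (auto simp: quotient_def)
  then show "card (X // r) = 1" by simp
qed

text \<open>The form in which the machine performs the test, by strict comparisons: once there is a
  component, the sum is below 2 only with one component and nothing undominated. The empty set is
  excluded by having no component.\<close>

lemma cds_iff_counts:
  assumes "finite V" "sym E" "X \<subseteq> V"
  shows "cds E V X \<longleftrightarrow> 0 < ncomp E X \<and> ncomp E X + card (undom E V X) < 2"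
proof -
  have fin: "finite X" "finite (undom E V X)"
    using assms finite_subset by (auto simp: undom_def)
  have "ncomp E X = 1 \<longleftrightarrow> X \<noteq> {} \<and> X \<times> X \<subseteq> comp_rel E X"
    unfolding ncomp_def by (intro card_quotient_eq_1_iff equiv_comp_rel assms fin)
  moreover have "card (undom E V X) = 0 \<longleftrightarrow> undom E V X = {}" using fin by simp
  ultimately show ?thesis using assms(3) unfolding cds_def by linarith
qed

section \<open>Connecting \<open>I\<close> by few vertices of an independent set\<close>

lemma card_quotient_less:
  assumes "equiv X r" "equiv X r'" "finite X" "r \<subset> r'"
  shows "card (X // r') < card (X // r)"
proof -
  have sub: "r \<subseteq> X \<times> X" "r' \<subseteq> X \<times> X"
    using assms(1,2) by (auto simp: equiv_def refl_on_def)
  obtain a b where ab: "(a, b) \<in> r'" "(a, b) \<notin> r" using assms(4) by auto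
  have abX: "a \<in> X" "b \<in> X" using ab sub by auto
  have fin: "finite (X // r)" using assms(3) sub(1) by (rule finite_quotient)
  have img: "(\<lambda>C. r' `` C) (r `` {x}) = r' `` {x}" if "x \<in> X" for x
    using assms that
    by (auto simp: equiv_def refl_on_def) (meson subset_iff psubsetE transE assms(4))+
  \<comment> \<open>Saturation under \<open>r'\<close> maps the finer quotient onto the coarser one,
    and the classes of \<open>a\<close> and \<open>b\<close> collide, so the image is strictly
    smaller.\<close>
  have "X // r' = (\<lambda>C. r' `` C) ` (X // r)"
  proof -
    have "X // r' = (\<lambda>x. r' `` {x}) ` X" by (auto simp: quotient_def)
    also have "\<dots> = (\<lambda>x. r' `` (r `` {x})) ` X" using img by (intro image_cong) auto
    also have "\<dots> = (\<lambda>C. r' `` C) ` (X // r)" by (auto simp: quotient_def)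
    finally show ?thesis .
  qed
  moreover have "\<not> inj_on (\<lambda>C. r' `` C) (X // r)"
  proof
    assume "inj_on (\<lambda>C. r' `` C) (X // r)"
    moreover have "r' `` (r `` {a}) = r' `` (r `` {b})"
      using img abX ab(1) assms(2) by (simp add: equiv_class_eq)
    ultimately have "r `` {a} = r `` {b}"
      using abX by (meson inj_onD quotientI)
    then show False using assms(1) abX ab(2) by (simp add: eq_equiv_class)
  qed
  ultimately show ?thesis
    using fin by (metis card_image_le eq_card_imp_inj_on le_neq_implies_less)
qed

text \<open>Adding vertices that each merge classes of \<open>I\<close> must stop after
  \<open>ncomp E I - 1\<close> additions. The greedy process is replaced by a maximal set whose size
  is at most the number of classes it has merged away.\<close>

lemma connecting_subset_exists:
  assumes fin: "finite I" "finite S" and sym: "sym E" and ne: "I \<noteq> {}"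
    and indep: "\<forall>u\<in>S. \<forall>v\<in>S. (u, v) \<notin> E"
    and conn: "I \<times> I \<subseteq> comp_rel E (I \<union> S)"
  obtains T where "T \<subseteq> S" "I \<times> I \<subseteq> comp_rel E (I \<union> T)" "card T \<le> ncomp E I - 1"
proof -
  \<comment> \<open>Connectivity in \<open>I \<union> T\<close> is traced on \<open>I\<close>, so
    that vertices of \<open>T\<close> never form classes of their own.\<close>
  define K where "K T = comp_rel E (I \<union> T) \<inter> I \<times> I" for T
  have eqK: "equiv I (K T)" for T
  proof (intro equivI refl_onI symI transI)
    show "K T \<subseteq> I \<times> I" "\<And>x. x \<in> I \<Longrightarrow> (x, x) \<in> K T"
      by (auto simp: K_def comp_rel_def)
    show "(y, x) \<in> K T" if "(x, y) \<in> K T" for x y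
      using that comp_rel_sym[OF sym] by (auto simp: K_def)
    show "(x, z) \<in> K T" if "(x, y) \<in> K T" "(y, z) \<in> K T" for x y z
      using that comp_rel_trans by (auto simp: K_def)
  qed
  have K0: "K {} = comp_rel E I" by (auto simp: K_def comp_rel_def)
  define \<T> where "\<T> = {T. T \<subseteq> S \<and> card T + card (I // K T) \<le> ncomp E I}"
  have "{} \<in> \<T>" by (simp add: \<T>_def K0 ncomp_def)
  moreover have "finite \<T>" using fin by (simp add: \<T>_def)
  ultimately obtain T where T: "T \<in> \<T>" and max: "\<forall>T'\<in>\<T>. T \<subseteq> T' \<longrightarrow> T = T'"
    using finite_has_maximal[of \<T>] by auto
  have TS: "T \<subseteq> S" and finT: "finite T" using T fin finite_subset by (auto simp: \<T>_def)
  have stuck: "K (insert v T) = K T" if "v \<in> S" for v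
  proof (rule ccontr)
    assume ne: "K (insert v T) \<noteq> K T"
    have "K T \<subseteq> K (insert v T)"
      unfolding K_def using comp_rel_mono[of "I \<union> T" "I \<union> insert v T" E] by blast
    with ne have "K T \<subset> K (insert v T)" by auto
    then have "card (I // K (insert v T)) < card (I // K T)"
      by (intro card_quotient_less eqK fin)
    then have "insert v T \<in> \<T>"
      using T that finT by (auto simp: \<T>_def card_insert_if)
    then have "v \<in> T" using max by blast
    then show False using ne by (simp add: insert_absorb)
  qed
  text \<open>Since \<open>S\<close> is independent, a path through \<open>I \<union> S\<close> visits \<open>S\<close> only between two vertices of \<open>I\<close>,
    which are therefore already joined in \<open>I \<union> T\<close>.\<close>
  have path: "(y \<in> I \<longrightarrow> (x, y) \<in> K T) \<and> (y \<in> S \<longrightarrow> y \<notin> I \<longrightarrow> (\<exists>z\<in>I. (z, y) \<in> E \<and> (x, z) \<in> K T))"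
    if "(x, y) \<in> (Restr E (I \<union> S))\<^sup>*" "x \<in> I" for x y
    using that
  proof (induction rule: rtrancl_induct)
    case base
    then show ?case using eqK[of T] by (auto simp: equiv_def refl_on_def)
  next
    case (step y z)
    have yz: "(y, z) \<in> E" "y \<in> I \<union> S" "z \<in> I \<union> S" using step by auto
    have tr: "(x, b) \<in> K T" if "(x, a) \<in> K T" "(a, b) \<in> K T" for a b
      using that eqK[of T] by (meson equivE transE)
    show ?case
    proof (cases "y \<in> I")
      case True
      then have xy: "(x, y) \<in> K T" using step by auto
      have "(x, z) \<in> K T" if "z \<in> I"
        using tr[OF xy] True that yz comp_rel_edge[of y z E "I \<union> T"] by (auto simp: K_def)
      then show ?thesis using xy True yz by auto
    next
      case False
      then have y: "y \<in> S" using yz by auto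
      then obtain w where w: "w \<in> I" "(w, y) \<in> E" "(x, w) \<in> K T" using step False by auto
      have z: "z \<in> I" using y yz indep by auto
      have "(w, z) \<in> comp_rel E (I \<union> insert y T)"
        using w z yz by (intro comp_rel_trans[OF comp_rel_edge[of w y] comp_rel_edge[of y z]]) auto
      then have "(w, z) \<in> K T" using stuck[OF y] w z by (auto simp: K_def)
      then show ?thesis using tr[OF w(3)] z yz y w
        by auto
    qed
  qed
  have full: "I \<times> I \<subseteq> K T"
  proof
    fix p assume "p \<in> I \<times> I"
    then obtain x y where p: "p = (x, y)" "x \<in> I" "y \<in> I" by auto
    then have "(x, y) \<in> (Restr E (I \<union> S))\<^sup>*" using conn by (auto simp: comp_rel_def)
    then show "p \<in> K T" using path p by auto
  qed
  then have "card (I // K T) = 1"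
    using card_quotient_eq_1_iff[OF eqK fin(1), of T] ne by auto
  then have "card T \<le> ncomp E I - 1" using T by (auto simp: \<T>_def)
  with that[OF TS] full show ?thesis by (auto simp: K_def)
qed

section \<open>Counting subsets and extracting disjoint families\<close>

lemma card_hitting_subsets_le:
  fixes N :: "'b \<Rightarrow> 'a set"
  assumes "finite W" "finite L" "\<forall>w\<in>W. N w \<subseteq> L \<and> card (N w) \<le> a"
    and "\<forall>w\<in>W. \<forall>w'\<in>W. w \<noteq> w' \<longrightarrow> N w \<inter> N w' = {}"
  shows "real (card {S. S \<subseteq> L \<and> (\<forall>w\<in>W. S \<inter> N w \<noteq> {})}) \<le> 2 ^ card L * (1 - 1 / 2 ^ a) ^ card W"
  using assms
proof (induction W arbitrary: L rule: finite_induct)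
  case empty
  have "{S. S \<subseteq> L} = Pow L" by auto
  then show ?case using empty by (simp add: card_Pow)
next
  case (insert w W)
  let ?F = "\<lambda>L W. {S. S \<subseteq> L \<and> (\<forall>w\<in>W. S \<inter> N w \<noteq> {})}"
  let ?L = "L - N w"
  have Nw: "N w \<subseteq> L" "card (N w) \<le> a" "finite (N w)"
    using insert.prems finite_subset by auto
  have IH: "real (card (?F ?L W)) \<le> 2 ^ card ?L * (1 - 1 / 2 ^ a) ^ card W"
  proof (rule insert.IH)
    show "\<forall>w\<in>W. N w \<subseteq> ?L \<and> card (N w) \<le> a"
    proof
      fix v assume v: "v \<in> W"
      then have "N v \<inter> N w = {}" using insert.prems(3) insert.hyps(2) by (metis insertCI)
      then show "N v \<subseteq> ?L \<and> card (N v) \<le> a" using v insert.prems(2) by auto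
    qed
  qed (use insert.prems in auto)
  \<comment> \<open>\<open>S\<close> is coded by its trace on \<open>N w\<close> and the rest. The
    rest still hits the other neighbourhoods, which are disjoint from \<open>N w\<close>; the
    forbidden empty trace yields the factor \<open>1 - 1 / 2 ^ a\<close>.\<close>
  have "inj_on (\<lambda>S. (S \<inter> N w, S - N w)) (?F L (insert w W))"
    by (rule inj_onI) (metis Un_Diff_Int Pair_inject)
  moreover have "(\<lambda>S. (S \<inter> N w, S - N w)) ` ?F L (insert w W) \<subseteq> (Pow (N w) - {{}}) \<times> ?F ?L W"
  proof (intro image_subsetI)
    fix S assume S: "S \<in> ?F L (insert w W)"
    have "(S - N w) \<inter> N w' = S \<inter> N w'" if "w' \<in> W" for w'
      using insert.prems(3) insert.hyps(2) that by (metis Diff_Int_distrib2 Diff_empty insertCI)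
    with S show "(S \<inter> N w, S - N w) \<in> (Pow (N w) - {{}}) \<times> ?F ?L W" by auto
  qed
  moreover have "finite ((Pow (N w) - {{}}) \<times> ?F ?L W)" using Nw insert.prems by simp
  ultimately have "card (?F L (insert w W)) \<le> card ((Pow (N w) - {{}}) \<times> ?F ?L W)"
    by (intro card_inj_on_le)
  then have "card (?F L (insert w W)) \<le> card (Pow (N w) - {{}}) * card (?F ?L W)"
    by (simp only: card_cartesian_product)
  then have "real (card (?F L (insert w W))) \<le> real (card (Pow (N w) - {{}})) * real (card (?F ?L W))"
    unfolding of_nat_mult[symmetric] of_nat_le_iff .
  also have "real (card (Pow (N w) - {{}})) = 2 ^ card (N w) - 1"
    using Nw by (simp add: card_Pow of_nat_diff)
  also have "(2 ^ card (N w) - 1) * real (card (?F ?L W)) \<le>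
      (2 ^ card (N w) * (1 - 1 / 2 ^ a)) * (2 ^ card ?L * (1 - 1 / 2 ^ a) ^ card W)"
  proof (intro mult_mono IH)
    have "(2::real) ^ card (N w) \<le> 2 ^ a" using Nw by (intro power_increasing) auto
    then show "2 ^ card (N w) - 1 \<le> 2 ^ card (N w) * (1 - 1 / 2 ^ a :: real)"
      by (simp add: field_simps)
  qed auto
  also have "\<dots> = 2 ^ (card (N w) + card ?L) * (1 - 1 / 2 ^ a) ^ Suc (card W)"
    by (simp add: power_add)
  also have "card (N w) + card ?L = card L"
    using Nw insert.prems by (simp add: card_Diff_subset card_mono)
  finally show ?case using insert.hyps by simp
qed

lemma sum_Pow_power_card:
  fixes x :: "'b :: comm_semiring_1"
  assumes "finite A"
  shows "(\<Sum>T\<in>Pow A. x ^ card T) = (1 + x) ^ card A"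
  using assms
proof (induction A rule: finite_induct)
  case (insert a A)
  have inj: "inj_on (insert a) (Pow A)" using insert.hyps by (auto simp: inj_on_def)
  have "(\<Sum>T\<in>Pow (insert a A). x ^ card T) =
      (\<Sum>T\<in>Pow A. x ^ card T) + (\<Sum>T\<in>insert a ` Pow A. x ^ card T)"
    unfolding Pow_insert using insert.hyps by (intro sum.union_disjoint) auto
  also have "(\<Sum>T\<in>insert a ` Pow A. x ^ card T) = (\<Sum>T\<in>Pow A. x ^ card (insert a T))"
    using inj by (simp add: sum.reindex)
  also have "\<dots> = (\<Sum>T\<in>Pow A. x * x ^ card T)"
  proof (intro sum.cong refl)
    fix T assume "T \<in> Pow A"
    then have "finite T" "a \<notin> T" using insert.hyps finite_subset by auto
    then show "x ^ card (insert a T) = x * x ^ card T" by simp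
  qed
  finally show ?case using insert by (simp add: sum_distrib_left[symmetric] algebra_simps)
qed simp

text \<open>Exponential weighting: every counted set has weight
  \<open>2 ^ m * (1 / 2) ^ card T\<close> at least 1, and the weights of all subsets sum to the
  right-hand side. The weight 1/2 leaves enough room in \<open>small_subsets_bound\<close>.\<close>

lemma card_small_subsets_le:
  assumes "finite A"
  shows "real (card {T. T \<subseteq> A \<and> card T \<le> m}) \<le> 2 ^ m * (3 / 2) ^ card A"
proof -
  let ?F = "{T. T \<subseteq> A \<and> card T \<le> m}"
  have "real (card ?F) = (\<Sum>T\<in>?F. 1)" by simp
  also have "\<dots> \<le> (\<Sum>T\<in>?F. 2 ^ m * (1 / 2) ^ card T)"
  proof (rule sum_mono)
    fix T assume "T \<in> ?F"
    then have "(2::real) ^ card T \<le> 2 ^ m" by (auto intro: power_increasing)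
    then show "1 \<le> 2 ^ m * (1 / 2 :: real) ^ card T" by (simp add: field_simps)
  qed
  also have "\<dots> \<le> (\<Sum>T\<in>Pow A. 2 ^ m * (1 / 2) ^ card T)"
    using assms by (intro sum_mono2) auto
  also have "\<dots> = 2 ^ m * (3 / 2) ^ card A"
    using sum_Pow_power_card[OF assms, of "1 / 2 :: real"] by (simp add: sum_distrib_left[symmetric])
  finally show ?thesis .
qed

text \<open>Take a maximal disjoint subfamily: every other member shares a point with a chosen one.
  A chosen member has at most \<open>a\<close> points, each in at most \<open>b\<close> members, so
  it accounts for at most \<open>a * b\<close> elements of \<open>W\<close>.\<close>

lemma disjoint_subfamily_exists:
  fixes N :: "'b \<Rightarrow> 'a set"
  assumes "finite W" "\<forall>w\<in>W. finite (N w) \<and> card (N w) \<le> a"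
    and deg: "\<forall>x. card {w \<in> W. x \<in> N w} \<le> b" and "1 \<le> a * b"
  obtains W' where "W' \<subseteq> W" "\<forall>w\<in>W'. \<forall>w'\<in>W'. w \<noteq> w' \<longrightarrow> N w \<inter> N w' = {}"
    "card W \<le> a * b * card W'"
proof -
  define \<D> where "\<D> = {W'. W' \<subseteq> W \<and> (\<forall>w\<in>W'. \<forall>w'\<in>W'. w \<noteq> w' \<longrightarrow> N w \<inter> N w' = {})}"
  have "finite \<D>" "{} \<in> \<D>" using assms(1) by (auto simp: \<D>_def)
  then obtain W' where W': "W' \<in> \<D>" and max: "\<forall>W''\<in>\<D>. W' \<subseteq> W'' \<longrightarrow> W' = W''"
    using finite_has_maximal[of \<D>] by auto
  have sub: "W' \<subseteq> W" and finW': "finite W'" using W' assms(1) finite_subset by (auto simp: \<D>_def)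
  \<comment> \<open>The singleton covers \<open>w'\<close> itself when \<open>N w'\<close> is empty;
    this case is why \<open>1 \<le> a * b\<close> is assumed.\<close>
  define K where "K w' = {w'} \<union> (\<Union>x\<in>N w'. {w \<in> W. x \<in> N w})" for w'
  have "W \<subseteq> (\<Union>w'\<in>W'. K w')"
  proof
    fix w assume w: "w \<in> W"
    show "w \<in> (\<Union>w'\<in>W'. K w')"
    proof (cases "w \<in> W'")
      case False
      then have "insert w W' \<notin> \<D>" using max by blast
      then obtain w' where "w' \<in> W'" "N w \<inter> N w' \<noteq> {}"
        using W' w unfolding \<D>_def by blast
      then show ?thesis using w by (auto simp: K_def)
    qed (auto simp: K_def)
  qed
  then have "card W \<le> card (\<Union>w'\<in>W'. K w')"
    using assms(1,2) finW' sub by (intro card_mono) (auto simp: K_def)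
  also have "\<dots> \<le> (\<Sum>w'\<in>W'. card (K w'))" by (intro card_UN_le finW')
  also have "\<dots> \<le> (\<Sum>w'\<in>W'. a * b)"
  proof (rule sum_mono)
    fix w' assume w': "w' \<in> W'"
    then have fin: "finite (N w')" "card (N w') \<le> a" "w' \<in> W" using assms(2) sub by auto
    show "card (K w') \<le> a * b"
    proof (cases "N w' = {}")
      case True
      then show ?thesis using assms(4) by (simp add: K_def)
    next
      case False
      then have "K w' = (\<Union>x\<in>N w'. {w \<in> W. x \<in> N w})" using fin by (auto simp: K_def)
      then have "card (K w') \<le> (\<Sum>x\<in>N w'. card {w \<in> W. x \<in> N w})"
        using fin card_UN_le by metis
      also have "\<dots> \<le> card (N w') * b" using deg sum_bounded_above[of "N w'" _ b] by simp
      also have "\<dots> \<le> a * b" using fin by simp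
      finally show ?thesis .
    qed
  qed
  finally have "card W \<le> a * b * card W'" by (simp add: mult.commute)
  with that sub W' show ?thesis by (auto simp: \<D>_def)
qed

text \<open>Picking a point of \<open>Y\<close> in each member is injective by disjointness. It
  serves to count the objects that meet \<open>H\<close> and the objects adjacent to a given vertex
  of \<open>L\<close>.\<close>

lemma card_disjoint_family_le:
  assumes "finite Y" "\<And>C. C \<in> F \<Longrightarrow> C \<inter> Y \<noteq> {}"
    "\<And>C D. C \<in> F \<Longrightarrow> D \<in> F \<Longrightarrow> C \<noteq> D \<Longrightarrow> C \<inter> D = {}"
  shows "finite F \<and> card F \<le> card Y"
proof -
  define g where "g C = (SOME x. x \<in> C \<inter> Y)" for C
  have g: "g C \<in> C \<inter> Y" if "C \<in> F" for C
    unfolding g_def using assms(2)[OF that] by (metis ex_in_conv someI)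
  then have "inj_on g F" using assms(3) unfolding inj_on_def by (metis IntD1 disjoint_iff)
  moreover have "g ` F \<subseteq> Y" using g by auto
  ultimately show ?thesis using assms(1) by (metis card_inj_on_le inj_on_finite)
qed

section \<open>Structure of extensions\<close>

lemma cds_dominates: "cds E V X \<Longrightarrow> v \<in> V \<Longrightarrow> v \<notin> X \<Longrightarrow> \<exists>u\<in>X. (v, u) \<in> E"
  unfolding cds_def undom_def by blast

text \<open>By domination every added vertex is adjacent to \<open>X\<close>, so it joins the single
  component. Pruning and the minimality test both rest on this.\<close>

lemma cds_superset:
  assumes "sym E" "cds E V X" "X \<subseteq> Y" "Y \<subseteq> V"
  shows "cds E V Y"
proof -
  have XX: "X \<times> X \<subseteq> comp_rel E Y"
    using assms comp_rel_mono[of X Y E] by (auto simp: cds_def)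
  have to: "\<exists>x\<in>X. (y, x) \<in> comp_rel E Y" if y: "y \<in> Y" for y
  proof (cases "y \<in> X")
    case True
    then show ?thesis using XX by auto
  next
    case False
    then obtain x where "x \<in> X" "(y, x) \<in> E" using cds_dominates[OF assms(2)] assms y by blast
    then show ?thesis using assms that by (auto intro: comp_rel_edge)
  qed
  have "(y, z) \<in> comp_rel E Y" if yz: "y \<in> Y" "z \<in> Y" for y z
  proof -
    obtain x x' where "x \<in> X" "(y, x) \<in> comp_rel E Y" "x' \<in> X" "(z, x') \<in> comp_rel E Y"
      using to yz by meson
    then show ?thesis using XX comp_rel_sym[OF assms(1)] comp_rel_trans by (metis mem_Sigma_iff subsetD)
  qed
  moreover have "undom E V Y = {}"
    using cds_dominates[OF assms(2)] assms(3) unfolding undom_def by blast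
  ultimately show ?thesis using assms unfolding cds_def by blast
qed

locale extension_setting =
  fixes V :: "'a set" and E :: "'a rel" and L I O' :: "'a set"
  assumes finV: "finite V" and symE: "sym E" and V_eq: "L \<union> I \<union> O' = V"
    and disj: "L \<inter> I = {}" "L \<inter> O' = {}" "I \<inter> O' = {}"
    and indep: "\<forall>u\<in>L. \<forall>v\<in>L. (u, v) \<notin> E"
begin

definition mext :: "'a set \<Rightarrow> bool" where
  "mext S \<longleftrightarrow> S \<subseteq> L \<and> cds E V (I \<union> S) \<and> (\<forall>T. T \<subset> S \<longrightarrow> \<not> cds E V (I \<union> T))"

lemma finite_parts: "finite L" "finite I" "finite O'"
  using finV unfolding V_eq[symmetric] by auto

text \<open>If a proper subset \<open>T\<close> works, so does \<open>S - {v}\<close> for any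
  \<open>v \<in> S - T\<close>, by \<open>cds_superset\<close>. Minimality then takes one test per
  element instead of one per subset.\<close>

lemma mext_iff:
  "mext S \<longleftrightarrow> S \<subseteq> L \<and> cds E V (I \<union> S) \<and> (\<forall>v\<in>S. \<not> cds E V (I \<union> (S - {v})))"
proof
  assume "mext S"
  then show "S \<subseteq> L \<and> cds E V (I \<union> S) \<and> (\<forall>v\<in>S. \<not> cds E V (I \<union> (S - {v})))"
    by (auto simp: mext_def)
next
  assume a: "S \<subseteq> L \<and> cds E V (I \<union> S) \<and> (\<forall>v\<in>S. \<not> cds E V (I \<union> (S - {v})))"
  have "\<not> cds E V (I \<union> T)" if TS: "T \<subset> S" for T
  proof
    assume T: "cds E V (I \<union> T)"
    obtain v where v: "v \<in> S" "v \<notin> T" using TS by blast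
    then have "cds E V (I \<union> (S - {v}))"
      using TS a V_eq by (intro cds_superset[OF symE T]) auto
    then show False using a v by auto
  qed
  then show "mext S" using a by (auto simp: mext_def)
qed

text \<open>\<open>L\<close> is independent: a path from a chosen vertex to \<open>I\<close> enters
  \<open>I\<close> with its first edge, and the dominator of an unchosen vertex of \<open>L\<close>
  cannot lie in \<open>S\<close>.\<close>

lemma neighbour_in_I:
  assumes "I \<noteq> {}" "S \<subseteq> L" "cds E V (I \<union> S)" "x \<in> L"
  shows "\<exists>i\<in>I. (x, i) \<in> E"
proof (cases "x \<in> S")
  case True
  obtain i where i: "i \<in> I" using assms by auto
  then have "(x, i) \<in> (Restr E (I \<union> S))\<^sup>*" using True assms by (auto simp: cds_def comp_rel_def)
  moreover have "x \<noteq> i" using i assms disj by auto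
  ultimately obtain y where "(x, y) \<in> Restr E (I \<union> S)" by (meson converse_rtranclE)
  then show ?thesis using assms indep by auto
next
  case False
  then have "x \<in> V" "x \<notin> I \<union> S" using assms V_eq disj by auto
  then obtain y where "y \<in> I \<union> S" "(x, y) \<in> E" using cds_dominates[OF assms(3)] by blast
  then show ?thesis using assms indep by auto
qed

text \<open>A connecting set inside \<open>S\<close>, together with one chosen neighbour of each
  undominated vertex of \<open>O'\<close>, is already an extension; minimality makes it all of
  \<open>S\<close>.\<close>

lemma card_mext_le:
  assumes "I \<noteq> {}" "mext S"
  shows "card S \<le> ncomp E I - 1 + card (undom E V I)"
proof -
  have S: "S \<subseteq> L" "cds E V (I \<union> S)" using assms by (auto simp: mext_def)
  have finS: "finite S" using S finite_parts finite_subset by auto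
  obtain T2 where T2: "T2 \<subseteq> S" "I \<times> I \<subseteq> comp_rel E (I \<union> T2)" "card T2 \<le> ncomp E I - 1"
  proof (rule connecting_subset_exists[of I S E])
    show "\<forall>u\<in>S. \<forall>v\<in>S. (u, v) \<notin> E" using S indep by blast
    show "I \<times> I \<subseteq> comp_rel E (I \<union> S)" using S(2) unfolding cds_def by blast
  qed (use finite_parts finS symE assms(1) in auto)
  let ?U = "undom E V I \<inter> O'"
  have "\<forall>u\<in>?U. \<exists>s. s \<in> S \<and> (u, s) \<in> E"
  proof
    fix u assume u: "u \<in> ?U"
    then have "u \<in> V" "u \<notin> I \<union> S" using S disj by (auto simp: undom_def)
    then obtain s where "s \<in> I \<union> S" "(u, s) \<in> E" using cds_dominates[OF S(2)] by blast
    then show "\<exists>s. s \<in> S \<and> (u, s) \<in> E" using u by (auto simp: undom_def)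
  qed
  then obtain g where g: "\<forall>u\<in>?U. g u \<in> S \<and> (u, g u) \<in> E" by metis
  define T where "T = g ` ?U \<union> T2"
  have TS: "T \<subseteq> S" using g T2 by (auto simp: T_def)
  have finU: "finite (undom E V I)" using finV by (simp add: undom_def)
  have conn: "(x, y) \<in> comp_rel E (I \<union> T)" if "x \<in> I" "y \<in> I" for x y
    using T2(2) comp_rel_mono[of "I \<union> T2" "I \<union> T" E] that by (auto simp: T_def)
  \<comment> \<open>Vertices taken only to dominate are connected to \<open>I\<close> for free,
    since each has a neighbour there.\<close>
  have to: "\<exists>i\<in>I. (x, i) \<in> comp_rel E (I \<union> T)" if x: "x \<in> I \<union> T" for x
  proof (cases "x \<in> I")
    case True
    then show ?thesis using conn by auto
  next
    case False
    then obtain i where "i \<in> I" "(x, i) \<in> E" using neighbour_in_I[OF assms(1) S] x TS S by blast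
    then show ?thesis using that by (auto intro: comp_rel_edge)
  qed
  have "cds E V (I \<union> T)"
    unfolding cds_def
  proof (intro conjI)
    show "I \<union> T \<subseteq> V" using TS S V_eq by auto
    show "I \<union> T \<noteq> {}" using assms by auto
    show "(I \<union> T) \<times> (I \<union> T) \<subseteq> comp_rel E (I \<union> T)"
      using to conn comp_rel_sym[OF symE] comp_rel_trans[of _ _ E "I \<union> T"] by (clarify, metis)
    show "undom E V (I \<union> T) = {}"
    proof -
      have "\<exists>u\<in>I \<union> T. (v, u) \<in> E" if "v \<in> V - (I \<union> T)" for v
      proof (cases "v \<in> L")
        case True
        then show ?thesis using neighbour_in_I[OF assms(1) S] by auto
      next
        case False
        then have "v \<in> O'" "v \<notin> I" using that V_eq by auto
        then show ?thesis using g that by (cases "v \<in> undom E V I") (auto simp: T_def undom_def)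
      qed
      then show ?thesis by (auto simp: undom_def)
    qed
  qed
  then have "T = S" using TS assms by (auto simp: mext_def)
  then have "card S \<le> card (g ` ?U) + card T2" unfolding T_def using card_Un_le by blast
  also have "card (g ` ?U) \<le> card ?U" using finU by (intro card_image_le) auto
  also have "card ?U \<le> card (undom E V I)" using finU by (intro card_mono) auto
  finally show ?thesis using T2 by linarith
qed

text \<open>If no chosen vertex touches \<open>C\<close>, a walk in \<open>I \<union> S\<close> that
  starts in \<open>C\<close> never leaves it, so \<open>C\<close> would be all of
  \<open>I\<close>.\<close>

lemma component_hit:
  assumes "S \<subseteq> L" "cds E V (I \<union> S)" "C \<in> I // comp_rel E I" "2 \<le> ncomp E I"
  shows "\<exists>s\<in>S. \<exists>c\<in>C. (s, c) \<in> E"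
proof (rule ccontr)
  assume no: "\<not> (\<exists>s\<in>S. \<exists>c\<in>C. (s, c) \<in> E)"
  obtain a where a: "a \<in> I" "C = comp_rel E I `` {a}" using assms(3) by (auto elim: quotientE)
  have inC: "y \<in> C" if "(a, y) \<in> (Restr E (I \<union> S))\<^sup>*" for y
    using that
  proof (induction rule: rtrancl_induct)
    case base
    then show ?case using a by (auto simp: comp_rel_def)
  next
    case (step y z)
    have y: "y \<in> I" "(a, y) \<in> comp_rel E I" using step a by (auto simp: comp_rel_def)
    have "z \<notin> S" using no step symE by (auto dest: symD)
    then have "z \<in> I" "(y, z) \<in> E" using step by auto
    then show ?case using a y comp_rel_trans comp_rel_edge by (metis Image_singleton_iff)
  qed
  have "(a, y) \<in> comp_rel E (I \<union> S)" if "y \<in> I" for y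
    using assms(2) a(1) that unfolding cds_def by blast
  then have "I \<subseteq> C" using inC by (auto simp: comp_rel_def)
  then have "I \<times> I \<subseteq> comp_rel E I"
    using a comp_rel_sym[OF symE, of _ _ I] comp_rel_trans[of _ _ E I] by (clarify, metis Image_singleton_iff subsetD)
  then have "ncomp E I = 1"
    unfolding ncomp_def using card_quotient_eq_1_iff[OF equiv_comp_rel[OF symE] finite_parts(2)] a by auto
  then show False using assms by auto
qed

end

section \<open>Counting extensions and search nodes\<close>

definition enum_bound :: "nat \<Rightarrow> nat \<Rightarrow> real" where
  "enum_bound l N = 2 ^ N * exp (- (real N / (2 ^ (10 * l) * 100 * real l ^ 2)))"

text \<open>Here \<open>q\<close> is \<open>exp (- (1 / D))\<close>. The estimate 50/51 comes from
  \<open>D \<ge> 100\<close> and \<open>exp x \<le> 1 + 2 * x\<close> for small nonnegative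
  \<open>x\<close>.\<close>

lemma enum_bound_eq_power:
  assumes "l \<ge> 1"
  obtains q where "50 / 51 \<le> q" "\<And>N. enum_bound l N = (2 * q) ^ N"
proof -
  define D where "D = 2 ^ (10 * l) * 100 * real l ^ 2"
  have "1 * 100 * 1 \<le> D"
    unfolding D_def using assms by (intro mult_mono one_le_power) auto
  then have D: "0 \<le> 1 / D" "1 / D \<le> 1 / 100" by (auto simp: field_simps)
  have "exp (1 / D) \<le> 1 + 2 * (1 / D)" using D by (intro real_exp_bound_lemma) auto
  then have "exp (1 / D) \<le> 51 / 50" using D by linarith
  then have "50 / 51 \<le> exp (- (1 / D))" by (simp add: exp_minus field_simps)
  moreover have "enum_bound l N = (2 * exp (- (1 / D))) ^ N" for N
    by (simp add: enum_bound_def D_def power_mult_distrib exp_of_nat_mult[symmetric])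
  ultimately show ?thesis by (rule that)
qed

lemma one_le_enum_bound:
  assumes "l \<ge> 1"
  shows "1 \<le> enum_bound l N"
proof -
  obtain q where "50 / 51 \<le> q" "enum_bound l N = (2 * q) ^ N"
    using enum_bound_eq_power[OF assms] by metis
  moreover from this have "1 \<le> (2 * q) ^ N" by (intro one_le_power) linarith
  ultimately show ?thesis by simp
qed

text \<open>Tenth powers clear the fraction 3/10: what remains is 2^3 * (3/2)^10 \<le> (100/51)^10,
  roughly 461 against 840.\<close>

lemma small_subsets_bound:
  assumes "l \<ge> 1" "10 * m \<le> 3 * N"
  shows "2 ^ m * (3 / 2) ^ N \<le> enum_bound l N"
proof -
  obtain q where q: "50 / 51 \<le> q" "enum_bound l N = (2 * q) ^ N"
    using enum_bound_eq_power[OF assms(1)] by metis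
  have "(2 * (50 / 51)) ^ 10 \<le> (2 * q) ^ 10" using q by (intro power_mono) auto
  moreover have "2 ^ 3 * (3 / 2) ^ 10 \<le> (2 * (50 / 51 :: real)) ^ 10" by (simp add: field_simps)
  ultimately have base: "2 ^ 3 * (3 / 2) ^ 10 \<le> (2 * q) ^ 10" by linarith
  have "(2 ^ m * (3 / 2) ^ N) ^ 10 = 2 ^ (10 * m) * ((3 / 2 :: real) ^ 10) ^ N"
    by (simp add: power_mult_distrib power_mult[symmetric] mult.commute)
  also have "\<dots> \<le> 2 ^ (3 * N) * ((3 / 2 :: real) ^ 10) ^ N"
    using assms(2) by (intro mult_right_mono power_increasing) auto
  also have "\<dots> = (2 ^ 3 * (3 / 2) ^ 10) ^ N"
    by (simp only: power_mult_distrib power_mult)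
  also have "\<dots> \<le> ((2 * q) ^ 10) ^ N" using base by (intro power_mono) auto
  also have "\<dots> = ((2 * q) ^ N) ^ 10" by (simp only: power_mult[symmetric] mult.commute)
  finally show ?thesis
    unfolding q(2) using q(1) power_mono_iff[of "2 ^ m * (3 / 2) ^ N" "(2 * q) ^ N" 10] by simp
qed

text \<open>By \<open>1 - x \<le> exp (- x)\<close> the product is at most
  \<open>exp (- (k * x))\<close> with \<open>x = 1 / 2 ^ (10 * l)\<close>; inserting the lower bound
  \<open>N / (100 * l\<^sup>2)\<close> for \<open>k\<close> produces the exponent of
  \<open>enum_bound\<close>.\<close>

lemma hitting_bound:
  assumes "l \<ge> 1" "N \<le> 100 * l\<^sup>2 * k"
  shows "2 ^ N * (1 - 1 / 2 ^ (10 * l)) ^ k \<le> enum_bound l N"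
proof -
  define x :: real where "x = 1 / 2 ^ (10 * l)"
  have x: "0 < x" "x \<le> 1" by (auto simp: x_def)
  have "real N \<le> real (100 * l\<^sup>2 * k)" using assms(2) by (simp only: of_nat_le_iff)
  then have N: "real N \<le> 100 * real l ^ 2 * real k" by simp
  have "(1 - x) ^ k \<le> exp (- x) ^ k"
    using x exp_ge_add_one_self[of "- x"] by (intro power_mono) auto
  also have "\<dots> = exp (- (real k * x))" by (simp add: exp_of_nat_mult[symmetric])
  also have "\<dots> \<le> exp (- (real N / (2 ^ (10 * l) * 100 * real l ^ 2)))"
    using N assms(1) by (simp add: x_def field_simps)
  finally show ?thesis by (simp add: enum_bound_def x_def)
qed

section \<open>The dichotomy for good partitions\<close>

locale good_setting = extension_setting +
  fixes H R :: "'a set" and l :: nat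
  assumes HR: "I \<union> O' = H \<union> R" "H \<inter> R = {}" and card_H: "10 * card H \<le> card L"
    and deg_R: "\<forall>v\<in>L. card {u \<in> R. (v, u) \<in> E} < l" and l1: "1 \<le> l"
begin

text \<open>The family is hit by all extensions, not just minimal ones, so that it applies to search
  nodes as well. The extension \<open>S0\<close> forces the vertices undominated by \<open>I\<close>
  into \<open>O'\<close>.\<close>

lemma hitting_family_or_few_objects:
  assumes ne: "I \<noteq> {}" and S0: "S0 \<subseteq> L" "cds E V (I \<union> S0)"
  shows "(\<exists>(W :: 'a set set) N. finite W \<and> (\<forall>w\<in>W. N w \<subseteq> L \<and> card (N w) \<le> 10 * l) \<and>
      (\<forall>w\<in>W. \<forall>w'\<in>W. w \<noteq> w' \<longrightarrow> N w \<inter> N w' = {}) \<and> card L \<le> 100 * l\<^sup>2 * card W \<and>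
      (\<forall>S. S \<subseteq> L \<longrightarrow> cds E V (I \<union> S) \<longrightarrow> (\<forall>w\<in>W. S \<inter> N w \<noteq> {}))) \<or>
    10 * (ncomp E I - 1 + card (undom E V I)) \<le> 3 * card L"
proof -
  define U where "U = undom E V I"
  \<comment> \<open>Undominated vertices become singletons, so that they are treated like
    components. A lone component is left out because an extension need not touch it.\<close>
  define J where "J = (\<lambda>u. {u}) ` U \<union> (if 2 \<le> ncomp E I then I // comp_rel E I else {})"
  define N where "N C = {x \<in> L. \<exists>c\<in>C. (x, c) \<in> E}" for C
  have UO: "U \<subseteq> O'"
    using neighbour_in_I[OF ne S0] V_eq by (auto simp: U_def undom_def)
  have finHR: "finite H" "finite R" using finite_parts HR by (metis finite_Un)+
  have J_disj: "C \<inter> D = {}" if "C \<in> J" "D \<in> J" "C \<noteq> D" for C D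
  proof -
    have sub: "K \<subseteq> I" if "K \<in> I // comp_rel E I" for K
      using that by (auto simp: quotient_def comp_rel_def)
    have dis: "K \<inter> K' = {}" if "K \<in> I // comp_rel E I" "K' \<in> I // comp_rel E I" "K \<noteq> K'" for K K'
      using quotient_disj[OF equiv_comp_rel[OF symE]] that by blast
    show ?thesis
      using that sub dis UO disj(3) unfolding J_def by (auto split: if_splits) blast+
  qed
  have J_ne: "C \<noteq> {}" "C \<subseteq> H \<union> R" if "C \<in> J" for C
    using that UO HR(1) in_quotient_imp_non_empty[OF equiv_comp_rel[OF symE], of C I]
      in_quotient_imp_subset[OF equiv_comp_rel[OF symE], of C I]
    by (auto simp: J_def split: if_splits)
  have hit: "S \<inter> N C \<noteq> {}" if S: "S \<subseteq> L" "cds E V (I \<union> S)" and C: "C \<in> J" for S C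
  proof (cases "C \<in> (\<lambda>u. {u}) ` U")
    case True
    then obtain u where u: "u \<in> U" "C = {u}" by auto
    then have "u \<in> V" "u \<notin> I \<union> S" using UO S V_eq disj by auto
    then obtain s where "s \<in> I \<union> S" "(u, s) \<in> E" using cds_dominates[OF S(2)] by blast
    then have "s \<in> S" "(s, u) \<in> E" using u symE by (auto simp: U_def undom_def dest: symD)
    then show ?thesis using u S by (auto simp: N_def)
  next
    case False
    then have "C \<in> I // comp_rel E I" "2 \<le> ncomp E I" using C by (auto simp: J_def split: if_splits)
    then show ?thesis using component_hit[OF S] S by (auto simp: N_def)
  qed
  have finJ: "finite J"
    using card_disjoint_family_le[of "H \<union> R" J] J_disj J_ne finHR by (metis finite_Un inf.absorb1)
  \<comment> \<open>The \<open>- 1\<close> covers both cases: it is 0 when there is at most one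
    component and loses one object otherwise.\<close>
  have card_J: "ncomp E I - 1 + card U \<le> card J"
  proof -
    have c: "card ((\<lambda>u. {u}) ` U) = card U" by (intro card_image) auto
    show ?thesis
    proof (cases "2 \<le> ncomp E I")
      case True
      then have "J = (\<lambda>u. {u}) ` U \<union> I // comp_rel E I" by (simp add: J_def)
      moreover have "(\<lambda>u. {u}) ` U \<inter> I // comp_rel E I = {}"
        using in_quotient_imp_subset[OF equiv_comp_rel[OF symE], of _ I] UO disj(3) by blast
      ultimately have "card J = card U + ncomp E I"
        using finJ c by (simp add: card_Un_disjoint ncomp_def)
      then show ?thesis by simp
    next
      case False
      then show ?thesis using c by (simp add: J_def)
    qed
  qed
  define JH where "JH = {C \<in> J. C \<inter> H \<noteq> {}}"
  define JR where "JR = J - JH"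
  define Hi where "Hi = {C \<in> JR. 10 * l < card (N C)}"
  define W where "W = JR - Hi"
  have fin: "finite JH" "finite JR" "finite Hi" "finite W"
    using finJ by (auto simp: JH_def JR_def Hi_def W_def)
  have finN: "finite (N C)" for C using finite_parts by (simp add: N_def)
  have JH_le: "card JH \<le> card H"
  proof (intro conjunct2[OF card_disjoint_family_le])
    show "C \<inter> D = {}" if "C \<in> JH" "D \<in> JH" "C \<noteq> D" for C D
      using that J_disj by (simp add: JH_def)
  qed (use finHR in \<open>auto simp: JH_def\<close>)
  \<comment> \<open>The objects in \<open>JR\<close> are disjoint and lie in \<open>R\<close>, so
    those adjacent to \<open>x\<close> have distinct representatives among its fewer than
    \<open>l\<close> neighbours in \<open>R\<close>.\<close>
  have deg: "card {C \<in> JR. x \<in> N C} \<le> l" for x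
  proof (cases "x \<in> L")
    case True
    have "card {C \<in> JR. x \<in> N C} \<le> card {u \<in> R. (x, u) \<in> E}"
    proof (intro conjunct2[OF card_disjoint_family_le])
      fix C assume "C \<in> {C \<in> JR. x \<in> N C}"
      then have C: "C \<in> J" "C \<inter> H = {}" "x \<in> N C" by (auto simp: JR_def JH_def)
      then show "C \<inter> {u \<in> R. (x, u) \<in> E} \<noteq> {}" using J_ne(2)[OF C(1)] by (auto simp: N_def)
    next
      fix C D assume "C \<in> {C \<in> JR. x \<in> N C}" "D \<in> {C \<in> JR. x \<in> N C}" "C \<noteq> D"
      then show "C \<inter> D = {}" using J_disj by (simp add: JR_def)
    qed (use finHR in simp)
    then show ?thesis using deg_R True by (meson le_trans less_imp_le)
  next
    case False
    then have "{C \<in> JR. x \<in> N C} = {}" by (auto simp: N_def)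
    then show ?thesis by (metis card.empty le0)
  qed
  \<comment> \<open>Double counting of incidences between \<open>L\<close> and \<open>JR\<close>:
    each object of \<open>Hi\<close> has more than \<open>10 * l\<close> of them, each vertex of
    \<open>L\<close> at most \<open>l\<close>.\<close>
  have "10 * l * card Hi \<le> (\<Sum>C\<in>Hi. card (N C))"
    using sum_bounded_below[of Hi "10 * l" "\<lambda>C. card (N C)"] by (auto simp: Hi_def mult.commute)
  also have "\<dots> \<le> (\<Sum>C\<in>JR. card (N C))"
    using fin by (intro sum_mono2) (auto simp: Hi_def)
  also have "\<dots> = (\<Sum>C\<in>JR. \<Sum>x\<in>L. of_bool (x \<in> N C))"
  proof (intro sum.cong refl)
    fix C
    have "L \<inter> {x. x \<in> N C} = N C" by (auto simp: N_def)
    then show "card (N C) = (\<Sum>x\<in>L. of_bool (x \<in> N C))"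
      using finite_parts by (simp add: sum_of_bool_eq)
  qed
  also have "\<dots> = (\<Sum>x\<in>L. \<Sum>C\<in>JR. of_bool (x \<in> N C))" by (rule sum.swap)
  also have "\<dots> = (\<Sum>x\<in>L. card {C \<in> JR. x \<in> N C})"
    using fin by (simp add: sum_of_bool_eq Collect_conj_eq)
  also have "\<dots> \<le> card L * l" using sum_bounded_above[of L _ l] deg by simp
  finally have Hi_le: "10 * card Hi \<le> card L" using l1 by (simp add: mult.commute)
  show ?thesis
  proof (cases "card L \<le> 10 * card W")
    case True
    \<comment> \<open>With \<open>a = 10 * l\<close> and \<open>b = l\<close> the disjoint family
      keeps a fraction \<open>1 / (10 * l\<^sup>2)\<close> of \<open>W\<close>; the case assumption
      supplies the other factor 10.\<close>
    obtain W' where W': "W' \<subseteq> W" "\<forall>w\<in>W'. \<forall>w'\<in>W'. w \<noteq> w' \<longrightarrow> N w \<inter> N w' = {}"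
      "card W \<le> 10 * l * l * card W'"
    proof (rule disjoint_subfamily_exists[of W N "10 * l" l])
      show "\<forall>x. card {w \<in> W. x \<in> N w} \<le> l"
      proof
        fix x
        have "card {w \<in> W. x \<in> N w} \<le> card {C \<in> JR. x \<in> N C}"
          using fin by (intro card_mono) (auto simp: W_def)
        then show "card {w \<in> W. x \<in> N w} \<le> l" using deg le_trans by blast
      qed
      show "1 \<le> 10 * l * l" using l1 by simp
      show "\<forall>w\<in>W. finite (N w) \<and> card (N w) \<le> 10 * l"
        using finN by (simp add: W_def Hi_def not_less)
    qed (use fin in simp)
    have "card L \<le> 100 * l\<^sup>2 * card W'"
      using True W'(3) by (simp add: power2_eq_square)
    moreover have "\<forall>w\<in>W'. N w \<subseteq> L \<and> card (N w) \<le> 10 * l"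
      using W'(1) by (auto simp: W_def Hi_def N_def)
    moreover have "\<forall>S. S \<subseteq> L \<longrightarrow> cds E V (I \<union> S) \<longrightarrow> (\<forall>w\<in>W'. S \<inter> N w \<noteq> {})"
      using hit W'(1) by (auto simp: W_def JR_def)
    moreover have "finite W'" using W'(1) fin finite_subset by auto
    ultimately show ?thesis using W'(2) by blast
  next
    case False
    have "J = JH \<union> (Hi \<union> W)" by (auto simp: W_def JR_def Hi_def JH_def)
    then have "card J \<le> card JH + (card Hi + card W)"
      by (metis (no_types, lifting) card_Un_le le_trans nat_add_left_cancel_le)
    then have "10 * card J \<le> 3 * card L"
      using JH_le Hi_le False card_H by linarith
    then have "10 * (ncomp E I - 1 + card U) \<le> 3 * card L"
      using mult_le_mono2[OF card_J, of 10] by (rule order_trans[rotated])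
    then show ?thesis by (simp add: U_def)
  qed
qed

text \<open>Degenerate cases have at most one extension, and the bound is at least 1. For empty
  \<open>I\<close> a vertex of \<open>L\<close> left out would need a dominator in \<open>L\<close>,
  so only \<open>L\<close> itself can qualify.\<close>

lemma few_extensions_or_few_objects:
  "real (card {S. S \<subseteq> L \<and> cds E V (I \<union> S)}) \<le> enum_bound l (card L) \<or>
    I \<noteq> {} \<and> 10 * (ncomp E I - 1 + card (undom E V I)) \<le> 3 * card L"
proof (cases "\<exists>S0. S0 \<subseteq> L \<and> cds E V (I \<union> S0)")
  case False
  then have "{S. S \<subseteq> L \<and> cds E V (I \<union> S)} = {}" by auto
  then have "card {S. S \<subseteq> L \<and> cds E V (I \<union> S)} = 0" by (simp only: card.empty)
  then show ?thesis using one_le_enum_bound[OF l1, of "card L"] by linarith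
next
  case True
  then obtain S0 where S0: "S0 \<subseteq> L" "cds E V (I \<union> S0)" by auto
  show ?thesis
  proof (cases "I = {}")
    case True
    have "S = L" if S: "S \<subseteq> L" "cds E V (I \<union> S)" for S
    proof (rule ccontr)
      assume "S \<noteq> L"
      then obtain x where "x \<in> L" "x \<notin> S" using S by auto
      moreover then obtain s where "s \<in> S" "(x, s) \<in> E"
        using cds_dominates[OF S(2), of x] True V_eq by auto
      ultimately show False using indep S by auto
    qed
    then have "{S. S \<subseteq> L \<and> cds E V (I \<union> S)} \<subseteq> {L}" by auto
    then have "card {S. S \<subseteq> L \<and> cds E V (I \<union> S)} \<le> card {L}" by (intro card_mono) auto
    then show ?thesis using one_le_enum_bound[OF l1, of "card L"] by simp
  next
    case False
    from hitting_family_or_few_objects[OF False S0]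
    show ?thesis
    proof
      assume "10 * (ncomp E I - 1 + card (undom E V I)) \<le> 3 * card L"
      then show ?thesis using False by simp
    next
      assume "\<exists>(W :: 'a set set) N. finite W \<and> (\<forall>w\<in>W. N w \<subseteq> L \<and> card (N w) \<le> 10 * l) \<and>
        (\<forall>w\<in>W. \<forall>w'\<in>W. w \<noteq> w' \<longrightarrow> N w \<inter> N w' = {}) \<and> card L \<le> 100 * l\<^sup>2 * card W \<and>
        (\<forall>S. S \<subseteq> L \<longrightarrow> cds E V (I \<union> S) \<longrightarrow> (\<forall>w\<in>W. S \<inter> N w \<noteq> {}))"
      then obtain W :: "'a set set" and N where W: "finite W"
        "\<forall>w\<in>W. N w \<subseteq> L \<and> card (N w) \<le> 10 * l"
        "\<forall>w\<in>W. \<forall>w'\<in>W. w \<noteq> w' \<longrightarrow> N w \<inter> N w' = {}" "card L \<le> 100 * l\<^sup>2 * card W"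
        "\<forall>S. S \<subseteq> L \<longrightarrow> cds E V (I \<union> S) \<longrightarrow> (\<forall>w\<in>W. S \<inter> N w \<noteq> {})"
        by (elim exE conjE) (rule that)
      have "card {S. S \<subseteq> L \<and> cds E V (I \<union> S)} \<le> card {S. S \<subseteq> L \<and> (\<forall>w\<in>W. S \<inter> N w \<noteq> {})}"
        using W(5) finite_parts by (intro card_mono) auto
      then have "real (card {S. S \<subseteq> L \<and> cds E V (I \<union> S)}) \<le>
          real (card {S. S \<subseteq> L \<and> (\<forall>w\<in>W. S \<inter> N w \<noteq> {})})" by simp
      also have "\<dots> \<le> 2 ^ card L * (1 - 1 / 2 ^ (10 * l)) ^ card W"
        using W finite_parts by (intro card_hitting_subsets_le) auto
      also have "\<dots> \<le> enum_bound l (card L)" using hitting_bound[OF l1 W(4)] .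
      finally show ?thesis by simp
    qed
  qed
qed

lemma card_mext_family_le: "finite {S. mext S} \<and> real (card {S. mext S}) \<le> enum_bound l (card L)"
proof -
  have "{S. mext S} \<subseteq> Pow L" by (auto simp: mext_def)
  then have fin: "finite {S. mext S}" using finite_parts finite_subset by blast
  from few_extensions_or_few_objects have "real (card {S. mext S}) \<le> enum_bound l (card L)"
  proof
    assume a: "real (card {S. S \<subseteq> L \<and> cds E V (I \<union> S)}) \<le> enum_bound l (card L)"
    have "card {S. mext S} \<le> card {S. S \<subseteq> L \<and> cds E V (I \<union> S)}"
      using finite_parts by (intro card_mono) (auto simp: mext_def)
    then show ?thesis using a by linarith
  next
    assume a: "I \<noteq> {} \<and> 10 * (ncomp E I - 1 + card (undom E V I)) \<le> 3 * card L"
    let ?m = "ncomp E I - 1 + card (undom E V I)"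
    have "card {S. mext S} \<le> card {T. T \<subseteq> L \<and> card T \<le> ?m}"
      using finite_parts card_mext_le a by (intro card_mono) (auto simp: mext_def)
    then have "real (card {S. mext S}) \<le> real (card {T. T \<subseteq> L \<and> card T \<le> ?m})" by simp
    also have "\<dots> \<le> 2 ^ ?m * (3 / 2) ^ card L" using finite_parts by (intro card_small_subsets_le)
    also have "\<dots> \<le> enum_bound l (card L)" using a l1 by (intro small_subsets_bound) auto
    finally show ?thesis .
  qed
  with fin show ?thesis ..
qed

text \<open>A search node at which the vertices of \<open>Q\<close> have been decided is a set \<open>Y\<close> that contains all
  undecided vertices of \<open>L\<close>, so that \<open>Y - I\<close> is again an extension.\<close>

lemma card_search_nodes_le:
  assumes "Q \<subseteq> L"
  shows "real (card {Y. Y \<subseteq> I \<union> L \<and> (I \<union> L) - Y \<subseteq> Q \<and> cds E V Y \<and>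
      card (Y \<inter> Q) \<le> ncomp E I + card (undom E V I)}) \<le> 2 * enum_bound l (card L)"
    (is "real (card ?F) \<le> _")
proof -
  have fin: "finite ?F" using finite_parts by simp
  have YI: "Y = I \<union> (Y - I)" "Y - I \<subseteq> L" if "Y \<in> ?F" for Y
    using that assms disj by auto
  from few_extensions_or_few_objects show ?thesis
  proof
    assume a: "real (card {S. S \<subseteq> L \<and> cds E V (I \<union> S)}) \<le> enum_bound l (card L)"
    have "card ?F \<le> card {S. S \<subseteq> L \<and> cds E V (I \<union> S)}"
    proof (rule card_inj_on_le)
      show "inj_on (\<lambda>Y. Y - I) ?F" using YI by (metis (no_types, lifting) inj_onI)
      show "(\<lambda>Y. Y - I) ` ?F \<subseteq> {S. S \<subseteq> L \<and> cds E V (I \<union> S)}"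
      proof (intro image_subsetI CollectI conjI)
        fix Y assume Y: "Y \<in> ?F"
        show "Y - I \<subseteq> L" using YI(2)[OF Y] .
        show "cds E V (I \<union> (Y - I))" using YI(1)[OF Y] Y by simp
      qed
    qed (use finite_parts in simp)
    then show ?thesis using a one_le_enum_bound[OF l1, of "card L"] by linarith
  next
    assume a: "I \<noteq> {} \<and> 10 * (ncomp E I - 1 + card (undom E V I)) \<le> 3 * card L"
    let ?m = "ncomp E I + card (undom E V I)"
    have "card ?F \<le> card {T. T \<subseteq> L \<and> card T \<le> ?m}"
    proof (rule card_inj_on_le)
      \<comment> \<open>\<open>Y\<close> contains everything outside \<open>Q\<close>, so its trace
        on \<open>Q\<close> determines it.\<close>
      have "Y = ((I \<union> L) - Q) \<union> (Y \<inter> Q)" if "Y \<in> ?F" for Y using that assms by auto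
      then show "inj_on (\<lambda>Y. Y \<inter> Q) ?F" by (metis (no_types, lifting) inj_onI)
    qed (use finite_parts assms in auto)
    then have "real (card ?F) \<le> real (card {T. T \<subseteq> L \<and> card T \<le> ?m})" by simp
    also have "\<dots> \<le> 2 ^ ?m * (3 / 2) ^ card L" using finite_parts by (intro card_small_subsets_le)
    \<comment> \<open>The cap of the search may exceed the bound of \<open>card_mext_le\<close> by
      one; this costs the factor 2.\<close>
    also have "\<dots> \<le> 2 ^ Suc (ncomp E I - 1 + card (undom E V I)) * (3 / 2) ^ card L"
      by (intro mult_right_mono power_increasing) auto
    also have "\<dots> \<le> 2 * enum_bound l (card L)"
      using small_subsets_bound[OF l1, of "ncomp E I - 1 + card (undom E V I)" "card L"] a by simp
    finally show ?thesis .
  qed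
qed

end

section \<open>A program logic with time bounds\<close>

primrec cost :: "nat \<Rightarrow> com \<Rightarrow> nat" where
  "cost m Skip = 1"
| "cost m (Const r k) = 1"
| "cost m (Copy r r') = 1"
| "cost m (Inc r) = 1"
| "cost m (Dec r) = 1"
| "cost m (Load r a) = 1"
| "cost m (Store a r) = 1"
| "cost m (Print r) = 1"
| "cost m (Seq c d) = cost m c + cost m d"
| "cost m (IfLess r r' c d) = 1 + cost m c + cost m d"
| "cost m (WhileLess r r' c) = 1 + m * (1 + cost m c)"

text \<open>The exponent depends on the program text alone. A base of at least 2 lets constants be
  absorbed into it even for tiny instances.\<close>

lemma cost_polynomial: "\<exists>k. \<forall>m. cost m c \<le> max 2 m ^ k"
proof (induction c)
  case (Seq c d)
  then obtain i j where ij: "\<forall>m. cost m c \<le> max 2 m ^ i" "\<forall>m. cost m d \<le> max 2 m ^ j" by auto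
  have "cost m (Seq c d) \<le> max 2 m ^ Suc (i + j)" for m
  proof -
    let ?x = "max 2 m"
    have "cost m c \<le> ?x ^ (i + j)" "cost m d \<le> ?x ^ (i + j)"
      using ij by (meson le_trans power_increasing le_add1 le_add2 max.cobounded1 one_le_numeral)+
    then have "cost m (Seq c d) \<le> 2 * ?x ^ (i + j)" by simp
    also have "\<dots> \<le> ?x * ?x ^ (i + j)" by (intro mult_right_mono) auto
    finally show ?thesis by simp
  qed
  then show ?case by blast
next
  case (IfLess r r' c d)
  then obtain i j where ij: "\<forall>m. cost m c \<le> max 2 m ^ i" "\<forall>m. cost m d \<le> max 2 m ^ j" by auto
  have "cost m (IfLess r r' c d) \<le> max 2 m ^ (2 + (i + j))" for m
  proof -
    let ?x = "max 2 m"
    have "cost m c \<le> ?x ^ (i + j)" "cost m d \<le> ?x ^ (i + j)" "1 \<le> ?x ^ (i + j)"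
      using ij by (meson le_trans power_increasing le_add1 le_add2 max.cobounded1 one_le_numeral one_le_power)+
    then have "cost m (IfLess r r' c d) \<le> 4 * ?x ^ (i + j)" unfolding cost.simps by linarith
    also have "\<dots> \<le> ?x\<^sup>2 * ?x ^ (i + j)"
      using power_mono[of 2 ?x 2] by (intro mult_right_mono) auto
    finally show ?thesis by (simp only: power_add)
  qed
  then show ?case by blast
next
  case (WhileLess r r' c)
  then obtain i where i: "\<forall>m. cost m c \<le> max 2 m ^ i" by auto
  have "cost m (WhileLess r r' c) \<le> max 2 m ^ (3 + i)" for m
  proof -
    let ?x = "max 2 m"
    have "1 \<le> ?x ^ i" by simp
    then have "1 + cost m c \<le> 2 * ?x ^ i" using i[rule_format, of m] by linarith
    also have "\<dots> \<le> ?x * ?x ^ i" by (intro mult_right_mono) auto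
    finally have a: "m * (1 + cost m c) \<le> ?x * (?x * ?x ^ i)" by (intro mult_mono) auto
    have "1 \<le> ?x ^ Suc (Suc i)" by (rule one_le_power) simp
    then have "cost m (WhileLess r r' c) \<le> 2 * (?x * (?x * ?x ^ i))"
      using a unfolding cost.simps power_Suc by linarith
    also have "\<dots> \<le> ?x * (?x * (?x * ?x ^ i))" by (intro mult_right_mono) auto
    finally show ?thesis by (simp add: power_add power3_eq_cube mult.assoc)
  qed
  then show ?case by blast
qed (auto intro: exI[of _ 0])

text \<open>Weakest preconditions for total correctness in which every loop makes at most \<open>m\<close> iterations,
  so that \<open>cost m c\<close> bounds the running time of \<open>c\<close>.\<close>

primrec wp :: "nat \<Rightarrow> com \<Rightarrow> (state \<Rightarrow> bool) \<Rightarrow> state \<Rightarrow> bool" where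
  "wp m Skip Q = Q"
| "wp m (Const r k) Q = (\<lambda>s. Q (s\<lparr>reg := (reg s)(r := k)\<rparr>))"
| "wp m (Copy r r') Q = (\<lambda>s. Q (s\<lparr>reg := (reg s)(r := reg s r')\<rparr>))"
| "wp m (Inc r) Q = (\<lambda>s. Q (s\<lparr>reg := (reg s)(r := reg s r + 1)\<rparr>))"
| "wp m (Dec r) Q = (\<lambda>s. Q (s\<lparr>reg := (reg s)(r := reg s r - 1)\<rparr>))"
| "wp m (Load r a) Q = (\<lambda>s. Q (s\<lparr>reg := (reg s)(r := mem s (reg s a))\<rparr>))"
| "wp m (Store a r) Q = (\<lambda>s. Q (s\<lparr>mem := (mem s)(reg s a := reg s r)\<rparr>))"
| "wp m (Print r) Q = (\<lambda>s. Q (s\<lparr>out := out s @ [reg s r]\<rparr>))"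
| "wp m (Seq c d) Q = wp m c (wp m d Q)"
| "wp m (IfLess r r' c d) Q = (\<lambda>s. if reg s r < reg s r' then wp m c Q s else wp m d Q s)"
| "wp m (WhileLess r r' c) Q = (\<lambda>s. \<exists>k\<le>m.
     ((\<lambda>F s. reg s r < reg s r' \<and> wp m c F s) ^^ k) (\<lambda>s. \<not> reg s r < reg s r' \<and> Q s) s)"

lemma wp_sound: "wp m c Q s \<Longrightarrow> \<exists>t s'. t \<le> cost m c \<and> exec c s t s' \<and> Q s'"
proof (induction c arbitrary: Q s)
  case (Seq c d)
  then obtain t s' where 1: "t \<le> cost m c" "exec c s t s'" "wp m d Q s'" by fastforce
  then obtain t' s'' where "t' \<le> cost m d" "exec d s' t' s''" "Q s''" using Seq by blast
  then show ?case using 1 exec.Seq[of c s t s' d t' s'']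
    by (intro exI[of _ "t + t'"] exI[of _ s'']) auto
next
  case (IfLess r r' c d)
  show ?case
  proof (cases "reg s r < reg s r'")
    case True
    then obtain t s' where "t \<le> cost m c" "exec c s t s'" "Q s'"
      using IfLess.IH(1)[of Q s] IfLess.prems by auto
    then show ?thesis using exec.IfTrue[OF True, of c t s' d]
      by (intro exI[of _ "1 + t"] exI[of _ s']) auto
  next
    case False
    then obtain t s' where "t \<le> cost m d" "exec d s t s'" "Q s'"
      using IfLess.IH(2)[of Q s] IfLess.prems by auto
    then show ?thesis using exec.IfFalse[OF False, of d t s' c]
      by (intro exI[of _ "1 + t"] exI[of _ s']) auto
  qed
next
  case (WhileLess r r' c)
  let ?F = "\<lambda>F s. reg s r < reg s r' \<and> wp m c F s"
  have "\<exists>t s'. t \<le> 1 + k * (1 + cost m c) \<and> exec (WhileLess r r' c) s t s' \<and> Q s'"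
    if "(?F ^^ k) (\<lambda>s. \<not> reg s r < reg s r' \<and> Q s) s" for k s
    using that
  proof (induction k arbitrary: s)
    case 0
    then show ?case using exec.WhileFalse by (intro exI[of _ 1] exI[of _ s]) auto
  next
    case (Suc k)
    then have lt: "reg s r < reg s r'" and "wp m c ((?F ^^ k) (\<lambda>s. \<not> reg s r < reg s r' \<and> Q s)) s"
      by auto
    then obtain t s' where 1: "t \<le> cost m c" "exec c s t s'"
      "(?F ^^ k) (\<lambda>s. \<not> reg s r < reg s r' \<and> Q s) s'" using WhileLess.IH by blast
    then obtain t' s'' where 2: "t' \<le> 1 + k * (1 + cost m c)" "exec (WhileLess r r' c) s' t' s''" "Q s''"
      using Suc.IH by blast
    have "1 + t + t' \<le> 1 + Suc k * (1 + cost m c)" using 1 2 by simp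
    then show ?case using exec.WhileTrue[OF lt 1(2) 2(2)] 2(3) by blast
  qed
  moreover from WhileLess.prems obtain k where "k \<le> m"
    "(?F ^^ k) (\<lambda>s. \<not> reg s r < reg s r' \<and> Q s) s" by auto
  ultimately obtain t s' where "t \<le> 1 + k * (1 + cost m c)" "exec (WhileLess r r' c) s t s'" "Q s'"
    by blast
  moreover have "1 + k * (1 + cost m c) \<le> cost m (WhileLess r r' c)"
    unfolding cost.simps using \<open>k \<le> m\<close> by (intro add_left_mono mult_right_mono) auto
  ultimately show ?case by (meson le_trans)
qed (unfold wp.simps cost.simps, (blast intro: exec.intros order_refl)+)

section \<open>Frame conditions and the rule for counting loops\<close>

primrec writes :: "com \<Rightarrow> nat set" where
  "writes Skip = {}"
| "writes (Const r k) = {r}"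
| "writes (Copy r r') = {r}"
| "writes (Inc r) = {r}"
| "writes (Dec r) = {r}"
| "writes (Load r a) = {r}"
| "writes (Store a r) = {}"
| "writes (Print r) = {}"
| "writes (Seq c d) = writes c \<union> writes d"
| "writes (IfLess r r' c d) = writes c \<union> writes d"
| "writes (WhileLess r r' c) = writes c"

primrec no_store :: "com \<Rightarrow> bool" where
  "no_store Skip = True"
| "no_store (Const r k) = True"
| "no_store (Copy r r') = True"
| "no_store (Inc r) = True"
| "no_store (Dec r) = True"
| "no_store (Load r a) = True"
| "no_store (Store a r) = False"
| "no_store (Print r) = True"
| "no_store (Seq c d) = (no_store c \<and> no_store d)"
| "no_store (IfLess r r' c d) = (no_store c \<and> no_store d)"
| "no_store (WhileLess r r' c) = no_store c"

primrec no_print :: "com \<Rightarrow> bool" where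
  "no_print Skip = True"
| "no_print (Const r k) = True"
| "no_print (Copy r r') = True"
| "no_print (Inc r) = True"
| "no_print (Dec r) = True"
| "no_print (Load r a) = True"
| "no_print (Store a r) = True"
| "no_print (Print r) = False"
| "no_print (Seq c d) = (no_print c \<and> no_print d)"
| "no_print (IfLess r r' c d) = (no_print c \<and> no_print d)"
| "no_print (WhileLess r r' c) = no_print c"

text \<open>What the text of a program guarantees without following its run. Loop invariants then
  need to mention only what changes.\<close>

definition frame :: "com \<Rightarrow> state \<Rightarrow> state \<Rightarrow> bool" where
  "frame c s s' \<longleftrightarrow> (\<forall>r. r \<notin> writes c \<longrightarrow> reg s' r = reg s r) \<and>
     (no_store c \<longrightarrow> mem s' = mem s) \<and> (no_print c \<longrightarrow> out s' = out s)"

lemma wp_mono: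
  assumes "wp m c Q s" "\<And>s'. Q s' \<Longrightarrow> Q' s'"
  shows "wp m c Q' s"
  using assms
proof (induction c arbitrary: Q Q' s)
  case (Seq c d)
  have "wp m c (wp m d Q') s"
    by (rule Seq.IH(1)[of "wp m d Q"]) (use Seq in auto)
  then show ?case by simp
next
  case (WhileLess r r' c)
  let ?F = "\<lambda>F s. reg s r < reg s r' \<and> wp m c F s"
  have "(?F ^^ k) (\<lambda>s. \<not> reg s r < reg s r' \<and> Q' s) s"
    if "(?F ^^ k) (\<lambda>s. \<not> reg s r < reg s r' \<and> Q s) s" for k s
    using that
  proof (induction k arbitrary: s)
    case 0
    then show ?case using WhileLess.prems(2) by simp
  next
    case (Suc k)
    then show ?case using WhileLess.IH[of "(?F ^^ k) (\<lambda>s. \<not> reg s r < reg s r' \<and> Q s)" s] by auto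
  qed
  then show ?case using WhileLess.prems(1) by auto
qed auto

lemma wp_and_frame:
  "wp m c Q s \<Longrightarrow> wp m c (\<lambda>s'. Q s' \<and> frame c s s') s"
proof (induction c arbitrary: Q s)
  case (Seq c d)
  have "wp m c (\<lambda>s'. wp m d Q s' \<and> frame c s s') s" using Seq.IH(1) Seq.prems by simp
  then have "wp m c (wp m d (\<lambda>s'. Q s' \<and> frame (Seq c d) s s')) s"
  proof (rule wp_mono)
    fix s' assume a: "wp m d Q s' \<and> frame c s s'"
    then have "wp m d (\<lambda>s''. Q s'' \<and> frame d s' s'') s'" using Seq.IH(2) by blast
    then show "wp m d (\<lambda>s'. Q s' \<and> frame (Seq c d) s s') s'"
      by (rule wp_mono) (use a in \<open>auto simp: frame_def\<close>)
  qed
  then show ?case by simp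
next
  case (IfLess r r' c d)
  show ?case
  proof (cases "reg s r < reg s r'")
    case True
    then have "wp m c (\<lambda>s'. Q s' \<and> frame c s s') s" using IfLess by simp
    then have "wp m c (\<lambda>s'. Q s' \<and> frame (IfLess r r' c d) s s') s"
      by (rule wp_mono) (auto simp: frame_def)
    then show ?thesis using True by simp
  next
    case False
    then have "wp m d (\<lambda>s'. Q s' \<and> frame d s s') s" using IfLess by simp
    then have "wp m d (\<lambda>s'. Q s' \<and> frame (IfLess r r' c d) s s') s"
      by (rule wp_mono) (auto simp: frame_def)
    then show ?thesis using False by simp
  qed
next
  case (WhileLess r r' c)
  let ?F = "\<lambda>F s. reg s r < reg s r' \<and> wp m c F s"
  let ?fr = "frame (WhileLess r r' c)"
  have "(?F ^^ k) (\<lambda>s'. \<not> reg s' r < reg s' r' \<and> (Q s' \<and> ?fr s s')) s"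
    if "(?F ^^ k) (\<lambda>s. \<not> reg s r < reg s r' \<and> Q s) s" for k s
    using that
  proof (induction k arbitrary: s)
    case 0
    then show ?case by (simp add: frame_def)
  next
    case (Suc k)
    have mono: "(?F ^^ k) G' s'" if "(?F ^^ k) G s'" "\<And>s. G s \<Longrightarrow> G' s" for G G' s'
      using that(1)
    proof (induction k arbitrary: s')
      case (Suc k)
      then show ?case using wp_mono[of m c "(?F ^^ k) G" s' "(?F ^^ k) G'"] by auto
    qed (use that(2) in simp)
    from Suc.prems have "wp m c (\<lambda>s'. (?F ^^ k) (\<lambda>s. \<not> reg s r < reg s r' \<and> Q s) s' \<and> frame c s s') s"
      using WhileLess.IH by simp
    then have "wp m c (\<lambda>s'. (?F ^^ k) (\<lambda>s'. \<not> reg s' r < reg s' r' \<and> (Q s' \<and> ?fr s s')) s') s"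
    proof (rule wp_mono)
      fix s' assume a: "(?F ^^ k) (\<lambda>s. \<not> reg s r < reg s r' \<and> Q s) s' \<and> frame c s s'"
      then have "(?F ^^ k) (\<lambda>s''. \<not> reg s'' r < reg s'' r' \<and> (Q s'' \<and> ?fr s' s'')) s'"
        using Suc.IH by blast
      then show "(?F ^^ k) (\<lambda>s'. \<not> reg s' r < reg s' r' \<and> (Q s' \<and> ?fr s s')) s'"
        by (rule mono) (use a in \<open>auto simp: frame_def\<close>)
    qed
    then show ?case using Suc.prems by simp
  qed
  then show ?case using WhileLess.prems by auto
qed (auto simp: frame_def)

lemma wp_conseq:
  assumes "wp m c Q s" "\<And>s'. Q s' \<Longrightarrow> frame c s s' \<Longrightarrow> Q' s'"
  shows "wp m c Q' s"
  by (rule wp_mono[OF wp_and_frame[OF assms(1)]]) (use assms(2) in auto)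

text \<open>Determinism turns a precondition for one exact final state into an equation, so that
  macros can be evaluated by rewriting.\<close>

lemma wp_eqI:
  assumes "wp m c (\<lambda>s'. s' = f) s"
  shows "wp m c Q s \<longleftrightarrow> Q f"
proof
  assume "wp m c Q s"
  then obtain t s' where "exec c s t s'" "Q s'" using wp_sound by blast
  moreover obtain t where "exec c s t f" using wp_sound[OF assms] by blast
  ultimately show "Q f" using exec_deterministic by blast
next
  assume "Q f"
  then show "wp m c Q s" by (intro wp_mono[OF assms]) auto
qed

definition For :: "nat \<Rightarrow> nat \<Rightarrow> com \<Rightarrow> com" where
  "For i b c = Seq (Const i 0) (WhileLess i b (Seq c (Inc i)))"

text \<open>\<open>Inv\<close> takes the counter as an argument, and \<open>inc\<close> lets it
  survive the increment that follows the body. In later applications obligation 7 is the loop step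
  and obligation 9 the exit.\<close>

lemma wp_For:
  assumes regs: "i \<noteq> b" "i \<notin> writes c" "b \<notin> writes c" and n: "reg s b = n" "n \<le> m"
    and init: "Inv 0 (s\<lparr>reg := (reg s)(i := 0)\<rparr>)"
    and step: "\<And>j s'. j < n \<Longrightarrow> Inv j s' \<Longrightarrow> reg s' i = j \<Longrightarrow> frame (For i b c) s s' \<Longrightarrow>
      wp m c (Inv (Suc j)) s'"
    and inc: "\<And>j s'. Inv j s' \<Longrightarrow> Inv j (s'\<lparr>reg := (reg s')(i := j)\<rparr>)"
    and final: "\<And>s'. Inv n s' \<Longrightarrow> reg s' i = n \<Longrightarrow> frame (For i b c) s s' \<Longrightarrow> Q s'"
  shows "wp m (For i b c) Q s"
proof -
  let ?F = "\<lambda>F s. reg s i < reg s b \<and> wp m (Seq c (Inc i)) F s"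
  let ?G = "\<lambda>s'. \<not> reg s' i < reg s' b \<and> Q s'"
  \<comment> \<open>The induction is on the number \<open>k\<close> of remaining iterations, as the
    precondition of \<open>WhileLess\<close> unfolds from the front.\<close>
  have main: "(?F ^^ k) ?G s'" if "Inv (n - k) s'" "reg s' i = n - k" "frame (For i b c) s s'" "k \<le> n" for k s'
    using that
  proof (induction k arbitrary: s')
    case 0
    have "reg s' b = n" using 0(3) regs n by (auto simp: frame_def For_def)
    then show ?case using final[of s'] 0 by simp
  next
    case (Suc k)
    have b: "reg s' b = n" using Suc.prems(3) regs n by (auto simp: frame_def For_def)
    have "wp m c (Inv (Suc (n - Suc k))) s'" using step[of "n - Suc k" s'] Suc.prems by simp
    then have "wp m c (wp m (Inc i) ((?F ^^ k) ?G)) s'"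
    proof (rule wp_conseq)
      fix s'' assume a: "Inv (Suc (n - Suc k)) s''" "frame c s' s''"
      have e: "Suc (n - Suc k) = n - k" using Suc.prems by simp
      have r: "reg s'' i + 1 = n - k" using a(2) regs Suc.prems by (auto simp: frame_def)
      have "(?F ^^ k) ?G (s''\<lparr>reg := (reg s'')(i := n - k)\<rparr>)"
      proof (rule Suc.IH)
        show "Inv (n - k) (s''\<lparr>reg := (reg s'')(i := n - k)\<rparr>)"
          using inc a(1) unfolding e by blast
        show "frame (For i b c) s (s''\<lparr>reg := (reg s'')(i := n - k)\<rparr>)"
          using a(2) Suc.prems(3) by (auto simp: frame_def For_def)
      qed (use Suc.prems in auto)
      then show "wp m (Inc i) ((?F ^^ k) ?G) s''" using r by simp
    qed
    then show ?case using b Suc.prems by simp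
  qed
  have "(?F ^^ n) ?G (s\<lparr>reg := (reg s)(i := 0)\<rparr>)"
    by (rule main) (use init in \<open>auto simp: frame_def For_def\<close>)
  then show ?thesis using n(2) unfolding For_def wp.simps by blast
qed

section \<open>The search program\<close>

text \<open>
  The registers \<open>rBL\<close>, \<open>rBI\<close>, \<open>rBA\<close>, \<open>rBX\<close>, \<open>rBB\<close> hold the base addresses of the characteristic
  vectors of \<open>L\<close> and \<open>I\<close>, of the adjacency matrix, of the working set \<open>X\<close> and of the component labels;
  \<open>rRA\<close> is the base address of the current row of the matrix. \<open>rP\<close> is the depth in the search tree,
  \<open>rDOWN\<close> tells whether the search is descending, and \<open>rM\<close> is one more than the largest admissible
  number of chosen vertices. \<open>rK\<close> and \<open>rPT\<close> are scratch registers of the macros below.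
\<close>

abbreviation (input) rZ :: nat where "rZ \<equiv> 2"
abbreviation (input) rN :: nat where "rN \<equiv> 3"
abbreviation (input) rBL :: nat where "rBL \<equiv> 4"
abbreviation (input) rBI :: nat where "rBI \<equiv> 5"
abbreviation (input) rBA :: nat where "rBA \<equiv> 6"
abbreviation (input) rBX :: nat where "rBX \<equiv> 7"
abbreviation (input) rBB :: nat where "rBB \<equiv> 8"
abbreviation (input) rONE :: nat where "rONE \<equiv> 9"
abbreviation (input) rTWO :: nat where "rTWO \<equiv> 10"
abbreviation (input) rM :: nat where "rM \<equiv> 11"
abbreviation (input) rP :: nat where "rP \<equiv> 12"
abbreviation (input) rDOWN :: nat where "rDOWN \<equiv> 13"
abbreviation (input) rRUN :: nat where "rRUN \<equiv> 14"
abbreviation (input) rK :: nat where "rK \<equiv> 15"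
abbreviation (input) rPT :: nat where "rPT \<equiv> 16"
abbreviation (input) rC :: nat where "rC \<equiv> 17"
abbreviation (input) rD :: nat where "rD \<equiv> 18"
abbreviation (input) rRA :: nat where "rRA \<equiv> 19"
abbreviation (input) rU :: nat where "rU \<equiv> 20"
abbreviation (input) rV :: nat where "rV \<equiv> 21"
abbreviation (input) rW :: nat where "rW \<equiv> 22"
abbreviation (input) rJ :: nat where "rJ \<equiv> 23"
abbreviation (input) rX :: nat where "rX \<equiv> 24"
abbreviation (input) rY :: nat where "rY \<equiv> 25"
abbreviation (input) rE :: nat where "rE \<equiv> 26"
abbreviation (input) rLU :: nat where "rLU \<equiv> 27"
abbreviation (input) rLV :: nat where "rLV \<equiv> 28"
abbreviation (input) rLW :: nat where "rLW \<equiv> 29"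
abbreviation (input) rF :: nat where "rF \<equiv> 30"
abbreviation (input) rT :: nat where "rT \<equiv> 31"
abbreviation (input) rMIN :: nat where "rMIN \<equiv> 32"

abbreviation (input) When :: "nat \<Rightarrow> com \<Rightarrow> com" where
  "When r c \<equiv> IfLess rZ r c Skip"

abbreviation (input) WhenEq :: "nat \<Rightarrow> nat \<Rightarrow> com \<Rightarrow> com" where
  "WhenEq r r' c \<equiv> IfLess r r' Skip (IfLess r' r Skip c)"

notation (input) Seq (infixr \<open>;;\<close> 60)

text \<open>Addition is iterated increment, so the second summand must stay within the loop bound.
  \<open>Get\<close> and \<open>Put\<close> therefore pass the index there, not the base
  address.\<close>

definition Add :: "nat \<Rightarrow> nat \<Rightarrow> nat \<Rightarrow> com" where
  "Add d a b = (Copy d a ;; For rK b (Inc d))"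

definition Get :: "nat \<Rightarrow> nat \<Rightarrow> nat \<Rightarrow> com" where
  "Get d b i = (Add rPT b i ;; Load d rPT)"

definition Put :: "nat \<Rightarrow> nat \<Rightarrow> nat \<Rightarrow> com" where
  "Put b i r = (Add rPT b i ;; Store rPT r)"

lemma macro_effects [simp]:
  "writes (For i b c) = insert i (writes c)" "no_store (For i b c) = no_store c"
  "no_print (For i b c) = no_print c"
  "writes (Add d a b) = {d, rK}" "no_store (Add d a b)" "no_print (Add d a b)"
  "writes (Get d b i) = {rPT, rK, d}" "no_store (Get d b i)" "no_print (Get d b i)"
  "writes (Put b i r) = {rPT, rK}" "\<not> no_store (Put b i r)" "no_print (Put b i r)"
  by (auto simp: For_def Add_def Get_def Put_def)

lemma wp_Add [simp]:
  assumes "d \<noteq> rK" "b \<noteq> d" "b \<noteq> rK" "reg s b \<le> m"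
  shows "wp m (Add d a b) Q s =
    Q (s\<lparr>reg := (reg s)(d := reg s a + reg s b, rK := reg s b)\<rparr>)"
proof (rule wp_eqI)
  have "wp m (For rK b (Inc d)) (\<lambda>s'. s' = s\<lparr>reg := (reg s)(d := reg s a + reg s b, rK := reg s b)\<rparr>)
      (s\<lparr>reg := (reg s)(d := reg s a)\<rparr>)"
  proof (rule wp_For[where n = "reg s b" and
        Inv = "\<lambda>j s'. \<exists>k. s' = s\<lparr>reg := (reg s)(d := reg s a + j, rK := k)\<rparr>"])
    fix j s' assume "\<exists>k. s' = s\<lparr>reg := (reg s)(d := reg s a + j, rK := k)\<rparr>"
    then obtain k where k: "s' = s\<lparr>reg := (reg s)(d := reg s a + j, rK := k)\<rparr>" by blast
    show "wp m (Inc d) (\<lambda>s'. \<exists>k. s' = s\<lparr>reg := (reg s)(d := reg s a + Suc j, rK := k)\<rparr>) s'"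
      unfolding k using assms by (auto simp: fun_upd_twist intro: exI[of _ k])
  qed (use assms in \<open>auto simp: fun_upd_twist intro: exI[of _ 0]\<close>)
  then show "wp m (Add d a b)
      (\<lambda>s'. s' = s\<lparr>reg := (reg s)(d := reg s a + reg s b, rK := reg s b)\<rparr>) s"
    by (simp add: Add_def)
qed

lemma wp_Get [simp]:
  assumes "i \<noteq> rK" "i \<noteq> rPT" "reg s i \<le> m"
  shows "wp m (Get d b i) Q s = Q (s\<lparr>reg := (reg s)(rPT := reg s b + reg s i, rK := reg s i,
    d := mem s (reg s b + reg s i))\<rparr>)"
  using assms by (simp add: Get_def)

lemma wp_Put [simp]:
  assumes "i \<noteq> rK" "i \<noteq> rPT" "r \<noteq> rK" "r \<noteq> rPT" "reg s i \<le> m"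
  shows "wp m (Put b i r) Q s = Q (s\<lparr>reg := (reg s)(rPT := reg s b + reg s i, rK := reg s i),
    mem := (mem s)(reg s b + reg s i := reg s r)\<rparr>)"
  using assms by (simp add: Put_def)

text \<open>
  Components are found by quick-find: for every edge inside \<open>X\<close> the label of one end replaces that of
  the other throughout. Each label remains the label of the vertex it names, so components are
  counted by the vertices that are labelled by themselves.
\<close>

definition Relabel :: com where
  "Relabel = For rW rN (Get rLW rBB rW ;; WhenEq rLW rLU (Put rBB rW rLV))"

definition Merge_row :: com where
  "Merge_row = For rV rN (Get rX rBX rU ;; Get rY rBX rV ;; Get rE rRA rV ;;
     When rX (When rY (When rE (Get rLU rBB rU ;; Get rLV rBB rV ;; Relabel))))"

definition Merge :: com where
  "Merge = (Copy rRA rBA ;; For rU rN (Merge_row ;; Add rRA rRA rN))"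

definition Count_components :: com where
  "Count_components = (Const rC 0 ;;
     For rU rN (Get rX rBX rU ;; When rX (Get rLU rBB rU ;; WhenEq rLU rU (Inc rC))))"

definition Dominated_row :: com where
  "Dominated_row = For rV rN (Get rX rBX rV ;; Get rE rRA rV ;; When rX (When rE (Const rF 1)))"

text \<open>Starting \<open>rD\<close> at the component count leaves the sum needed by
  \<open>cds_iff_counts\<close> in one register.\<close>

definition Count_undominated :: com where
  "Count_undominated = (Copy rD rC ;; Copy rRA rBA ;;
     For rU rN (Get rF rBX rU ;; Dominated_row ;; IfLess rF rONE (Inc rD) Skip ;; Add rRA rRA rN))"

definition Eval :: com where
  "Eval = (For rU rN (Put rBB rU rU) ;; Merge ;; Count_components ;; Count_undominated)"

section \<open>Correctness of the evaluation routine\<close>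

lemma less_mult_add: "u < n \<Longrightarrow> v < n \<Longrightarrow> u * n + v < n * (n :: nat)"
proof -
  assume "u < n" "v < n"
  then have "u * n + v < Suc u * n" by simp
  also have "\<dots> \<le> n * n" using \<open>u < n\<close> by (intro mult_right_mono) auto
  finally show ?thesis .
qed

text \<open>A union step: a new edge joins the components of its ends and no others, and so does
  overwriting one label by the other. Equal new labels give a walk, possibly through the new edge;
  conversely \<open>f'\<close> is constant along every edge.\<close>

lemma kernel_relabel_iff:
  assumes lab: "\<And>i j. i \<in> A \<Longrightarrow> j \<in> A \<Longrightarrow> f i = f j \<longleftrightarrow> (g i, g j) \<in> (F \<union> F\<inverse>)\<^sup>*"
    and F: "F \<subseteq> g ` A \<times> g ` A" and uv: "u \<in> A" "v \<in> A" and ij: "i \<in> A" "j \<in> A"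
    and f': "\<And>i. i \<in> A \<Longrightarrow> f' i = (if f i = f u then f v else f i)"
  shows "f' i = f' j \<longleftrightarrow> (g i, g j) \<in> (insert (g u, g v) F \<union> (insert (g u, g v) F)\<inverse>)\<^sup>*"
    (is "_ \<longleftrightarrow> _ \<in> ?R\<^sup>*")
proof
  have le: "(x, y) \<in> ?R\<^sup>*" if "(x, y) \<in> (F \<union> F\<inverse>)\<^sup>*" for x y
    using that rtrancl_mono[of "F \<union> F\<inverse>" ?R] by auto
  have uv': "(g u, g v) \<in> ?R\<^sup>*" "(g v, g u) \<in> ?R\<^sup>*" by auto
  have same: "(g a, g b) \<in> ?R\<^sup>*" if "f a = f b" "a \<in> A" "b \<in> A" for a b
    using le lab that by blast
  assume "f' i = f' j"
  then consider "f i = f j" | "f i = f u" "f v = f j" | "f i = f v" "f u = f j"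
    using f' ij by (metis (full_types))
  then show "(g i, g j) \<in> ?R\<^sup>*"
  proof cases
    case 1
    then show ?thesis using same ij by blast
  next
    case 2
    then have "(g i, g u) \<in> ?R\<^sup>*" "(g v, g j) \<in> ?R\<^sup>*" using same ij uv by blast+
    then show ?thesis using uv'(1) by (meson rtrancl_trans)
  next
    case 3
    then have "(g i, g v) \<in> ?R\<^sup>*" "(g u, g j) \<in> ?R\<^sup>*" using same ij uv by blast+
    then show ?thesis using uv'(2) by (meson rtrancl_trans)
  qed
next
  have edge: "f' a = f' b" if e: "(g a, g b) \<in> ?R" "a \<in> A" "b \<in> A" for a b
  proof -
    have fe: "f c = f d" if "g c = g d" "c \<in> A" "d \<in> A" for c d
      using lab[OF that(2,3)] that(1) by simp
    consider "(g a, g b) \<in> F \<union> F\<inverse>" | "g a = g u" "g b = g v" | "g a = g v" "g b = g u"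
      using e(1) by auto
    then show ?thesis
    proof cases
      case 1
      then have "(g a, g b) \<in> (F \<union> F\<inverse>)\<^sup>*" by blast
      then have "f a = f b" using lab[OF e(2,3)] by blast
      then show ?thesis using f' that by simp
    next
      case 2
      then have "f a = f u" "f b = f v" using fe[of a u] fe[of b v] e uv by blast+
      then show ?thesis using f' that by simp
    next
      case 3
      then have "f a = f v" "f b = f u" using fe[of a v] fe[of b u] e uv by blast+
      then show ?thesis using f' that by simp
    qed
  qed
  \<comment> \<open>Walks run through vertices while labels belong to indices, so the claim ranges
    over all indices naming the end points.\<close>
  have "\<forall>a b. a \<in> A \<longrightarrow> b \<in> A \<longrightarrow> x = g a \<longrightarrow> y = g b \<longrightarrow> f' a = f' b" if "(x, y) \<in> ?R\<^sup>*" for x y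
    using that
  proof (induction rule: rtrancl_induct)
    case base
    show ?case
    proof (intro allI impI)
      fix a b assume ab: "a \<in> A" "b \<in> A" "x = g a" "x = g b"
      then have "f a = f b" using lab[OF ab(1,2)] by simp
      then show "f' a = f' b" using f' ab by simp
    qed
  next
    case (step y z)
    show ?case
    proof (intro allI impI)
      fix a b assume ab: "a \<in> A" "b \<in> A" "x = g a" "z = g b"
      have "y \<in> g ` A" using step.hyps(2) F uv by auto
      then obtain c where c: "c \<in> A" "y = g c" by auto
      have "f' a = f' c" using step.IH ab c by blast
      also have "(g c, g b) \<in> ?R" using step.hyps(2) ab c by (simp only:)
      then have "f' c = f' b" using ab c by (intro edge)
      finally show "f' a = f' b" .
    qed
  qed
  moreover assume "(g i, g j) \<in> ?R\<^sup>*"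
  ultimately show "f' i = f' j" using ij by blast
qed

lemma program_effects [simp]:
  "writes Relabel = {rW, rPT, rK, rLW}" "no_print Relabel"
  "writes Merge_row = {rV, rPT, rK, rX, rY, rE, rLU, rLV, rW, rLW}" "no_print Merge_row"
  "writes Merge = {rRA, rU, rV, rPT, rK, rX, rY, rE, rLU, rLV, rW, rLW}" "no_print Merge"
  "writes Count_components = {rC, rU, rPT, rK, rX, rLU}" "no_print Count_components"
  "no_store Count_components"
  "writes Dominated_row = {rV, rPT, rK, rX, rE, rF}" "no_print Dominated_row" "no_store Dominated_row"
  "writes Count_undominated = {rD, rRA, rU, rPT, rK, rV, rX, rE, rF}" "no_print Count_undominated"
  "no_store Count_undominated"
  by (auto simp: Relabel_def Merge_row_def Merge_def Count_components_def Dominated_row_def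
      Count_undominated_def)

locale ram_instance = extension_setting +
  fixes vs :: "'a list"
  assumes dist: "distinct vs" and set_vs: "set vs = V"
begin

abbreviation "n \<equiv> length vs"

text \<open>The layout of \<open>encode_instance\<close>: two header cells, five vectors with
  \<open>L\<close> first and \<open>I\<close> fourth, then the matrix. The work areas
  \<open>bX\<close> and \<open>bB\<close> start right behind the input.\<close>

definition bL :: nat where "bL = 2"
definition bI :: nat where "bI = 2 + 3 * n"
definition bA :: nat where "bA = 2 + 5 * n"
definition bX :: nat where "bX = bA + n * n"
definition bB :: nat where "bB = bX + n"

definition env :: "state \<Rightarrow> bool" where
  "env s \<longleftrightarrow> reg s rZ = 0 \<and> reg s rN = n \<and> reg s rBL = bL \<and> reg s rBI = bI \<and>
     reg s rBA = bA \<and> reg s rBX = bX \<and> reg s rBB = bB \<and> reg s rONE = 1 \<and> reg s rTWO = 2"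

definition inp :: "(nat \<Rightarrow> nat) \<Rightarrow> bool" where
  "inp f \<longleftrightarrow> (\<forall>j<n. f (bL + j) = of_bool (vs ! j \<in> L)) \<and>
     (\<forall>j<n. f (bI + j) = of_bool (vs ! j \<in> I)) \<and>
     (\<forall>u<n. \<forall>v<n. f (bA + u * n + v) = of_bool ((vs ! u, vs ! v) \<in> E))"

definition holds :: "(nat \<Rightarrow> nat) \<Rightarrow> 'a set \<Rightarrow> bool" where
  "holds f X \<longleftrightarrow> inp f \<and> (\<forall>j<n. f (bX + j) = of_bool (vs ! j \<in> X))"

lemma inp_upd: "bX \<le> a \<Longrightarrow> inp (f(a := k)) = inp f"
proof -
  assume a: "bX \<le> a"
  have "bL + j \<noteq> a" "bI + j \<noteq> a" if "j < n" for j
    using that a unfolding bX_def bL_def bI_def bA_def by linarith+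
  moreover have "bA + u * n + v \<noteq> a" if "u < n" "v < n" for u v
    using less_mult_add[OF that] a unfolding bX_def by linarith
  ultimately show ?thesis by (simp add: inp_def)
qed

lemma holds_upd_label [simp]: "holds (f(bB + j := k)) X = holds f X"
proof -
  have "bX + i \<noteq> bB + j" if "i < n" for i using that by (simp add: bB_def)
  then show ?thesis using inp_upd[of "bB + j" f k] by (simp add: holds_def bB_def)
qed

lemma holds_insert: "holds f X \<Longrightarrow> j < n \<Longrightarrow> holds (f(bX + j := Suc 0)) (insert (vs ! j) X)"
  using inp_upd[of "bX + j" f "Suc 0"] dist by (auto simp: holds_def nth_eq_iff_index_eq)

lemma holds_remove: "holds f X \<Longrightarrow> j < n \<Longrightarrow> holds (f(bX + j := 0)) (X - {vs ! j})"
  using inp_upd[of "bX + j" f 0] dist by (auto simp: holds_def nth_eq_iff_index_eq)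

lemma read_L: "holds f X \<Longrightarrow> j < n \<Longrightarrow> f (bL + j) = of_bool (vs ! j \<in> L)"
  and read_E: "holds f X \<Longrightarrow> u < n \<Longrightarrow> v < n \<Longrightarrow>
    f (bA + u * n + v) = of_bool ((vs ! u, vs ! v) \<in> E)"
  and read_X: "holds f X \<Longrightarrow> j < n \<Longrightarrow> f (bX + j) = of_bool (vs ! j \<in> X)"
  by (auto simp: holds_def inp_def)

lemma in_V: "j < n \<Longrightarrow> vs ! j \<in> V"
  using set_vs by auto

lemma index_exists: "x \<in> V \<Longrightarrow> \<exists>j<n. vs ! j = x"
  using set_vs by (metis in_set_conv_nth)

lemma card_index_set:
  assumes "Y \<subseteq> V" "\<And>j. j < n \<Longrightarrow> P j \<longleftrightarrow> vs ! j \<in> Y"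
  shows "card {j. j < n \<and> P j} = card Y"
proof (rule bij_betw_same_card[of "(!) vs"])
  show "bij_betw ((!) vs) {j. j < n \<and> P j} Y"
    unfolding bij_betw_def
  proof
    show "inj_on ((!) vs) {j. j < n \<and> P j}" using dist by (auto simp: inj_on_def nth_eq_iff_index_eq)
    show "(!) vs ` {j. j < n \<and> P j} = Y" using assms index_exists by (auto simp: image_iff) (metis subsetD)
  qed
qed

lemma card_less_Suc_filter:
  "card {j. j < Suc u \<and> P j} = (if P u then Suc (card {j. j < u \<and> P j}) else card {j. j < u \<and> P j})"
proof -
  have "{j. j < Suc u \<and> P j} = (if P u then insert u {j. j < u \<and> P j} else {j. j < u \<and> P j})"
    by (auto simp: less_Suc_eq)
  then show ?thesis by simp
qed

text \<open>The converse of \<open>F\<close> is added because arcs are processed one at a time and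
  the pairs seen so far are not symmetric. By the second conjunct a label names a vertex of its own
  class.\<close>

definition labelling :: "(nat \<Rightarrow> nat) \<Rightarrow> 'a set \<Rightarrow> 'a rel \<Rightarrow> bool" where
  "labelling f X F \<longleftrightarrow>
     (\<forall>i j. i < n \<longrightarrow> j < n \<longrightarrow> vs ! i \<in> X \<longrightarrow> vs ! j \<in> X \<longrightarrow>
        (f i = f j \<longleftrightarrow> (vs ! i, vs ! j) \<in> (F \<union> F\<inverse>)\<^sup>*)) \<and>
     (\<forall>i<n. vs ! i \<in> X \<longrightarrow> f i < n \<and> vs ! f i \<in> X \<and> f (f i) = f i)"

lemma labelling_insert:
  assumes "labelling f X F" "F \<subseteq> X \<times> X" "X \<subseteq> V" "u < n" "v < n" "vs ! u \<in> X" "vs ! v \<in> X"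
    and f': "\<And>i. i < n \<Longrightarrow> f' i = (if f i = f u then f v else f i)"
  shows "labelling f' X (insert (vs ! u, vs ! v) F)"
proof -
  let ?A = "{i. i < n \<and> vs ! i \<in> X}"
  have img: "X \<subseteq> (!) vs ` ?A"
  proof
    fix x assume x: "x \<in> X"
    then obtain j where "j < n" "vs ! j = x" using index_exists assms(3) by blast
    then show "x \<in> (!) vs ` ?A" using x by auto
  qed
  have "f' i = f' j \<longleftrightarrow>
      (vs ! i, vs ! j) \<in> (insert (vs ! u, vs ! v) F \<union> (insert (vs ! u, vs ! v) F)\<inverse>)\<^sup>*"
    if "i < n" "j < n" "vs ! i \<in> X" "vs ! j \<in> X" for i j
  proof (rule kernel_relabel_iff[of ?A f "(!) vs"])
    show "F \<subseteq> (!) vs ` ?A \<times> (!) vs ` ?A" using assms(2) img by blast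
    show "f i = f j \<longleftrightarrow> (vs ! i, vs ! j) \<in> (F \<union> F\<inverse>)\<^sup>*" if "i \<in> ?A" "j \<in> ?A" for i j
      using assms(1) that unfolding labelling_def by blast
  qed (use that assms in auto)
  moreover have "f' i < n \<and> vs ! f' i \<in> X \<and> f' (f' i) = f' i" if "i < n" "vs ! i \<in> X" for i
  proof -
    have *: "f k < n \<and> vs ! f k \<in> X \<and> f (f k) = f k" if "k < n" "vs ! k \<in> X" for k
      using assms(1) that unfolding labelling_def by blast
    show ?thesis using *[of i] *[of v] f' that assms(4-7) by auto
  qed
  ultimately show ?thesis unfolding labelling_def by blast
qed

text \<open>Every component contains exactly one self-labelled index, namely the common label of its
  vertices.\<close>

lemma card_fixpoints_labelling:
  assumes lab: "labelling f X (Restr E X)" and X: "X \<subseteq> V"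
  shows "card {i. i < n \<and> vs ! i \<in> X \<and> f i = i} = ncomp E X"
  unfolding ncomp_def
proof (rule bij_betw_same_card[of "\<lambda>i. comp_rel E X `` {vs ! i}"])
  have sym: "Restr E X \<union> (Restr E X)\<inverse> = Restr E X" using symE by (auto dest: symD)
  have eq: "f i = f j \<longleftrightarrow> (vs ! i, vs ! j) \<in> comp_rel E X"
    if "i < n" "j < n" "vs ! i \<in> X" "vs ! j \<in> X" for i j
    using lab that unfolding labelling_def comp_rel_def sym by blast
  have idem: "f i < n \<and> vs ! f i \<in> X \<and> f (f i) = f i" if "i < n" "vs ! i \<in> X" for i
    using lab that unfolding labelling_def by blast
  have equ: "equiv X (comp_rel E X)" using symE by (rule equiv_comp_rel)
  show "bij_betw (\<lambda>i. comp_rel E X `` {vs ! i}) {i. i < n \<and> vs ! i \<in> X \<and> f i = i} (X // comp_rel E X)"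
    unfolding bij_betw_def
  proof
    show "inj_on (\<lambda>i. comp_rel E X `` {vs ! i}) {i. i < n \<and> vs ! i \<in> X \<and> f i = i}"
    proof (rule inj_onI)
      fix i j assume a: "i \<in> {i. i < n \<and> vs ! i \<in> X \<and> f i = i}" "j \<in> {i. i < n \<and> vs ! i \<in> X \<and> f i = i}"
        "comp_rel E X `` {vs ! i} = comp_rel E X `` {vs ! j}"
      then have "(vs ! i, vs ! j) \<in> comp_rel E X" using eq_equiv_class[OF _ equ] by blast
      then show "i = j" using a(1,2) eq[of i j] by auto
    qed
    show "(\<lambda>i. comp_rel E X `` {vs ! i}) ` {i. i < n \<and> vs ! i \<in> X \<and> f i = i} = X // comp_rel E X"
    proof (intro equalityI image_subsetI subsetI)
      fix K assume "K \<in> X // comp_rel E X"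
      then obtain x where x: "x \<in> X" "K = comp_rel E X `` {x}" by (rule quotientE)
      then obtain k where k: "k < n" "vs ! k = x" using index_exists X by blast
      have i: "f k < n" "vs ! f k \<in> X" "f (f k) = f k" using idem[of k] k x by auto
      then have "(vs ! f k, vs ! k) \<in> comp_rel E X" using eq[of "f k" k] k x by auto
      then have "comp_rel E X `` {vs ! f k} = K" using equiv_class_eq[OF equ] k x by blast
      then show "K \<in> (\<lambda>i. comp_rel E X `` {vs ! i}) ` {i. i < n \<and> vs ! i \<in> X \<and> f i = i}"
        using i by blast
    qed (auto intro: quotientI)
  qed
qed

lemma wp_Relabel:
  assumes "env s" "holds (mem s) X"
  shows "wp n Relabel (\<lambda>s'. holds (mem s') X \<and> (\<forall>w<n. mem s' (bB + w) =
    (if mem s (bB + w) = reg s rLU then reg s rLV else mem s (bB + w)))) s"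
  unfolding Relabel_def
proof (rule wp_For[where n = n and Inv = "\<lambda>j s'. holds (mem s') X \<and> (\<forall>w<n. mem s' (bB + w) =
    (if w < j \<and> mem s (bB + w) = reg s rLU then reg s rLV else mem s (bB + w)))"], goal_cases)
  case (7 j s')
  have r: "reg s' 3 = n" "reg s' 8 = bB" "reg s' 27 = reg s 27" "reg s' 28 = reg s 28"
    using 7(4) assms(1) by (auto simp: frame_def env_def)
  show ?case
    using 7(1-3) r by (auto simp: less_Suc_eq)
qed (use assms in \<open>auto simp: env_def\<close>)

lemma env_frame: "env s \<Longrightarrow> frame c s s' \<Longrightarrow> writes c \<inter> {2..10} = {} \<Longrightarrow> env s'"
proof -
  assume a: "env s" "frame c s s'" "writes c \<inter> {2..10} = {}"
  have "reg s' r = reg s r" if "2 \<le> r" "r \<le> 10" for r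
  proof -
    have "r \<notin> writes c" using a(3) that by (metis atLeastAtMost_iff disjoint_iff)
    then show ?thesis using a(2) by (simp add: frame_def)
  qed
  then show "env s'" using a(1) by (simp add: env_def)
qed

definition done_pairs :: "nat \<Rightarrow> nat \<Rightarrow> 'a rel" where
  "done_pairs u v = {(vs ! i, vs ! j) | i j. i < n \<and> j < n \<and> (i < u \<or> i = u \<and> j < v)}"

lemma done_pairs_Suc: "u < n \<Longrightarrow> v < n \<Longrightarrow> done_pairs u (Suc v) = insert (vs ! u, vs ! v) (done_pairs u v)"
  by (auto simp: done_pairs_def less_Suc_eq)

lemma done_pairs_row: "done_pairs u n = done_pairs (Suc u) 0"
  by (auto simp: done_pairs_def less_Suc_eq)

lemma done_pairs_all: "X \<subseteq> V \<Longrightarrow> done_pairs n 0 \<inter> Restr E X = Restr E X"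
proof -
  assume X: "X \<subseteq> V"
  have "(x, y) \<in> done_pairs n 0" if xy: "x \<in> X" "y \<in> X" for x y
  proof -
    obtain i j where "i < n" "vs ! i = x" "j < n" "vs ! j = y" using index_exists X xy by (metis subsetD)
    then show ?thesis by (auto simp: done_pairs_def)
  qed
  then show "done_pairs n 0 \<inter> Restr E X = Restr E X" by auto
qed

lemma wp_Merge_row:
  assumes "env s" "holds (mem s) X" "X \<subseteq> V" and u: "reg s rU < n" "reg s rRA = bA + reg s rU * n"
    and "labelling (\<lambda>j. mem s (bB + j)) X (done_pairs (reg s rU) 0 \<inter> Restr E X)"
  shows "wp n Merge_row (\<lambda>s'. holds (mem s') X \<and>
    labelling (\<lambda>j. mem s' (bB + j)) X (done_pairs (Suc (reg s rU)) 0 \<inter> Restr E X)) s"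
  unfolding Merge_row_def
proof (rule wp_For[where n = n and Inv = "\<lambda>v s'. holds (mem s') X \<and>
    labelling (\<lambda>j. mem s' (bB + j)) X (done_pairs (reg s rU) v \<inter> Restr E X)"], goal_cases)
  case (7 v s')
  define u where "u = reg s rU"
  have r: "env s'" "reg s' rU = u" "reg s' rRA = bA + u * n" "reg s' rV = v" "u < n" "v < n"
    using env_frame[OF assms(1) 7(4)] 7 assms u by (auto simp: frame_def u_def)
  let ?F = "done_pairs u v \<inter> Restr E X"
  have lab: "labelling (\<lambda>j. mem s' (bB + j)) X ?F" and h: "holds (mem s') X"
    using 7(2) by (auto simp: u_def)
  note reads = read_X[OF h] read_E[OF h]
  show ?case
  proof (cases "vs ! u \<in> X \<and> vs ! v \<in> X \<and> (vs ! u, vs ! v) \<in> E")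
    case False
    then have "done_pairs u (Suc v) \<inter> Restr E X = ?F" using r by (auto simp: done_pairs_Suc)
    then show ?thesis using False r 7(2) by (auto simp: env_def reads u_def[symmetric])
  next
    case True
    then have F: "done_pairs u (Suc v) \<inter> Restr E X = insert (vs ! u, vs ! v) ?F"
      using r by (auto simp: done_pairs_Suc)
    have "wp n Relabel (\<lambda>s''. holds (mem s'') X \<and>
        labelling (\<lambda>j. mem s'' (bB + j)) X (done_pairs u (Suc v) \<inter> Restr E X)) t"
      if t: "env t" "mem t = mem s'" "reg t rLU = mem s' (bB + u)" "reg t rLV = mem s' (bB + v)" for t
    proof (rule wp_mono[OF wp_Relabel[OF t(1), of X]])
      fix s'' assume a: "holds (mem s'') X \<and> (\<forall>w<n. mem s'' (bB + w) =
        (if mem t (bB + w) = reg t rLU then reg t rLV else mem t (bB + w)))"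
      have "labelling (\<lambda>j. mem s'' (bB + j)) X (insert (vs ! u, vs ! v) ?F)"
        by (rule labelling_insert[OF lab]) (use a t r True assms(3) in auto)
      then show "holds (mem s'') X \<and>
          labelling (\<lambda>j. mem s'' (bB + j)) X (done_pairs u (Suc v) \<inter> Restr E X)"
        using a F by simp
    qed (use h t in simp)
    then show ?thesis using True r by (auto simp: env_def reads u_def[symmetric])
  qed
qed (use assms in \<open>auto simp: env_def done_pairs_row\<close>)

lemma wp_Merge:
  assumes "env s" "holds (mem s) X" "X \<subseteq> V" "labelling (\<lambda>j. mem s (bB + j)) X {}"
  shows "wp n Merge (\<lambda>s'. holds (mem s') X \<and> labelling (\<lambda>j. mem s' (bB + j)) X (Restr E X)) s"
proof -
  let ?s = "s\<lparr>reg := (reg s)(rRA := reg s rBA)\<rparr>"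
  have 0: "done_pairs 0 0 = {}" by (auto simp: done_pairs_def)
  have "wp n (For rU rN (Merge_row ;; Add rRA rRA rN))
    (\<lambda>s'. holds (mem s') X \<and> labelling (\<lambda>j. mem s' (bB + j)) X (Restr E X)) ?s"
  proof (rule wp_For[where n = n and Inv = "\<lambda>u s'. holds (mem s') X \<and> reg s' rRA = bA + u * n \<and>
      labelling (\<lambda>j. mem s' (bB + j)) X (done_pairs u 0 \<inter> Restr E X)"], goal_cases)
    case (7 u s')
    have "env ?s" using assms(1) by (simp add: env_def)
    then have e: "env s'" by (rule env_frame[OF _ 7(4)]) auto
    show ?case
      unfolding wp.simps
    proof (rule wp_conseq[OF wp_Merge_row[OF e, of X]], goal_cases)
      case (6 s'')
      have "env s''" by (rule env_frame[OF e 6(2)]) auto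
      moreover have "reg s'' rRA = reg s' rRA" "reg s'' rU = u"
        using 6(2) 7(3) by (auto simp: frame_def)
      ultimately show ?case using 6(1) 7 by (auto simp: env_def)
    qed (use 7 assms(3) in auto)
  qed (use assms 0 in \<open>auto simp: env_def done_pairs_all\<close>)
  then show ?thesis by (simp add: Merge_def)
qed

lemma wp_Count_components:
  assumes "env s" "holds (mem s) X" "X \<subseteq> V" "labelling (\<lambda>j. mem s (bB + j)) X (Restr E X)"
  shows "wp n Count_components (\<lambda>s'. reg s' rC = ncomp E X) s"
proof -
  let ?s = "s\<lparr>reg := (reg s)(rC := 0)\<rparr>"
  let ?P = "\<lambda>j. vs ! j \<in> X \<and> mem s (bB + j) = j"
  have "wp n (For rU rN (Get rX rBX rU ;; When rX (Get rLU rBB rU ;; WhenEq rLU rU (Inc rC))))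
    (\<lambda>s'. reg s' rC = ncomp E X) ?s"
  proof (rule wp_For[where n = n and Inv = "\<lambda>u s'. reg s' rC = card {j. j < u \<and> ?P j}"], goal_cases)
    case (7 u s')
    have "env s'" "mem s' = mem s" using assms(1) 7(4) by (auto simp: env_def frame_def)
    then show ?case using 7(1-3) read_X[OF assms(2)] unfolding card_less_Suc_filter
      by (auto simp: env_def)
  qed (use assms card_fixpoints_labelling[OF assms(4,3)] in \<open>auto simp: env_def\<close>)
  then show ?thesis by (simp add: Count_components_def)
qed

lemma wp_Dominated_row:
  assumes "env s" "holds (mem s) X" "X \<subseteq> V" and u: "reg s rU < n" "reg s rRA = bA + reg s rU * n"
    and "reg s rF = of_bool (vs ! reg s rU \<in> X)"
  shows "wp n Dominated_row (\<lambda>s'. reg s' rF = of_bool (vs ! reg s rU \<notin> undom E V X)) s"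
  unfolding Dominated_row_def
proof (rule wp_For[where n = n and Inv = "\<lambda>v s'. reg s' rF = of_bool (vs ! reg s rU \<in> X \<or>
    (\<exists>j<v. vs ! j \<in> X \<and> (vs ! reg s rU, vs ! j) \<in> E))"], goal_cases)
  case (7 v s')
  have "env s'" "mem s' = mem s" "reg s' rRA = bA + reg s rU * n" using assms(1,5) 7(4) by (auto simp: env_def frame_def)
  then show ?case using 7(1-3) read_X[OF assms(2)] read_E[OF assms(2) u(1)]
    by (auto simp: env_def less_Suc_eq)
next
  case (9 s')
  have "(\<exists>j<n. vs ! j \<in> X \<and> (vs ! reg s rU, vs ! j) \<in> E) \<longleftrightarrow> (\<exists>x\<in>X. (vs ! reg s rU, x) \<in> E)"
    using index_exists assms(3) by (metis subsetD)
  then show ?case using 9 in_V[OF u(1)] by (auto simp: undom_def)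
qed (use assms in \<open>auto simp: env_def\<close>)

lemma wp_Count_undominated:
  assumes "env s" "holds (mem s) X" "X \<subseteq> V"
  shows "wp n Count_undominated (\<lambda>s'. reg s' rD = reg s rC + card (undom E V X)) s"
proof -
  let ?s = "s\<lparr>reg := (reg s)(rD := reg s rC, rRA := reg s rBA)\<rparr>"
  let ?B = "Get rF rBX rU ;; Dominated_row ;; IfLess rF rONE (Inc rD) Skip ;; Add rRA rRA rN"
  let ?P = "\<lambda>j. vs ! j \<in> undom E V X"
  have "wp n (For rU rN ?B) (\<lambda>s'. reg s' rD = reg s rC + card (undom E V X)) ?s"
  proof (rule wp_For[where n = n and Inv = "\<lambda>u s'. reg s' rRA = bA + u * n \<and>
      reg s' rD = reg s rC + card {j. j < u \<and> ?P j}"], goal_cases)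
    case (7 u s')
    have "env ?s" using assms(1) by (simp add: env_def)
    then have e: "env s'" by (rule env_frame[OF _ 7(4)]) auto
    have m: "mem s' = mem s" using 7(4) by (auto simp: frame_def)
    note inv = 7(2) and u = 7(1,3)
    let ?t = "s'\<lparr>reg := (reg s')(rPT := bX + u, rK := u, rF := of_bool (vs ! u \<in> X))\<rparr>"
    have "wp n Dominated_row (wp n (IfLess rF rONE (Inc rD) Skip ;; Add rRA rRA rN)
        (\<lambda>s'. reg s' rRA = bA + Suc u * n \<and> reg s' rD = reg s rC + card {j. j < Suc u \<and> ?P j})) ?t"
    proof (rule wp_conseq[OF wp_Dominated_row[of _ X]], goal_cases)
      case (7 t)
      have t: "env t" by (rule env_frame[OF _ 7(2)]) (use e in \<open>auto simp: env_def\<close>)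
      have "reg t rRA = bA + u * n" "reg t rD = reg s rC + card {j. j < u \<and> ?P j}"
        using 7(2) inv by (auto simp: frame_def)
      then show ?case using t 7(1) u unfolding card_less_Suc_filter by (auto simp: env_def)
    qed (use e m assms 7 in \<open>auto simp: env_def\<close>)
    then show ?case using e m 7(1-3) read_X[OF assms(2)] by (simp add: env_def)
  next
    case (9 s')
    have "card {j. j < n \<and> ?P j} = card (undom E V X)"
      by (rule card_index_set) (auto simp: undom_def)
    then show ?case using 9 by simp
  qed (use assms in \<open>auto simp: env_def\<close>)
  then show ?thesis by (simp add: Count_undominated_def)
qed

lemma wp_Eval:
  assumes "env s" "holds (mem s) X" "X \<subseteq> V"
  shows "wp n Eval (\<lambda>s'. holds (mem s') X \<and> reg s' rC = ncomp E X \<and>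
    reg s' rD = ncomp E X + card (undom E V X)) s"
proof -
  have init: "wp n (For rU rN (Put rBB rU rU)) (\<lambda>s'. holds (mem s') X \<and> (\<forall>w<n. mem s' (bB + w) = w)) s"
    by (rule wp_For[where n = n and Inv = "\<lambda>j s'. holds (mem s') X \<and> (\<forall>w<j. mem s' (bB + w) = w)"])
      (use assms in \<open>auto simp: env_def frame_def less_Suc_eq\<close>)
  have lab: "labelling f X {}" if "\<forall>w<n. f w = w" for f
    using that dist unfolding labelling_def by (auto simp: nth_eq_iff_index_eq)
  have "wp n (For rU rN (Put rBB rU rU)) (wp n Merge (wp n Count_components (wp n Count_undominated
    (\<lambda>s'. holds (mem s') X \<and> reg s' rC = ncomp E X \<and>
      reg s' rD = ncomp E X + card (undom E V X))))) s"
  proof (rule wp_conseq[OF init], goal_cases)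
    case (1 s1)
    have e1: "env s1" by (rule env_frame[OF assms(1) 1(2)]) auto
    have l1: "labelling (\<lambda>j. mem s1 (bB + j)) X {}" by (rule lab) (use 1 in simp)
    show ?case
    proof (rule wp_conseq[OF wp_Merge[OF e1 _ assms(3) l1]], goal_cases)
      case (2 s2)
      have e2: "env s2" by (rule env_frame[OF e1 2(2)]) auto
      show ?case
      proof (rule wp_conseq[OF wp_Count_components[OF e2 _ assms(3)]], goal_cases)
        case (3 s3)
        have e3: "env s3" by (rule env_frame[OF e2 3(2)]) auto
        have h3: "holds (mem s3) X" using 3(2) 2(1) by (simp add: frame_def)
        show ?case
          by (rule wp_conseq[OF wp_Count_undominated[OF e3 h3 assms(3)]])
            (use 3 h3 in \<open>auto simp: frame_def\<close>)
      qed (use 2 in auto)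
    qed (use 1 in auto)
  qed
  then show ?thesis by (simp add: Eval_def)
qed

end

section \<open>Routines of the backtracking search\<close>

definition Count_chosen :: com where
  "Count_chosen = (Const rT 0 ;;
     For rU rP (Get rX rBL rU ;; Get rY rBX rU ;; When rX (When rY (Inc rT))))"

definition Print_set :: com where
  "Print_set = (For rU rN (Get rX rBL rU ;; Get rY rBX rU ;;
     When rX (When rY (Copy rE rU ;; Inc rE ;; Print rE))) ;; Print rZ)"

text \<open>Single deletions suffice by \<open>mext_iff\<close>; each vertex is put back before the
  next one is tried.\<close>

definition Check_minimal :: com where
  "Check_minimal = (Const rMIN 1 ;; For rJ rN (Get rX rBL rJ ;; Get rY rBX rJ ;;
     When rX (When rY (Put rBX rJ rZ ;; Eval ;; When rC (IfLess rD rTWO (Const rMIN 0) Skip) ;;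
       Put rBX rJ rONE))))"

definition Leaf :: com where
  "Leaf = (Check_minimal ;; When rMIN Print_set)"

text \<open>
  Backtracking happens in place: \<open>X\<close> contains all undecided vertices of \<open>L\<close>. On the way up, a vertex
  of \<open>L\<close> that is in \<open>X\<close> has only had its first branch explored and is now discarded, whereas a
  discarded vertex is put back.
\<close>

definition Down :: com where
  "Down = (Eval ;; Count_chosen ;;
     IfLess rZ rC
       (IfLess rD rTWO
         (IfLess rT rM (IfLess rP rN (Inc rP) (Leaf ;; Const rDOWN 0)) (Const rDOWN 0))
         (Const rDOWN 0))
       (Const rDOWN 0))"

definition Up :: com where
  "Up = IfLess rZ rP
     (Dec rP ;; Get rX rBL rP ;; When rX (Get rY rBX rP ;;
        IfLess rZ rY (Put rBX rP rZ ;; Inc rP ;; Const rDOWN 1) (Put rBX rP rONE)))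
     (Const rRUN 0)"

definition Body :: com where
  "Body = IfLess rZ rDOWN Down Up"

definition Loop :: com where
  "Loop = WhileLess rZ rRUN Body"

lemma search_effects [simp]:
  "writes Eval = {rU, rPT, rK, rRA, rV, rX, rY, rE, rLU, rLV, rW, rLW, rC, rD, rF}" "no_print Eval"
  "writes Count_chosen = {rT, rU, rPT, rK, rX, rY}" "no_store Count_chosen" "no_print Count_chosen"
  "writes Print_set = {rU, rPT, rK, rX, rY, rE}" "no_store Print_set"
  "writes Check_minimal = {rMIN, rJ, rU, rPT, rK, rRA, rV, rX, rY, rE, rLU, rLV, rW, rLW, rC, rD, rF}"
  "no_print Check_minimal"
  by (auto simp: Eval_def Count_chosen_def Print_set_def Check_minimal_def)

context ram_instance
begin

text \<open>Only indices below \<open>rP\<close> are decided. Undecided vertices of \<open>L\<close>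
  lie in \<open>X\<close> as well but do not count as chosen.\<close>

lemma wp_Count_chosen:
  assumes "env s" "holds (mem s) X" "reg s rP \<le> n"
  shows "wp n Count_chosen (\<lambda>s'. reg s' rT = card {j. j < reg s rP \<and> vs ! j \<in> X \<inter> L}) s"
proof -
  let ?s = "s\<lparr>reg := (reg s)(rT := 0)\<rparr>"
  have "wp n (For rU rP (Get rX rBL rU ;; Get rY rBX rU ;; When rX (When rY (Inc rT))))
    (\<lambda>s'. reg s' rT = card {j. j < reg s rP \<and> vs ! j \<in> X \<inter> L}) ?s"
  proof (rule wp_For[where n = "reg s rP" and
        Inv = "\<lambda>u s'. reg s' rT = card {j. j < u \<and> vs ! j \<in> X \<inter> L}"], goal_cases)
    case (7 u s')
    have "env s'" "mem s' = mem s" using assms(1) 7(4) by (auto simp: env_def frame_def)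
    then show ?case using 7(1-3) assms(3) read_X[OF assms(2)] read_L[OF assms(2)]
      unfolding card_less_Suc_filter by (auto simp: env_def)
  qed (use assms in \<open>auto simp: env_def\<close>)
  then show ?thesis by (simp add: Count_chosen_def)
qed

lemma wp_Print_set:
  assumes "env s" "holds (mem s) X"
  shows "wp n Print_set (\<lambda>s'. out s' = out s @ encode_set vs (X \<inter> L)) s"
proof -
  have "wp n (For rU rN (Get rX rBL rU ;; Get rY rBX rU ;;
      When rX (When rY (Copy rE rU ;; Inc rE ;; Print rE)))) (wp n (Print rZ)
    (\<lambda>s'. out s' = out s @ encode_set vs (X \<inter> L))) s"
  proof (rule wp_For[where n = n and
        Inv = "\<lambda>u s'. out s' = out s @ map Suc (filter (\<lambda>i. vs ! i \<in> X \<inter> L) [0..<u])"], goal_cases)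
    case (7 u s')
    have "env s'" "mem s' = mem s" using assms(1) 7(4) by (auto simp: env_def frame_def)
    then show ?case using 7(1-3) read_X[OF assms(2)] read_L[OF assms(2)] by (auto simp: env_def)
  next
    case (9 s')
    have "env s'" using assms(1) 9(3) by (auto simp: env_def frame_def)
    then show ?case using 9(1) by (simp add: encode_set_def env_def)
  qed (use assms in \<open>auto simp: env_def\<close>)
  then show ?thesis by (simp add: Print_set_def)
qed

definition removable :: "'a set \<Rightarrow> nat \<Rightarrow> bool" where
  "removable X j \<longleftrightarrow> vs ! j \<in> X \<inter> L \<and> cds E V (X - {vs ! j})"

lemma wp_Check_minimal:
  assumes "env s" "holds (mem s) X" "X \<subseteq> V"
  shows "wp n Check_minimal (\<lambda>s'. holds (mem s') X \<and> reg s' rMIN = of_bool (\<forall>j<n. \<not> removable X j)) s"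
proof -
  let ?s = "s\<lparr>reg := (reg s)(rMIN := 1)\<rparr>"
  let ?B = "Get rX rBL rJ ;; Get rY rBX rJ ;;
     When rX (When rY (Put rBX rJ rZ ;; Eval ;; When rC (IfLess rD rTWO (Const rMIN 0) Skip) ;;
       Put rBX rJ rONE))"
  have "wp n (For rJ rN ?B) (\<lambda>s'. holds (mem s') X \<and> reg s' rMIN = of_bool (\<forall>j<n. \<not> removable X j)) ?s"
  proof (rule wp_For[where n = n and Inv = "\<lambda>u s'. holds (mem s') X \<and>
      reg s' rMIN = of_bool (\<forall>j<u. \<not> removable X j)"], goal_cases)
    case (7 u s')
    have "env ?s" using assms(1) by (simp add: env_def)
    then have e: "env s'" by (rule env_frame[OF _ 7(4)]) auto
    have h: "holds (mem s') X" using 7(2) by simp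
    show ?case
    proof (cases "vs ! u \<in> X \<inter> L")
      case False
      then have "(\<forall>j<Suc u. \<not> removable X j) \<longleftrightarrow> (\<forall>j<u. \<not> removable X j)"
        by (auto simp: less_Suc_eq removable_def)
      then show ?thesis using 7(1-3) e False read_X[OF h] read_L[OF h] by (auto simp: env_def)
    next
      case True
      have "wp n Eval (wp n (When rC (IfLess rD rTWO (Const rMIN 0) Skip) ;; Put rBX rJ rONE)
         (\<lambda>s'. holds (mem s') X \<and> reg s' rMIN = of_bool (\<forall>j<Suc u. \<not> removable X j))) t"
        if t: "env t" "holds (mem t) (X - {vs ! u})" "reg t rMIN = reg s' rMIN" "reg t rJ = u" for t
      proof (rule wp_conseq[OF wp_Eval[OF t(1,2)]], goal_cases)
        case (2 t')
        have t': "env t'" by (rule env_frame[OF t(1) 2(2)]) auto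
        have r: "reg t' rMIN = of_bool (\<forall>j<u. \<not> removable X j)" "reg t' rJ = u"
          using t 2(2) 7(2) by (auto simp: frame_def)
        have c: "cds E V (X - {vs ! u}) \<longleftrightarrow> 0 < reg t' rC \<and> reg t' rD < 2"
          using cds_iff_counts[OF finV symE, of "X - {vs ! u}"] assms(3) 2(1) by auto
        have "holds ((mem t')(bX + u := Suc 0)) X"
          using holds_insert[of "mem t'" "X - {vs ! u}" u] 2(1) 7(1) True by (simp add: insert_absorb)
        moreover have "(\<forall>j<Suc u. \<not> removable X j) \<longleftrightarrow>
            (\<forall>j<u. \<not> removable X j) \<and> \<not> cds E V (X - {vs ! u})"
          using True by (auto simp: less_Suc_eq removable_def)
        ultimately show ?case using t' r c 7(1) by (auto simp: env_def)
      qed (use assms in auto)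
      moreover have "holds ((mem s')(bX + u := 0)) (X - {vs ! u})"
        using holds_remove[OF h 7(1)] .
      ultimately show ?thesis
        using 7(1,3) e True read_X[OF h] read_L[OF h] by (simp add: env_def)
    qed
  qed (use assms in \<open>auto simp: env_def\<close>)
  then show ?thesis by (simp add: Check_minimal_def)
qed

lemma not_removable_iff_mext:
  assumes "I \<subseteq> X" "X \<subseteq> I \<union> L" "cds E V X"
  shows "(\<forall>j<n. \<not> removable X j) \<longleftrightarrow> mext (X \<inter> L)"
proof -
  have X: "I \<union> X \<inter> L = X" using assms by auto
  have X': "I \<union> (X \<inter> L - {v}) = X - {v}" if "v \<in> X \<inter> L" for v
    using assms that disj by auto
  have "(\<forall>j<n. \<not> removable X j) \<longleftrightarrow> (\<forall>v\<in>X \<inter> L. \<not> cds E V (X - {v}))"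
    unfolding removable_def using index_exists V_eq by (metis IntD2 UnI1)
  then show ?thesis unfolding mext_iff using X X' assms(3) by auto
qed

lemma wp_Leaf:
  assumes "env s" "holds (mem s) X" "I \<subseteq> X" "X \<subseteq> I \<union> L" "cds E V X"
  shows "wp n Leaf (\<lambda>s'. holds (mem s') X \<and>
    out s' = out s @ (if mext (X \<inter> L) then encode_set vs (X \<inter> L) else [])) s"
proof -
  have XV: "X \<subseteq> V" using assms V_eq by auto
  have "wp n Check_minimal (wp n (When rMIN Print_set) (\<lambda>s'. holds (mem s') X \<and>
    out s' = out s @ (if mext (X \<inter> L) then encode_set vs (X \<inter> L) else []))) s"
  proof (rule wp_conseq[OF wp_Check_minimal[OF assms(1,2) XV]], goal_cases)
    case (1 t)
    have t: "env t" by (rule env_frame[OF assms(1) 1(2)]) auto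
    have h: "holds (mem t) X" using 1 by simp
    have o: "out t = out s" using 1(2) by (simp add: frame_def)
    have z: "reg t rZ = 0" using t by (simp add: env_def)
    show ?case
    proof (cases "mext (X \<inter> L)")
      case True
      have "wp n Print_set (\<lambda>s'. holds (mem s') X \<and> out s' = out s @ encode_set vs (X \<inter> L)) t"
        by (rule wp_conseq[OF wp_Print_set[OF t h]]) (use h o in \<open>auto simp: frame_def\<close>)
      then show ?thesis using True 1(1) z not_removable_iff_mext[OF assms(3-5)] by simp
    next
      case False
      then show ?thesis using 1(1) z h o not_removable_iff_mext[OF assms(3-5)] by simp
    qed
  qed
  then show ?thesis by (simp add: Leaf_def)
qed

text \<open>This is what \<open>Eval\<close> leaves in \<open>rD\<close> when run on
  \<open>I\<close>. It exceeds the bound of \<open>card_mext_le\<close> by one for nonempty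
  \<open>I\<close> and equals \<open>card V\<close> for empty \<open>I\<close>.\<close>

definition size_cap :: nat where
  "size_cap = ncomp E I + card (undom E V I)"

definition viable :: "nat \<Rightarrow> 'a set \<Rightarrow> bool" where
  "viable p X \<longleftrightarrow> cds E V X \<and> card {j. j < p \<and> vs ! j \<in> X \<inter> L} \<le> size_cap"

definition at_node :: "state \<Rightarrow> nat \<Rightarrow> 'a set \<Rightarrow> nat \<Rightarrow> bool" where
  "at_node s p X d \<longleftrightarrow> env s \<and> holds (mem s) X \<and> reg s rP = p \<and> reg s rDOWN = d \<and>
     reg s rRUN = 1 \<and> reg s rM = Suc size_cap"

text \<open>The search turns round at rejected nodes and at leaves. In the second alternative
  \<open>p < n\<close> means that \<open>X\<close> is not viable, so output occurs only at
  leaves.\<close>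

lemma wp_Body_down:
  assumes "at_node s p X 1" "p \<le> n" "I \<subseteq> X" "X \<subseteq> I \<union> L"
  shows "wp n Body (\<lambda>s'. if viable p X \<and> p < n then at_node s' (Suc p) X 1 \<and> out s' = out s
    else at_node s' p X 0 \<and>
      out s' = out s @ (if viable p X \<and> mext (X \<inter> L) then encode_set vs (X \<inter> L) else [])) s"
    (is "wp n Body ?Q s")
proof -
  have s: "env s" "holds (mem s) X" "reg s rP = p" "reg s rDOWN = 1" "reg s rRUN = 1"
    "reg s rM = Suc size_cap" using assms(1) by (auto simp: at_node_def)
  have XV: "X \<subseteq> V" using assms V_eq by auto
  let ?D0 = "Const rDOWN 0"
  let ?T = "IfLess rZ rC (IfLess rD rTWO (IfLess rT rM (IfLess rP rN (Inc rP) (Leaf ;; ?D0)) ?D0) ?D0) ?D0"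
  have "wp n Eval (wp n Count_chosen (wp n ?T ?Q)) s"
  proof (rule wp_conseq[OF wp_Eval[OF s(1,2) XV]], goal_cases)
    case (1 s1)
    have e1: "env s1" by (rule env_frame[OF s(1) 1(2)]) auto
    have h1: "holds (mem s1) X" using 1 by simp
    have r1: "reg s1 rP = p" using 1(2) s by (simp add: frame_def)
    have p1: "reg s1 rP \<le> n" using r1 assms by simp
    show ?case
    proof (rule wp_conseq[OF wp_Count_chosen[OF e1 h1 p1]], goal_cases)
      case (1 s2)
      have e2: "env s2" by (rule env_frame[OF e1 1(2)]) auto
      have h2: "holds (mem s2) X" using 1(2) h1 by (simp add: frame_def)
      have o2: "out s2 = out s" using 1(2) \<open>frame Eval s s1\<close> by (simp add: frame_def)
      have r2: "reg s2 rP = p" "reg s2 rDOWN = 1" "reg s2 rRUN = 1" "reg s2 rM = Suc size_cap"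
        "reg s2 rC = reg s1 rC" "reg s2 rD = reg s1 rD"
        using 1(2) \<open>frame Eval s s1\<close> s by (auto simp: frame_def)
      have v: "viable p X \<longleftrightarrow> 0 < reg s2 rC \<and> reg s2 rD < 2 \<and> reg s2 rT < reg s2 rM"
        using cds_iff_counts[OF finV symE XV] 1(1) \<open>holds (mem s1) X \<and> _\<close> r1 r2
        by (auto simp: viable_def)
      show ?case
      proof (cases "viable p X")
        case False
        then show ?thesis using v e2 h2 o2 r2 by (auto simp: env_def at_node_def)
      next
        case True
        show ?thesis
        proof (cases "p < n")
          case True
          then show ?thesis using \<open>viable p X\<close> v e2 h2 o2 r2 by (auto simp: env_def at_node_def)
        next
          case False
          have "cds E V X" using True by (simp add: viable_def)
          have "wp n Leaf (wp n ?D0 ?Q) s2"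
          proof (rule wp_conseq[OF wp_Leaf[OF e2 h2 assms(3,4) \<open>cds E V X\<close>]], goal_cases)
            case (1 s3)
            have e3: "env s3" by (rule env_frame[OF e2 1(2)]) (auto simp: Leaf_def)
            have "reg s3 rP = p" "reg s3 rRUN = 1" "reg s3 rM = Suc size_cap"
              using 1(2) r2 by (auto simp: frame_def Leaf_def)
            then show ?case using 1(1) e3 o2 True False by (auto simp: env_def at_node_def)
          qed
          then show ?thesis using True False v e2 r2 by (simp add: env_def)
        qed
      qed
    qed
  qed
  then show ?thesis using s by (simp add: Body_def Down_def env_def)
qed

lemma wp_Body_up:
  assumes "at_node s (Suc p) X 0" "p < n"
  shows "wp n Body (\<lambda>s'. out s' = out s \<and> (if vs ! p \<in> L
    then if vs ! p \<in> X then at_node s' (Suc p) (X - {vs ! p}) 1 else at_node s' p (insert (vs ! p) X) 0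
    else at_node s' p X 0)) s"
proof -
  have s: "env s" and h: "holds (mem s) X" and r: "reg s rP = Suc p" "reg s rDOWN = 0" "reg s rRUN = 1"
    "reg s rM = Suc size_cap" using assms(1) by (auto simp: at_node_def)
  show ?thesis
    using s h r assms(2) read_X[OF h assms(2)] read_L[OF h assms(2)] holds_remove[OF h assms(2)]
      holds_insert[OF h assms(2)]
    by (auto simp: Body_def Up_def env_def at_node_def)
qed

end

section \<open>The search tree\<close>

text \<open>Continuation form: a halting run from \<open>s'\<close> is extended backwards to one
  from \<open>s\<close>. No run of \<open>WhileLess\<close> has to be cut into segments, and
  subtrees compose by transitivity.\<close>

definition leads :: "nat \<Rightarrow> state \<Rightarrow> state \<Rightarrow> bool" where
  "leads T s s' \<longleftrightarrow> (\<forall>t f. exec Loop s' t f \<longrightarrow> (\<exists>t'\<le>t + T. exec Loop s t' f))"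

lemma leads_trans: "leads T s s' \<Longrightarrow> leads T' s' s'' \<Longrightarrow> leads (T + T') s s''"
  unfolding leads_def
proof (intro allI impI)
  fix t f
  assume a: "\<forall>t f. exec Loop s' t f \<longrightarrow> (\<exists>t'\<le>t + T. exec Loop s t' f)"
    "\<forall>t f. exec Loop s'' t f \<longrightarrow> (\<exists>t'\<le>t + T'. exec Loop s' t' f)" "exec Loop s'' t f"
  then obtain t1 where t1: "t1 \<le> t + T'" "exec Loop s' t1 f" by blast
  then obtain t2 where "t2 \<le> t1 + T" "exec Loop s t2 f" using a(1) by blast
  then show "\<exists>u\<le>t + (T + T'). exec Loop s u f" using t1 by (intro exI[of _ t2]) auto
qed

lemma leads_mono: "leads T s s' \<Longrightarrow> T \<le> T' \<Longrightarrow> leads T' s s'"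
  unfolding leads_def by (meson add_left_mono le_trans)

lemma leads_Body:
  assumes "wp m Body Q s" "reg s rZ < reg s rRUN"
  shows "\<exists>s'. Q s' \<and> leads (1 + cost m Body) s s'"
proof -
  obtain t s' where t: "t \<le> cost m Body" "exec Body s t s'" "Q s'" using wp_sound[OF assms(1)] by blast
  have "leads (1 + cost m Body) s s'"
    unfolding leads_def
  proof (intro allI impI)
    fix t' f assume "exec Loop s' t' f"
    then have "exec Loop s (1 + t + t') f"
      unfolding Loop_def by (intro exec.WhileTrue[OF assms(2) t(2)])
    then show "\<exists>u\<le>t' + (1 + cost m Body). exec Loop s u f" using t(1) by (intro exI[of _ "1 + t + t'"]) auto
  qed
  with t(3) show ?thesis by blast
qed

lemma nth_concat_map_uniform:
  assumes "\<forall>y\<in>set ys. length (f y) = n" "u < length ys" "v < n"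
  shows "concat (map f ys) ! (u * n + v) = f (ys ! u) ! v"
  using assms
proof (induction ys arbitrary: u)
  case (Cons y ys)
  then show ?case by (cases u) (auto simp: nth_append add.assoc)
qed simp

context ram_instance
begin

text \<open>The search without the machine, by recursion on the number of undecided levels. The
  branch that keeps the vertex comes first, as in the printed output.\<close>

primrec sols :: "nat \<Rightarrow> 'a set \<Rightarrow> 'a set list" where
  "sols 0 X = (if viable n X \<and> mext (X \<inter> L) then [X \<inter> L] else [])"
| "sols (Suc d) X = (if viable (n - Suc d) X
     then sols d X @ (if vs ! (n - Suc d) \<in> L then sols d (X - {vs ! (n - Suc d)}) else []) else [])"

text \<open>Rejected nodes are counted too, since rejecting one takes an iteration of the
  loop.\<close>

primrec nodes :: "nat \<Rightarrow> 'a set \<Rightarrow> nat" where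
  "nodes 0 X = 1"
| "nodes (Suc d) X = 1 + (if viable (n - Suc d) X
     then nodes d X + (if vs ! (n - Suc d) \<in> L then nodes d (X - {vs ! (n - Suc d)}) else 0) else 0)"

text \<open>The first \<open>n - d\<close> vertices have been decided.\<close>

definition partial_choice :: "nat \<Rightarrow> 'a set \<Rightarrow> bool" where
  "partial_choice d X \<longleftrightarrow> d \<le> n \<and> I \<subseteq> X \<and> X \<subseteq> I \<union> L \<and>
     (\<forall>j. n - d \<le> j \<longrightarrow> j < n \<longrightarrow> vs ! j \<in> L \<longrightarrow> vs ! j \<in> X)"

lemma partial_choice_keep: "partial_choice (Suc d) X \<Longrightarrow> partial_choice d X"
  by (auto simp: partial_choice_def)

lemma partial_choice_drop:
  assumes "partial_choice (Suc d) X" "vs ! (n - Suc d) \<in> L"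
  shows "partial_choice d (X - {vs ! (n - Suc d)})"
proof -
  have "vs ! j \<noteq> vs ! (n - Suc d)" if "n - d \<le> j" "j < n" for j
    using dist that assms(1) by (auto simp: partial_choice_def nth_eq_iff_index_eq)
  then show ?thesis using assms disj by (auto simp: partial_choice_def)
qed

text \<open>A node causes at most three iterations of its own, one on arrival and one after each of
  its two branches. \<open>X\<close> is restored on return, which lets the parent continue.\<close>

lemma leads_subtree:
  assumes "at_node s (n - d) X 1" "partial_choice d X"
  shows "\<exists>s'. at_node s' (n - d) X 0 \<and> out s' = out s @ concat (map (encode_set vs) (sols d X)) \<and>
    leads (3 * nodes d X * (1 + cost n Body)) s s'"
  using assms
proof (induction d arbitrary: s X)
  case 0
  have g: "reg s rZ < reg s rRUN" using 0(1) by (auto simp: at_node_def env_def)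
  have X: "I \<subseteq> X" "X \<subseteq> I \<union> L" using 0 by (auto simp: partial_choice_def)
  obtain s' where s': "at_node s' n X 0"
    "out s' = out s @ (if viable n X \<and> mext (X \<inter> L) then encode_set vs (X \<inter> L) else [])"
    "leads (1 + cost n Body) s s'"
    using leads_Body[OF wp_Body_down[of s n X] g] 0(1) X by auto
  show ?case
    by (intro exI[of _ s'] conjI leads_mono[OF s'(3)]) (use s' in auto)
next
  case (Suc d)
  let ?c = "1 + cost n Body"
  define p where "p = n - Suc d"
  have p: "p < n" "n - d = Suc p" using Suc.prems by (auto simp: partial_choice_def p_def)
  have g: "reg t rZ < reg t rRUN" if "at_node t q Y e" for t q Y e
    using that by (auto simp: at_node_def env_def)
  have X: "I \<subseteq> X" "X \<subseteq> I \<union> L" using Suc.prems by (auto simp: partial_choice_def)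
  have s: "at_node s p X 1" using Suc.prems by (simp add: p_def)
  show ?case
  proof (cases "viable p X")
    case False
    obtain s' where s': "at_node s' p X 0" "out s' = out s" "leads ?c s s'"
      using leads_Body[OF wp_Body_down[OF s _ X] g[OF s]] False p by auto
    show ?thesis
      by (intro exI[of _ s'] conjI leads_mono[OF s'(3)]) (use s' False in \<open>auto simp: p_def\<close>)
  next
    case True
    obtain s1 where s1: "at_node s1 (Suc p) X 1" "out s1 = out s" "leads ?c s s1"
      using leads_Body[OF wp_Body_down[OF s _ X] g[OF s]] True p by auto
    obtain s2 where s2: "at_node s2 (Suc p) X 0"
      "out s2 = out s1 @ concat (map (encode_set vs) (sols d X))" "leads (3 * nodes d X * ?c) s1 s2"
      using Suc.IH[of s1 X] s1 p partial_choice_keep[OF Suc.prems(2)] by auto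
    show ?thesis
    proof (cases "vs ! p \<in> L")
      case False
      obtain s3 where s3: "at_node s3 p X 0" "out s3 = out s2" "leads ?c s2 s3"
        using leads_Body[OF wp_Body_up[OF s2(1) p(1)] g[OF s2(1)]] False by auto
      have "leads (?c + 3 * nodes d X * ?c + ?c) s s3"
        using s1 s2 s3 leads_trans by blast
      moreover have "?c + 3 * nodes d X * ?c + ?c \<le> 3 * nodes (Suc d) X * ?c"
        using True False by (simp add: p_def algebra_simps)
      ultimately have "leads (3 * nodes (Suc d) X * ?c) s s3" by (rule leads_mono)
      then show ?thesis using s1 s2 s3 True False by (intro exI[of _ s3]) (auto simp: p_def)
    next
      case inL: True
      have inX: "vs ! p \<in> X" using Suc.prems(2) inL p by (auto simp: partial_choice_def p_def)
      let ?Y = "X - {vs ! p}"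
      obtain s3 where s3: "at_node s3 (Suc p) ?Y 1" "out s3 = out s2" "leads ?c s2 s3"
        using leads_Body[OF wp_Body_up[OF s2(1) p(1)] g[OF s2(1)]] inL inX by auto
      obtain s4 where s4: "at_node s4 (Suc p) ?Y 0"
        "out s4 = out s3 @ concat (map (encode_set vs) (sols d ?Y))" "leads (3 * nodes d ?Y * ?c) s3 s4"
        using Suc.IH[of s3 ?Y] s3 p partial_choice_drop[OF Suc.prems(2)] inL by (auto simp: p_def)
      obtain s5 where s5: "at_node s5 p X 0" "out s5 = out s4" "leads ?c s4 s5"
        using leads_Body[OF wp_Body_up[OF s4(1) p(1)] g[OF s4(1)]] inL inX by (auto simp: insert_absorb)
      have "leads (?c + 3 * nodes d X * ?c + ?c + 3 * nodes d ?Y * ?c + ?c) s s5"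
        using s1 s2 s3 s4 s5 leads_trans by blast
      moreover have "?c + 3 * nodes d X * ?c + ?c + 3 * nodes d ?Y * ?c + ?c \<le> 3 * nodes (Suc d) X * ?c"
        using True inL by (simp add: p_def algebra_simps)
      ultimately have "leads (3 * nodes (Suc d) X * ?c) s s5" by (rule leads_mono)
      then show ?thesis using s1 s2 s3 s4 s5 True inL by (intro exI[of _ s5]) (auto simp: p_def)
    qed
  qed
qed

lemma exec_Loop:
  assumes "at_node s 0 (I \<union> L) 1"
  shows "\<exists>t s'. exec Loop s t s' \<and> out s' = out s @ concat (map (encode_set vs) (sols n (I \<union> L))) \<and>
    t \<le> (3 * nodes n (I \<union> L) + 1) * (1 + cost n Body) + 1"
proof -
  obtain s1 where s1: "at_node s1 0 (I \<union> L) 0"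
    "out s1 = out s @ concat (map (encode_set vs) (sols n (I \<union> L)))"
    "leads (3 * nodes n (I \<union> L) * (1 + cost n Body)) s s1"
    using leads_subtree[of s n "I \<union> L"] assms by (auto simp: partial_choice_def)
  have g: "reg s1 rZ < reg s1 rRUN" using s1(1) by (auto simp: at_node_def env_def)
  \<comment> \<open>One last iteration: going up from the root clears \<open>rRUN\<close>.\<close>
  have "wp n Body (\<lambda>s'. out s' = out s1 \<and> \<not> reg s' rZ < reg s' rRUN) s1"
    using s1(1) by (auto simp: Body_def Up_def at_node_def env_def)
  then obtain s2 where s2: "out s2 = out s1" "\<not> reg s2 rZ < reg s2 rRUN" "leads (1 + cost n Body) s1 s2"
    using leads_Body[OF _ g] by blast
  have "exec Loop s2 1 s2" unfolding Loop_def using s2(2) by (rule exec.WhileFalse)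
  moreover have "leads (3 * nodes n (I \<union> L) * (1 + cost n Body) + (1 + cost n Body)) s s2"
    using s1(3) s2(3) by (rule leads_trans)
  ultimately obtain t where "t \<le> 1 + (3 * nodes n (I \<union> L) * (1 + cost n Body) + (1 + cost n Body))"
    "exec Loop s t s2" unfolding leads_def by blast
  then show ?thesis using s1 s2 by (intro exI[of _ t] exI[of _ s2]) (auto simp: algebra_simps)
qed

section \<open>Completeness of the pruned search\<close>

lemma card_mext_le_size_cap: "mext S \<Longrightarrow> card S \<le> size_cap"
proof (cases "I = {}")
  \<comment> \<open>\<open>card_mext_le\<close> does not apply to empty \<open>I\<close>, but then
    every vertex is undominated and the cap is \<open>card V\<close>.\<close>
  case True
  assume "mext S"
  then have "S \<subseteq> V" using V_eq by (auto simp: mext_def)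
  then have "card S \<le> card V" using finV by (intro card_mono)
  then show ?thesis using True unfolding size_cap_def undom_def by simp
next
  case False
  assume "mext S"
  then show ?thesis using card_mext_le[OF False, of S] unfolding size_cap_def by linarith
qed

definition agree :: "nat \<Rightarrow> 'a set \<Rightarrow> 'a set \<Rightarrow> bool" where
  "agree p X S \<longleftrightarrow> (\<forall>j<p. vs ! j \<in> L \<longrightarrow> (vs ! j \<in> S \<longleftrightarrow> vs ! j \<in> X))"

text \<open>Pruning loses no minimal extension: all undecided vertices are in \<open>X\<close>, so
  \<open>S \<subseteq> X\<close> and \<open>cds_superset\<close> applies; the chosen vertices lie in
  \<open>S\<close>, whose size respects the cap.\<close>

lemma viable_if_agree:
  assumes "mext S" "partial_choice d X" "agree (n - d) X S"
  shows "viable (n - d) X"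
proof -
  have S: "S \<subseteq> L" "cds E V (I \<union> S)" using assms(1) by (auto simp: mext_def)
  have "S \<subseteq> X"
  proof
    fix x assume x: "x \<in> S"
    then obtain j where j: "j < n" "vs ! j = x" using index_exists S V_eq by blast
    then show "x \<in> X" using x S assms(2,3) unfolding agree_def partial_choice_def
      by (metis not_le subsetD)
  qed
  then have "cds E V X"
    using assms(2) V_eq by (intro cds_superset[OF symE S(2)]) (auto simp: partial_choice_def)
  moreover have "card {j. j < n - d \<and> vs ! j \<in> X \<inter> L} \<le> card S"
  proof (rule card_inj_on_le[of "(!) vs"])
    show "inj_on ((!) vs) {j. j < n - d \<and> vs ! j \<in> X \<inter> L}"
      using dist by (auto simp: inj_on_def nth_eq_iff_index_eq)
    show "(!) vs ` {j. j < n - d \<and> vs ! j \<in> X \<inter> L} \<subseteq> S" using assms(3) by (auto simp: agree_def)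
    show "finite S" using S finite_parts finite_subset by blast
  qed
  ultimately show ?thesis using card_mext_le_size_cap[OF assms(1)] by (simp add: viable_def)
qed

text \<open>The branches divide the minimal extensions by membership of the vertex being decided,
  which yields completeness and absence of repetitions together.\<close>

lemma set_sols:
  assumes "partial_choice d X"
  shows "set (sols d X) = {S. mext S \<and> agree (n - d) X S} \<and> distinct (sols d X)"
  using assms
proof (induction d arbitrary: X)
  case 0
  have "S = X \<inter> L" if "mext S" "agree n X S" for S
  proof -
    have "S \<subseteq> L" using that by (auto simp: mext_def)
    moreover have "x \<in> S \<longleftrightarrow> x \<in> X" if "x \<in> L" for x
      using index_exists[of x] that \<open>agree n X S\<close> V_eq unfolding agree_def by blast
    ultimately show ?thesis by auto
  qed
  moreover have "agree n X (X \<inter> L)" by (auto simp: agree_def)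
  moreover have "viable n X" if "mext S" "agree n X S" for S
    using viable_if_agree[OF that(1) 0] that by simp
  ultimately show ?case by auto
next
  case (Suc d)
  define p where "p = n - Suc d"
  have p: "p < n" "n - d = Suc p" using Suc.prems by (auto simp: partial_choice_def p_def)
  have keep: "set (sols d X) = {S. mext S \<and> agree (Suc p) X S}" "distinct (sols d X)"
    using Suc.IH[OF partial_choice_keep[OF Suc.prems]] p by auto
  show ?case
  proof (cases "viable p X")
    case False
    then have "\<not> (mext S \<and> agree p X S)" for S
      using viable_if_agree[OF _ Suc.prems] p_def by auto
    then show ?thesis using False by (simp add: p_def)
  next
    case True
    show ?thesis
    proof (cases "vs ! p \<in> L")
      case False
      then have "agree (Suc p) X S \<longleftrightarrow> agree p X S" for S by (auto simp: agree_def less_Suc_eq)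
      then show ?thesis using True False keep by (simp add: p_def)
    next
      case inL: True
      let ?Y = "X - {vs ! p}"
      have inX: "vs ! p \<in> X" using Suc.prems inL p by (auto simp: partial_choice_def p_def)
      have drop: "set (sols d ?Y) = {S. mext S \<and> agree (Suc p) ?Y S}" "distinct (sols d ?Y)"
        using Suc.IH[OF partial_choice_drop[OF Suc.prems]] inL p by (auto simp: p_def)
      have ne: "vs ! j \<noteq> vs ! p" if "j < p" for j
        using dist that p by (auto simp: nth_eq_iff_index_eq)
      have 1: "agree (Suc p) X S \<longleftrightarrow> agree p X S \<and> vs ! p \<in> S" for S
        using inL inX by (auto simp: agree_def less_Suc_eq)
      have 2: "agree (Suc p) ?Y S \<longleftrightarrow> agree p X S \<and> vs ! p \<notin> S" for S
        using inL ne by (auto simp: agree_def less_Suc_eq)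
      have "sols (Suc d) X = sols d X @ sols d ?Y" using True inL by (simp add: p_def)
      then show ?thesis using keep drop 1 2 by (auto simp: p_def)
    qed
  qed
qed

lemma set_sols_all: "set (sols n (I \<union> L)) = {S. mext S}" "distinct (sols n (I \<union> L))"
  using set_sols[of n "I \<union> L"] by (auto simp: partial_choice_def agree_def)

section \<open>Counting the nodes of the search tree\<close>

text \<open>Pairs carry the level because the same set recurs along a path whenever a vertex is
  kept. Leaves are excluded by \<open>q < n\<close> and are charged to their parents.\<close>

definition viable_below :: "nat \<Rightarrow> 'a set \<Rightarrow> (nat \<times> 'a set) set" where
  "viable_below p X = {(q, Y). p \<le> q \<and> q < n \<and> Y \<subseteq> X \<and>
     X - Y \<subseteq> L \<inter> {vs ! j | j. p \<le> j \<and> j < q} \<and> viable q Y}"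

lemma finite_viable_below: "X \<subseteq> V \<Longrightarrow> finite (viable_below p X)"
proof -
  assume "X \<subseteq> V"
  then have "finite X" using finV finite_subset by blast
  moreover have "viable_below p X \<subseteq> {..<n} \<times> Pow X" by (auto simp: viable_below_def)
  ultimately show ?thesis by (meson finite_Pow_iff finite_SigmaI finite_lessThan finite_subset)
qed

text \<open>Every node but the root is a child of a viable inner node, and each of those has at most
  two children.\<close>

lemma nodes_le:
  assumes "X \<subseteq> V" "d \<le> n" "\<And>j. n - d \<le> j \<Longrightarrow> j < n \<Longrightarrow> vs ! j \<in> L \<Longrightarrow> vs ! j \<in> X"
  shows "nodes d X \<le> 1 + 2 * card (viable_below (n - d) X)"
  using assms
proof (induction d arbitrary: X)
  case (Suc d)
  define p where "p = n - Suc d"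
  have p: "p < n" "n - d = Suc p" using Suc.prems by (auto simp: p_def)
  show ?case
  proof (cases "viable p X")
    case True
    have fin: "finite (viable_below p X)" using finite_viable_below Suc.prems by blast
    have self: "(p, X) \<in> viable_below p X" using True p by (auto simp: viable_below_def)
    have keep: "viable_below (Suc p) X \<subseteq> viable_below p X - {(p, X)}"
      by (fastforce simp: viable_below_def)
    have nk: "nodes d X \<le> 1 + 2 * card (viable_below (Suc p) X)"
      using Suc.IH[of X] Suc.prems p by auto
    show ?thesis
    proof (cases "vs ! p \<in> L")
      case False
      have "card (viable_below (Suc p) X) \<le> card (viable_below p X) - 1"
        using card_mono[OF _ keep] fin self by simp
      moreover have "1 \<le> card (viable_below p X)"
        using fin self by (metis One_nat_def Suc_leI card_gt_0_iff empty_iff)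
      ultimately show ?thesis using nk True False by (simp add: p_def[symmetric])
    next
      case inL: True
      let ?Y = "X - {vs ! p}"
      have inX: "vs ! p \<in> X" using Suc.prems inL p by (auto simp: p_def)
      have ne: "vs ! j \<noteq> vs ! p" if "Suc p \<le> j" "j < n" for j
        using dist that p by (auto simp: nth_eq_iff_index_eq)
      have drop: "viable_below (Suc p) ?Y \<subseteq> viable_below p X - {(p, X)}"
        using inL by (fastforce simp: viable_below_def)
      \<comment> \<open>Sets below the first branch still contain \<open>vs ! p\<close>, those below
        the second lack it.\<close>
      have "viable_below (Suc p) X \<inter> viable_below (Suc p) ?Y = {}"
      proof -
        have "vs ! p \<in> Y" if Y: "(q, Y) \<in> viable_below (Suc p) X" for q Y
        proof (rule ccontr)
          assume "vs ! p \<notin> Y"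
          then obtain j where "vs ! p = vs ! j" "Suc p \<le> j" "j < q" "q < n"
            using Y inX unfolding viable_below_def by blast
          then show False using ne[of j] by simp
        qed
        then show ?thesis by (auto simp: viable_below_def)
      qed
      then have "card (viable_below (Suc p) X) + card (viable_below (Suc p) ?Y) =
          card (viable_below (Suc p) X \<union> viable_below (Suc p) ?Y)"
        using fin keep drop by (metis card_Un_disjoint finite_Diff finite_subset)
      also have "\<dots> \<le> card (viable_below p X - {(p, X)})"
        using fin keep drop by (intro card_mono) auto
      also have "\<dots> = card (viable_below p X) - 1" using fin self by simp
      finally have c: "card (viable_below (Suc p) X) + card (viable_below (Suc p) ?Y) \<le>
          card (viable_below p X) - 1" .
      have "nodes d ?Y \<le> 1 + 2 * card (viable_below (n - d) ?Y)"
        by (rule Suc.IH) (use Suc.prems ne p in auto)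
      moreover have "1 \<le> card (viable_below p X)"
        using fin self by (metis One_nat_def Suc_leI card_gt_0_iff empty_iff)
      ultimately show ?thesis using nk c True inL p by (simp add: p_def[symmetric])
    qed
  qed (simp add: p_def)
qed simp

end

section \<open>Initialisation and total running time\<close>

text \<open>The size of the matrix is skipped by adding \<open>n\<close> in a loop of
  \<open>n\<close> rounds, so that no summand exceeds the loop bound.\<close>

definition Set_bases :: com where
  "Set_bases = (Const rONE 1 ;; Const rTWO 2 ;; Load rN rZ ;; Const rBL 2 ;;
     Add rBI rBL rN ;; Add rBI rBI rN ;; Add rBI rBI rN ;; Add rBA rBI rN ;; Add rBA rBA rN ;;
     Copy rBX rBA ;; For rU rN (Add rBX rBX rN) ;; Add rBB rBX rN)"

definition Load_I :: com where
  "Load_I = For rU rN (Get rX rBI rU ;; Put rBX rU rX)"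

definition Load_L :: com where
  "Load_L = For rU rN (Get rX rBL rU ;; When rX (Put rBX rU rONE))"

text \<open>\<open>Eval\<close> runs while the working set is still \<open>I\<close>, so
  \<open>rD\<close> holds the size cap; \<open>rM\<close> is one larger because comparisons are
  strict. Only then is \<open>L\<close> added.\<close>

definition Setup :: com where
  "Setup = (Set_bases ;; Load_I ;; Eval ;; Copy rM rD ;; Inc rM ;; Load_L ;;
     Const rDOWN 1 ;; Const rRUN 1)"

context ram_instance
begin

lemma wp_Set_bases:
  assumes "reg s rZ = 0" "mem s 0 = n"
  shows "wp n Set_bases env s"
proof -
  have "wp n (For rU rN (Add rBX rBX rN)) (wp n (Add rBB rBX rN) env) t"
    if t: "reg t rZ = 0" "reg t rN = n" "reg t rBL = bL" "reg t rBI = bI" "reg t rBA = bA"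
      "reg t rBX = bA" "reg t rONE = 1" "reg t rTWO = 2" for t
  proof (rule wp_For[where n = n and Inv = "\<lambda>j s'. reg s' rBX = bA + j * n"], goal_cases)
    case (7 j s')
    then show ?case using t by (auto simp: frame_def)
  next
    case (9 s')
    then show ?case using t by (auto simp: frame_def env_def bX_def bB_def)
  qed (use t in auto)
  then show ?thesis using assms by (simp add: Set_bases_def bL_def bI_def bA_def)
qed

lemma wp_Load_I:
  assumes "env s" "inp (mem s)"
  shows "wp n Load_I (\<lambda>s'. holds (mem s') I) s"
  unfolding Load_I_def
proof (rule wp_For[where n = n and Inv = "\<lambda>j s'. inp (mem s') \<and>
    (\<forall>i<j. mem s' (bX + i) = of_bool (vs ! i \<in> I))"], goal_cases)
  case (7 j s')
  have "env s'" by (rule env_frame[OF assms(1) 7(4)]) auto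
  moreover have "mem s' (bI + j) = of_bool (vs ! j \<in> I)" using 7(1,2) by (simp add: inp_def)
  ultimately show ?case using 7(1-3) inp_upd[of "bX + j" "mem s'"]
    by (auto simp: env_def less_Suc_eq)
qed (use assms in \<open>auto simp: env_def holds_def\<close>)

lemma wp_Load_L:
  assumes "env s" "holds (mem s) I"
  shows "wp n Load_L (\<lambda>s'. holds (mem s') (I \<union> L)) s"
  unfolding Load_L_def
proof (rule wp_For[where n = n and Inv = "\<lambda>j s'. holds (mem s') (I \<union> {vs ! i | i. i < j \<and> vs ! i \<in> L})"],
    goal_cases)
  case (7 j s')
  have e: "env s'" by (rule env_frame[OF assms(1) 7(4)]) auto
  let ?X = "\<lambda>j. I \<union> {vs ! i | i. i < j \<and> vs ! i \<in> L}"
  have X: "?X (Suc j) = (if vs ! j \<in> L then insert (vs ! j) (?X j) else ?X j)"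
    by (auto simp: less_Suc_eq)
  show ?case
    unfolding X using e 7(1-3) read_L[OF 7(2,1)] holds_insert[OF 7(2,1)] by (auto simp: env_def)
next
  case (9 s')
  have "{vs ! i | i. i < n \<and> vs ! i \<in> L} = L" using index_exists V_eq by blast
  then show ?case using 9(1) by simp
qed (use assms in \<open>auto simp: env_def\<close>)

lemma setup_effects [simp]:
  "writes Set_bases = {rONE, rTWO, rN, rBL, rBI, rBA, rBX, rBB, rU, rK}" "no_store Set_bases"
  "no_print Set_bases" "writes Load_I = {rU, rPT, rK, rX}" "no_print Load_I"
  "writes Load_L = {rU, rPT, rK, rX}" "no_print Load_L"
  by (auto simp: Set_bases_def Load_I_def Load_L_def)

lemma wp_Setup:
  assumes "reg s rZ = 0" "reg s rP = 0" "mem s 0 = n" "inp (mem s)"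
  shows "wp n Setup (\<lambda>s'. at_node s' 0 (I \<union> L) 1 \<and> out s' = out s) s"
proof -
  let ?Q = "\<lambda>s'. at_node s' 0 (I \<union> L) 1 \<and> out s' = out s"
  have "wp n Set_bases (wp n Load_I (wp n Eval (wp n (Copy rM rD ;; Inc rM) (wp n Load_L
    (wp n (Const rDOWN 1 ;; Const rRUN 1) ?Q))))) s"
  proof (rule wp_conseq[OF wp_Set_bases[OF assms(1,3)]], goal_cases)
    case (1 s1)
    have s1: "inp (mem s1)" "reg s1 rP = 0" "out s1 = out s" using 1(2) assms by (auto simp: frame_def)
    show ?case
    proof (rule wp_conseq[OF wp_Load_I[OF 1(1) s1(1)]], goal_cases)
      case (1 s2)
      have e2: "env s2" by (rule env_frame[OF \<open>env s1\<close> 1(2)]) auto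
      have s2: "reg s2 rP = 0" "out s2 = out s" using 1(2) s1 by (auto simp: frame_def)
      have IV: "I \<subseteq> V" using V_eq by auto
      show ?case
      proof (rule wp_conseq[OF wp_Eval[OF e2 1(1) IV]], goal_cases)
        case (1 s3)
        have e3: "env s3" by (rule env_frame[OF e2 1(2)]) auto
        have s3: "reg s3 rP = 0" "out s3 = out s" using 1(2) s2 by (auto simp: frame_def)
        let ?t = "s3\<lparr>reg := (reg s3)(rM := Suc size_cap)\<rparr>"
        have "wp n Load_L (wp n (Const rDOWN 1 ;; Const rRUN 1) ?Q) ?t"
        proof (rule wp_conseq[OF wp_Load_L], goal_cases)
          case (3 s4)
          have "env ?t" using e3 by (simp add: env_def)
          then have e4: "env s4" by (rule env_frame[OF _ 3(2)]) auto
          have "reg s4 rM = Suc size_cap" "reg s4 rP = 0" "out s4 = out s"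
            using 3(2) s3 by (auto simp: frame_def)
          then show ?case using e4 3(1) by (simp add: env_def at_node_def)
        qed (use e3 1(1) in \<open>auto simp: env_def\<close>)
        then show ?case using 1(1) by (simp add: size_cap_def)
      qed
    qed
  qed
  then show ?thesis by (simp add: Setup_def)
qed

lemma initial_memory:
  fixes G :: "'a pair_pre_digraph" and l :: nat and H R :: "'a set"
  assumes "parcs G = E"
  defines "f \<equiv> mem (initial_state (encode_instance vs l G L H R I O'))"
  shows "f 0 = n" "inp f"
proof -
  let ?A = "concat (map (\<lambda>X. map (\<lambda>v. of_bool (v \<in> X)) vs) [L, H, R, I, O']) :: nat list"
  let ?B = "concat (map (\<lambda>u. map (\<lambda>v. of_bool ((u, v) \<in> parcs G)) vs) vs) :: nat list"
  let ?xs = "encode_instance vs l G L H R I O'"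
  have xs: "?xs = [n, l] @ ?A @ ?B" by (simp add: encode_instance_def)
  have lenA: "length ?A = 5 * n" by simp
  have lenB: "length ?B = n * n" by (simp add: length_concat comp_def sum_list_triv)
  have f: "f i = ?xs ! i" if "i < 2 + 5 * n + n * n" for i
    using that lenA lenB unfolding f_def xs initial_state_def by (simp del: concat.simps list.map)
  have fA: "f (2 + k) = ?A ! k" if "k < 5 * n" for k
    using f[of "2 + k"] that lenA unfolding xs by (simp add: nth_append del: concat.simps list.map)
  have fB: "f (2 + 5 * n + k) = ?B ! k" if "k < n * n" for k
    using f[of "2 + 5 * n + k"] that lenA unfolding xs
    by (simp add: nth_append del: concat.simps list.map)
  show "f 0 = n" using f[of 0] unfolding xs by simp
  have A: "?A ! (u * n + v) = of_bool (vs ! v \<in> [L, H, R, I, O'] ! u)" if "u < 5" "v < n" for u v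
    using nth_concat_map_uniform[of "[L, H, R, I, O']" "\<lambda>X. map (\<lambda>v. of_bool (v \<in> X)) vs" n u v] that
    by (simp del: concat.simps list.map)
  have B: "?B ! (u * n + v) = of_bool ((vs ! u, vs ! v) \<in> E)" if "u < n" "v < n" for u v
    using nth_concat_map_uniform[of vs "\<lambda>u. map (\<lambda>v. of_bool ((u, v) \<in> parcs G)) vs" n u v] that assms(1)
    by simp
  show "inp f"
    unfolding inp_def
  proof (intro conjI allI impI)
    fix j assume j: "j < n"
    show "f (bL + j) = of_bool (vs ! j \<in> L)"
      using fA[of j] A[of 0 j] j unfolding bL_def by (simp del: concat.simps list.map)
    show "f (bI + j) = of_bool (vs ! j \<in> I)"
      using fA[of "3 * n + j"] A[of 3 j] j unfolding bI_def
      by (simp add: add.assoc del: concat.simps list.map)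
  next
    fix u v assume uv: "u < n" "v < n"
    then show "f (bA + u * n + v) = of_bool ((vs ! u, vs ! v) \<in> E)"
      using fB[of "u * n + v"] B[of u v] less_mult_add[OF uv] unfolding bA_def by (simp add: add.assoc)
  qed
qed

end

section \<open>Assembling the time bound\<close>

locale ram_good_setting = good_setting + ram_instance
begin

text \<open>On each level \<open>card_search_nodes_le\<close> applies, with \<open>Q\<close> the
  vertices of \<open>L\<close> among the first \<open>q\<close>; summing over the levels gives the
  factor \<open>n\<close>.\<close>

lemma card_viable_below_le:
  "real (card (viable_below 0 (I \<union> L))) \<le> real n * (2 * enum_bound l (card L))"
proof -
  let ?Q = "\<lambda>q. L \<inter> {vs ! j | j. j < q}"
  let ?F = "\<lambda>q. {Y. Y \<subseteq> I \<union> L \<and> (I \<union> L) - Y \<subseteq> ?Q q \<and> cds E V Y \<and>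
      card (Y \<inter> ?Q q) \<le> ncomp E I + card (undom E V I)}"
  have fin: "finite (?F q)" for q using finite_parts by simp
  have c: "card {j. j < q \<and> vs ! j \<in> Y \<inter> L} = card (Y \<inter> ?Q q)" if "q < n" for q Y
  proof (rule bij_betw_same_card[of "(!) vs"])
    show "bij_betw ((!) vs) {j. j < q \<and> vs ! j \<in> Y \<inter> L} (Y \<inter> ?Q q)"
      using dist that by (auto simp: bij_betw_def inj_on_def nth_eq_iff_index_eq)
  qed
  have "viable_below 0 (I \<union> L) \<subseteq> (SIGMA q:{..<n}. ?F q)"
    using c by (auto simp: viable_below_def viable_def size_cap_def)
  then have "card (viable_below 0 (I \<union> L)) \<le> card (SIGMA q:{..<n}. ?F q)"
    using fin by (intro card_mono) auto
  also have "\<dots> = (\<Sum>q<n. card (?F q))" using fin by (intro card_SigmaI) auto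
  finally have "real (card (viable_below 0 (I \<union> L))) \<le> (\<Sum>q<n. real (card (?F q)))"
    by (simp only: of_nat_sum[symmetric] of_nat_le_iff)
  also have "\<dots> \<le> (\<Sum>q<n. 2 * enum_bound l (card L))"
    by (intro sum_mono card_search_nodes_le) auto
  finally show ?thesis by simp
qed

lemma real_nodes_le: "real (nodes n (I \<union> L)) \<le> 1 + 4 * real n * enum_bound l (card L)"
proof -
  have "nodes n (I \<union> L) \<le> 1 + 2 * card (viable_below 0 (I \<union> L))"
    using nodes_le[of "I \<union> L" n] V_eq by auto
  then have "real (nodes n (I \<union> L)) \<le> 1 + 2 * real (card (viable_below 0 (I \<union> L)))" by linarith
  then show ?thesis using card_viable_below_le by (simp add: algebra_simps)
qed

lemma computes_listing:
  assumes "parcs G = E"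
  shows "\<exists>t. computes_in_time (Setup ;; Loop) (encode_instance vs l G L H R I O')
      (concat (map (encode_set vs) (sols n (I \<union> L)))) t \<and>
    t \<le> cost n Setup + ((3 * nodes n (I \<union> L) + 1) * (1 + cost n Body) + 1)"
proof -
  let ?s = "initial_state (encode_instance vs l G L H R I O')"
  have "wp n Setup (\<lambda>s'. at_node s' 0 (I \<union> L) 1 \<and> out s' = out ?s) ?s"
    using initial_memory[OF assms, of l H R] by (intro wp_Setup) (auto simp: initial_state_def)
  from wp_sound[OF this] obtain t s1 where 1: "t \<le> cost n Setup" "exec Setup ?s t s1"
    "at_node s1 0 (I \<union> L) 1" "out s1 = out ?s" by blast
  have o: "out ?s = []" by (simp add: initial_state_def)
  obtain t' s2 where 2: "exec Loop s1 t' s2"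
    "out s2 = out s1 @ concat (map (encode_set vs) (sols n (I \<union> L)))"
    "t' \<le> (3 * nodes n (I \<union> L) + 1) * (1 + cost n Body) + 1"
    using exec_Loop[OF 1(3)] by blast
  have "exec (Setup ;; Loop) ?s (t + t') s2" using 1(2) 2(1) by (rule exec.Seq)
  then show ?thesis
    unfolding computes_in_time_def using 1 2 o by (intro exI[of _ "t + t'"]) (auto intro!: add_mono)
qed

lemma time_bound:
  assumes a: "cost n Setup \<le> max 2 n ^ a" and b: "cost n Body \<le> max 2 n ^ b"
    and t: "t \<le> cost n Setup + ((3 * nodes n (I \<union> L) + 1) * (1 + cost n Body) + 1)"
  shows "real t \<le> enum_bound l (card L) * real (max 2 n) ^ (a + b + 7)"
proof -
  define x where "x = real (max 2 n)"
  define B where "B = enum_bound l (card L)"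
  have x: "2 \<le> x" "real n \<le> x" by (auto simp: x_def)
  have B: "1 \<le> B" unfolding B_def using l1 by (rule one_le_enum_bound)
  have S: "real (cost n Setup) \<le> x ^ a" and D: "real (cost n Body) \<le> x ^ b"
    using a b by (metis of_nat_le_iff of_nat_power x_def)+
  have xB: "1 \<le> x * B" using x B mult_mono[of 1 x 1 B] by simp
  have xb: "1 \<le> x ^ b" "1 \<le> x ^ a" using x by (auto intro: one_le_power)
  have "real (nodes n (I \<union> L)) \<le> 1 + 4 * real n * B" using real_nodes_le by (simp add: B_def)
  also have "real n * B \<le> x * B" using x B by (intro mult_right_mono) auto
  then have "1 + 4 * real n * B \<le> 5 * (x * B)" using xB by linarith
  finally have "3 * real (nodes n (I \<union> L)) + 1 \<le> 16 * (x * B)" using xB by linarith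
  then have "(3 * real (nodes n (I \<union> L)) + 1) * (1 + real (cost n Body)) \<le> (16 * (x * B)) * (2 * x ^ b)"
    using D xb xB by (intro mult_mono) auto
  moreover have "real t \<le> real (cost n Setup + ((3 * nodes n (I \<union> L) + 1) * (1 + cost n Body) + 1))"
    using t by (simp only: of_nat_le_iff)
  ultimately have "real t \<le> x ^ a + 32 * (x ^ Suc b * B) + 1"
    using S by (simp add: algebra_simps)
  moreover have "x ^ a \<le> x ^ (a + b + 1) * B"
    using x B mult_mono[of "x ^ a" "x ^ (a + b + 1)" 1 B] power_increasing[of a "a + b + 1" x] by simp
  moreover have "x ^ Suc b * B \<le> x ^ (a + b + 1) * B"
    using x B by (intro mult_right_mono power_increasing) auto
  moreover have "1 \<le> x ^ (a + b + 1) * B"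
    using x B mult_mono[of 1 "x ^ (a + b + 1)" 1 B] one_le_power[of x "a + b + 1"] by simp
  \<comment> \<open>The summands contribute 1 + 32 + 1. Since 34 \<le> 2^6 \<le> x^6, the exponent
    rises from \<open>a + b + 1\<close> to \<open>a + b + 7\<close>.\<close>
  ultimately have "real t \<le> 34 * (x ^ (a + b + 1) * B)" by linarith
  also have "\<dots> \<le> x ^ 6 * (x ^ (a + b + 1) * B)"
    using power_mono[of 2 x 6] x B by (intro mult_right_mono) auto
  also have "\<dots> = B * x ^ (a + b + 7)" by (simp add: power_add eval_nat_numeral)
  finally show ?thesis by (simp add: B_def x_def)
qed

end

section \<open>Transfer to graphs and good partitions\<close>

lemma good_partition_good_setting:
  assumes "l \<ge> 1" "pair_graph G" "good_partition l G L H R" "I \<union> O' = H \<union> R" "I \<inter> O' = {}"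
  shows "good_setting (pverts G) (parcs G) L I O' H R l"
proof -
  interpret pair_graph G by fact
  have "sym (parcs G)" using sym_arcs by (simp add: symmetric_def)
  then show ?thesis
    using assms pair_finite_verts
    by unfold_locales (auto simp: good_partition_def)
qed

lemma (in extension_setting) minimal_extension_iff_mext:
  assumes "pair_graph G" "pverts G = V" "parcs G = E"
  shows "minimal_extension G I O' S \<longleftrightarrow> mext S"
proof -
  have ext: "extension G I O' T \<longleftrightarrow> T \<subseteq> L \<and> cds E V (I \<union> T)" for T
    unfolding extension_def connected_dominating_set_iff_cds[OF assms(1)] assms(2,3)
    using V_eq disj by blast
  have "T \<subseteq> L" if "S \<subseteq> L" "T \<subset> S" for T using that by auto
  then show ?thesis unfolding minimal_extension_def mext_def ext by (simp cong: conj_cong imp_cong)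
qed

theorem lemma12:
  shows "(\<forall>l (G :: 'a pair_pre_digraph) L H R I O'.
            l \<ge> 1 \<longrightarrow> pair_graph G \<longrightarrow> good_partition l G L H R \<longrightarrow>
            I \<union> O' = H \<union> R \<longrightarrow> I \<inter> O' = {} \<longrightarrow>
            finite {S. minimal_extension G I O' S} \<and>
            real (card {S. minimal_extension G I O' S})
              \<le> 2 ^ card L * exp (- (real (card L) / (2 ^ (10 * l) * 100 * real l ^ 2)))) \<and>
         (\<exists>P c. \<forall>l (G :: 'a pair_pre_digraph) L H R I O' vs.
            l \<ge> 1 \<longrightarrow> pair_graph G \<longrightarrow> good_partition l G L H R \<longrightarrow>
            I \<union> O' = H \<union> R \<longrightarrow> I \<inter> O' = {} \<longrightarrow>
            distinct vs \<longrightarrow> set vs = pverts G \<longrightarrow>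
            (\<exists>ys t. computes_in_time P (encode_instance vs l G L H R I O') ys t \<and>
               is_listing vs {S. minimal_extension G I O' S} ys \<and>
               real t \<le> 2 ^ card L * exp (- (real (card L) / (2 ^ (10 * l) * 100 * real l ^ 2)))
                         * real (max 2 (card (pverts G))) ^ c))"
proof
  show "\<forall>l (G :: 'a pair_pre_digraph) L H R I O'.
            l \<ge> 1 \<longrightarrow> pair_graph G \<longrightarrow> good_partition l G L H R \<longrightarrow>
            I \<union> O' = H \<union> R \<longrightarrow> I \<inter> O' = {} \<longrightarrow>
            finite {S. minimal_extension G I O' S} \<and>
            real (card {S. minimal_extension G I O' S})
              \<le> 2 ^ card L * exp (- (real (card L) / (2 ^ (10 * l) * 100 * real l ^ 2)))"
  proof (intro allI impI)
    fix l and G :: "'a pair_pre_digraph" and L H R I O'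
    assume a: "l \<ge> 1" "pair_graph G" "good_partition l G L H R" "I \<union> O' = H \<union> R" "I \<inter> O' = {}"
    interpret good_setting "pverts G" "parcs G" L I O' H R l
      using good_partition_good_setting[OF a] .
    show "finite {S. minimal_extension G I O' S} \<and> real (card {S. minimal_extension G I O' S})
        \<le> 2 ^ card L * exp (- (real (card L) / (2 ^ (10 * l) * 100 * real l ^ 2)))"
      using card_mext_family_le unfolding minimal_extension_iff_mext[OF a(2) refl refl] enum_bound_def .
  qed
next
  \<comment> \<open>The exponents are fixed before the instance, so one program and one
    \<open>c\<close> serve all \<open>l\<close> and \<open>G\<close>.\<close>
  obtain i where i: "\<forall>m. cost m Setup \<le> max 2 m ^ i" using cost_polynomial by blast
  obtain j where j: "\<forall>m. cost m Body \<le> max 2 m ^ j" using cost_polynomial by blast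
  show "\<exists>P c. \<forall>l (G :: 'a pair_pre_digraph) L H R I O' vs.
            l \<ge> 1 \<longrightarrow> pair_graph G \<longrightarrow> good_partition l G L H R \<longrightarrow>
            I \<union> O' = H \<union> R \<longrightarrow> I \<inter> O' = {} \<longrightarrow>
            distinct vs \<longrightarrow> set vs = pverts G \<longrightarrow>
            (\<exists>ys t. computes_in_time P (encode_instance vs l G L H R I O') ys t \<and>
               is_listing vs {S. minimal_extension G I O' S} ys \<and>
               real t \<le> 2 ^ card L * exp (- (real (card L) / (2 ^ (10 * l) * 100 * real l ^ 2)))
                         * real (max 2 (card (pverts G))) ^ c)"
  proof (rule exI[of _ "Setup ;; Loop"], rule exI[of _ "i + j + 7"], intro allI impI)
    fix l and G :: "'a pair_pre_digraph" and L H R I O' and vs :: "'a list"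
    assume a: "l \<ge> 1" "pair_graph G" "good_partition l G L H R" "I \<union> O' = H \<union> R" "I \<inter> O' = {}"
      and vs: "distinct vs" "set vs = pverts G"
    interpret good_setting "pverts G" "parcs G" L I O' H R l
      using good_partition_good_setting[OF a] .
    interpret ram_good_setting "pverts G" "parcs G" L I O' H R l vs
      by unfold_locales (use vs in auto)
    obtain t where t: "computes_in_time (Setup ;; Loop) (encode_instance vs l G L H R I O')
        (concat (map (encode_set vs) (sols n (I \<union> L)))) t"
      "t \<le> cost n Setup + ((3 * nodes n (I \<union> L) + 1) * (1 + cost n Body) + 1)"
      using computes_listing[OF refl] by blast
    have "is_listing vs {S. minimal_extension G I O' S} (concat (map (encode_set vs) (sols n (I \<union> L))))"
      unfolding is_listing_def minimal_extension_iff_mext[OF a(2) refl refl] using set_sols_all by blast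
    moreover have "card (pverts G) = n" using vs distinct_card by metis
    ultimately show "\<exists>ys t. computes_in_time (Setup ;; Loop) (encode_instance vs l G L H R I O') ys t \<and>
        is_listing vs {S. minimal_extension G I O' S} ys \<and>
        real t \<le> 2 ^ card L * exp (- (real (card L) / (2 ^ (10 * l) * 100 * real l ^ 2)))
          * real (max 2 (card (pverts G))) ^ (i + j + 7)"
      using t time_bound[OF i[rule_format] j[rule_format] t(2)] unfolding enum_bound_def by auto
  qed
qed

end
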